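(* Let $H\in(0,1/2)$ and let $\mu^H$ be the probability measure on $[0,\tfrac12]$ with density $(1-2H)2^{1-2H}p^{-2H}$. Let $(Y^{\mu^H,i})_{i\ge1}$ be a sequence of independent processes each of law $Q^{\mu^H}$, and let $c_H=\sqrt{\frac{2H}{\Gamma(2-2H)}}$. Then $$\mathcal{L}^{\mathcal{D}}\lim_{N\to\infty}\ \mathcal{L}\lim_{M\to\infty}\ c_H\,\frac{Y^{\mu^H,1}_{[Nt]}+\cdots+Y^{\mu^H,M}_{[Nt]}}{N^H\sqrt{M}}=B_H(t),$$ i.e. for each fixed $N\ge1$ the processes $\big(c_H\frac{Y^{\mu^H,1}_{[Nt]}+\cdots+Y^{\mu^H,M}_{[Nt]}}{N^H\sqrt M}\big)_{t\in[0,1]}$ converge as $M\to\infty$, in the sense of finite-dimensional distributions, to a process $Z_N$, and as $N\to\infty$ the processes $Z_N$ converge weakly, in the Skorohod topology on $D[0,1]$, to $(B_H(t))_{t\in[0,1]}$.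
   Context: For $p\in[0,1]$, the alternating correlated random walk $\tilde X^p=(\tilde X^p_n)_{n\ge0}$ with persistence $p$ is the $\mathbb{Z}$-valued process such that: $\tilde X_0^p=0$, $P(\tilde X_1^p=1)=P(\tilde X_1^p=-1)=1/2$; for all $n\ge1$, $\tilde\varepsilon_n^p:=\tilde X_n^p-\tilde X_{n-1}^p$ equals $1$ or $-1$ a.s.; for all $n\ge1$, $P(\tilde\varepsilon_{2n}^p=\tilde\varepsilon_{2n-1}^p\mid\sigma(\tilde X_k^p,0\le k\le 2n-1))=p$; and for all $n\ge1$, $\tilde\varepsilon_{2n+1}^p=-\tilde\varepsilon_{2n}^p$. For $p\in(0,1]$ let $Y_n^p:=\frac{\tilde X_{2n}^p}{2\sqrt p}$, $n\ge0$, and let $Q^p$ be the law of the process $Y^p=(Y^p_n)_{n\ge0}$ on real sequences. For a probability measure $\mu$ on $[0,1]$ with $\mu(\{0\})=0$, $Q^\mu:=\int_0^1Q^p\,d\mu(p)$ (annealed law: $p$ is drawn once according to $\mu$ for the whole process). $[x]$ denotes the integer part of $x$. $B_H$ is the fractional Brownian motion with index $H$: the continuous centered Gaussian process with covariance $E[B_H(s)B_H(t)]=\frac12(s^{2H}+t^{2H}-|s-t|^{2H})$. $D[0,1]$ is the space of cadlag functions on $[0,1]$; $\mathcal{L}$ denotes convergence of finite-dimensional distributions and $\mathcal{L}^{\mathcal{D}}$ denotes weak convergence in the Skorohod topology on $D[0,1]$. *)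

theory Defs
  imports "HOL-Probability.Probability"
begin

definition walk_step :: "(nat \<Rightarrow> 'a \<Rightarrow> int) \<Rightarrow> nat \<Rightarrow> 'a \<Rightarrow> int" where
  "walk_step X n \<omega> = X n \<omega> - X (n - 1) \<omega>"

definition walk_history :: "'a measure \<Rightarrow> (nat \<Rightarrow> 'a \<Rightarrow> int) \<Rightarrow> nat \<Rightarrow> 'a measure" where
  "walk_history M X m =
     sigma (space M) (\<Union>k\<le>m. sets (vimage_algebra (space M) (X k) (count_space UNIV)))"

definition alternating_crw :: "real \<Rightarrow> 'a measure \<Rightarrow> (nat \<Rightarrow> 'a \<Rightarrow> int) \<Rightarrow> bool" where
  "alternating_crw p M X \<longleftrightarrow>
     prob_space M \<and>
     (\<forall>n. X n \<in> M \<rightarrow>\<^sub>M count_space UNIV) \<and>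
     (AE \<omega> in M. X 0 \<omega> = 0) \<and>
     \<P>(\<omega> in M. X 1 \<omega> = 1) = 1 / 2 \<and>
     \<P>(\<omega> in M. X 1 \<omega> = - 1) = 1 / 2 \<and>
     (\<forall>n\<ge>1. AE \<omega> in M. walk_step X n \<omega> = 1 \<or> walk_step X n \<omega> = - 1) \<and>
     (\<forall>n\<ge>1. AE \<omega> in M.
        real_cond_exp M (walk_history M X (2 * n - 1))
          (indicator {\<omega> \<in> space M. walk_step X (2 * n) \<omega> = walk_step X (2 * n - 1) \<omega>}) \<omega> = p) \<and>
     (\<forall>n\<ge>1. AE \<omega> in M. walk_step X (2 * n + 1) \<omega> = - walk_step X (2 * n) \<omega>)"

text \<open>The defining properties determine the law of the walk, for \<open>0 \<le> p \<le> 1\<close>: it is the unique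
  measure on integer sequences under which the coordinate process is such a walk.\<close>

definition crw_law :: "real \<Rightarrow> (nat \<Rightarrow> int) measure" where
  "crw_law p = (THE \<nu>. sets \<nu> = sets (\<Pi>\<^sub>M n\<in>UNIV. count_space UNIV) \<and>
                        alternating_crw p \<nu> (\<lambda>n x. x n))"

abbreviation seq_space :: "(nat \<Rightarrow> real) measure" where
  "seq_space \<equiv> (\<Pi>\<^sub>M n\<in>UNIV. borel)"

text \<open>For \<open>p = 0\<close> division by zero gives the zero process; the mixing measures below do not
  charge this point.\<close>

definition Q_law :: "real \<Rightarrow> (nat \<Rightarrow> real) measure" where
  "Q_law p = distr (crw_law p) seq_space (\<lambda>x n. real_of_int (x (2 * n)) / (2 * sqrt p))"

definition Q_mix :: "real measure \<Rightarrow> (nat \<Rightarrow> real) measure" where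
  "Q_mix \<mu> = \<mu> \<bind> Q_law"

definition mu_H :: "real \<Rightarrow> real measure" where
  "mu_H H = density (restrict_space lborel {0..1/2})
     (\<lambda>p. ennreal ((1 - 2 * H) * 2 powr (1 - 2 * H) * p powr (- 2 * H)))"

definition c_H :: "real \<Rightarrow> real" where
  "c_H H = sqrt (2 * H / Gamma (2 - 2 * H))"

text \<open>Degenerate normal laws are Gaussian.\<close>

definition gaussian_law :: "real measure \<Rightarrow> bool" where
  "gaussian_law \<nu> \<longleftrightarrow>
     (\<exists>m. \<nu> = return borel m) \<or>
     (\<exists>m \<sigma>. \<sigma> > 0 \<and> \<nu> = density lborel (\<lambda>x. ennreal (normal_density m \<sigma> x)))"

definition gaussian_process :: "'a measure \<Rightarrow> real set \<Rightarrow> (real \<Rightarrow> 'a \<Rightarrow> real) \<Rightarrow> bool" where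
  "gaussian_process M T B \<longleftrightarrow>
     (\<forall>t\<in>T. B t \<in> borel_measurable M) \<and>
     (\<forall>J a. finite J \<and> J \<subseteq> T \<longrightarrow>
        gaussian_law (distr M borel (\<lambda>\<omega>. \<Sum>t\<in>J. a t * B t \<omega>)))"

definition fractional_brownian_motion ::
  "real \<Rightarrow> real set \<Rightarrow> 'a measure \<Rightarrow> (real \<Rightarrow> 'a \<Rightarrow> real) \<Rightarrow> bool" where
  "fractional_brownian_motion H T M B \<longleftrightarrow>
     prob_space M \<and>
     gaussian_process M T B \<and>
     (\<forall>t\<in>T. (\<integral>\<omega>. B t \<omega> \<partial>M) = 0) \<and>
     (\<forall>s\<in>T. \<forall>t\<in>T. (\<integral>\<omega>. B s \<omega> * B t \<omega> \<partial>M) =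
        (s powr (2 * H) + t powr (2 * H) - \<bar>s - t\<bar> powr (2 * H)) / 2) \<and>
     (\<forall>\<omega>\<in>space M. continuous_on T (\<lambda>t. B t \<omega>))"

text \<open>Paths are extended by \<^const>\<open>undefined\<close> outside the unit interval, so that equality of
  elements is equality on \<open>[0,1]\<close>.\<close>

definition cadlag_paths :: "(real \<Rightarrow> real) set" where
  "cadlag_paths = {x \<in> extensional {0..1}.
     (\<forall>t\<in>{0..<1}. (x \<longlongrightarrow> x t) (at_right t)) \<and>
     (\<forall>t\<in>{0<..1}. \<exists>l. (x \<longlongrightarrow> l) (at_left t))}"

definition time_changes :: "(real \<Rightarrow> real) set" where
  "time_changes = {l. strict_mono_on {0..1} l \<and> continuous_on {0..1} l \<and> l ` {0..1} = {0..1}}"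

definition skorohod_bounds :: "(real \<Rightarrow> real) \<Rightarrow> (real \<Rightarrow> real) \<Rightarrow> real set" where
  "skorohod_bounds x y = {e. \<exists>l\<in>time_changes. \<forall>t\<in>{0..1}. \<bar>l t - t\<bar> \<le> e \<and> \<bar>x t - y (l t)\<bar> \<le> e}"

text \<open>The value outside \<^const>\<open>cadlag_paths\<close> is only there because \<^locale>\<open>Metric_space\<close> requires
  nonnegativity and symmetry on the whole type.\<close>

definition skorohod_dist :: "(real \<Rightarrow> real) \<Rightarrow> (real \<Rightarrow> real) \<Rightarrow> real" where
  "skorohod_dist x y =
     (if x \<in> cadlag_paths \<and> y \<in> cadlag_paths then Inf (skorohod_bounds x y) else 0)"

lemma id_time_change: "(\<lambda>t. t) \<in> time_changes"
  by (auto simp: time_changes_def strict_mono_on_def)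

lemma time_change_mem:
  assumes "l \<in> time_changes" "t \<in> {0..1}" shows "l t \<in> {0..1}"
  using assms unfolding time_changes_def by blast

lemma time_change_at_1:
  assumes l: "l \<in> time_changes" shows "l 1 = 1"
proof -
  have "(1::real) \<in> l ` {0..1}" using l by (auto simp: time_changes_def)
  then obtain s where s: "s \<in> {0..1}" "l s = 1" by auto
  have "s = 1"
  proof (rule ccontr)
    assume "s \<noteq> 1"
    then have "l s < l 1"
      using l s by (intro strict_mono_onD[of "{0..1}" l]) (auto simp: time_changes_def)
    then show False using s time_change_mem[OF l, of 1] by auto
  qed
  then show ?thesis using s by simp
qed

lemma skorohod_boundsI:
  assumes "l \<in> time_changes"
    and "\<And>t. t \<in> {0..1} \<Longrightarrow> \<bar>l t - t\<bar> \<le> e \<and> \<bar>x t - y (l t)\<bar> \<le> e"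
  shows "e \<in> skorohod_bounds x y"
  unfolding skorohod_bounds_def mem_Collect_eq using assms by (intro bexI[of _ l] ballI)

lemma skorohod_bounds_nonneg: "e \<in> skorohod_bounds x y \<Longrightarrow> 0 \<le> e"
  unfolding skorohod_bounds_def by (force dest: bspec[where x = 0])

lemma skorohod_bounds_bdd_below: "bdd_below (skorohod_bounds x y)"
  by (rule bdd_belowI[where m = 0]) (rule skorohod_bounds_nonneg)

lemma skorohod_bounds_swap:
  assumes "e \<in> skorohod_bounds x y" shows "e \<in> skorohod_bounds y x"
proof -
  obtain l where l: "l \<in> time_changes"
    and b: "\<And>t. t \<in> {0..1} \<Longrightarrow> \<bar>l t - t\<bar> \<le> e \<and> \<bar>x t - y (l t)\<bar> \<le> e"
    using assms by (auto simp: skorohod_bounds_def)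
  have sm: "strict_mono_on {0..1} l" and co: "continuous_on {0..1} l"
    and im: "l ` {0..1} = {0..1}"
    using l by (auto simp: time_changes_def)
  have inj: "inj_on l {0..1}" using sm by (rule strict_mono_on_imp_inj_on)
  define g where "g = inv_into {0..1} l"
  have gl: "g (l t) = t" if "t \<in> {0..1}" for t
    using inj that by (simp add: g_def)
  have lg: "l (g s) = s" "g s \<in> {0..1}" if "s \<in> {0..1}" for s
    using that im f_inv_into_f[of s l "{0..1}"] inv_into_into[of s l "{0..1}"] by (auto simp: g_def)
  have "strict_mono_on {0..1} g"
  proof (rule strict_mono_onI)
    fix r s :: real assume rs: "r \<in> {0..1}" "s \<in> {0..1}" "r < s"
    show "g r < g s"
    proof (rule ccontr)
      assume "\<not> g r < g s"
      then have "l (g s) \<le> l (g r)"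
        using sm lg[OF rs(1)] lg[OF rs(2)]
        by (metis linorder_not_less order_le_less strict_mono_onD)
      then show False using lg[OF rs(1)] lg[OF rs(2)] rs(3) by simp
    qed
  qed
  moreover have "continuous_on {0..1} g"
    using continuous_on_inv[OF co, of g] gl im by simp
  moreover have "g ` {0..1} = {0..1}"
  proof
    show "g ` {0..1} \<subseteq> {0..1}" using lg by blast
    show "{0..1} \<subseteq> g ` {0..1}"
    proof
      fix t :: real assume t: "t \<in> {0..1}"
      then show "t \<in> g ` {0..1}" using gl[OF t] time_change_mem[OF l t] by (metis imageI)
    qed
  qed
  ultimately have g: "g \<in> time_changes" by (simp add: time_changes_def)
  have "\<bar>g s - s\<bar> \<le> e \<and> \<bar>y s - x (g s)\<bar> \<le> e" if "s \<in> {0..1}" for s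
    using b[OF lg(2)[OF that]] lg(1)[OF that] by (auto simp: abs_minus_commute)
  then show ?thesis by (rule skorohod_boundsI[OF g])
qed

lemma skorohod_bounds_trans:
  assumes "e \<in> skorohod_bounds x y" "e' \<in> skorohod_bounds y z"
  shows "e + e' \<in> skorohod_bounds x z"
proof -
  obtain l where l: "l \<in> time_changes"
    and b: "\<And>t. t \<in> {0..1} \<Longrightarrow> \<bar>l t - t\<bar> \<le> e \<and> \<bar>x t - y (l t)\<bar> \<le> e"
    using assms(1) by (auto simp: skorohod_bounds_def)
  obtain k where k: "k \<in> time_changes"
    and c: "\<And>t. t \<in> {0..1} \<Longrightarrow> \<bar>k t - t\<bar> \<le> e' \<and> \<bar>y t - z (k t)\<bar> \<le> e'"
    using assms(2) by (auto simp: skorohod_bounds_def)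
  have "strict_mono_on {0..1} (\<lambda>t. k (l t))"
  proof (rule strict_mono_onI)
    fix r s :: real assume rs: "r \<in> {0..1}" "s \<in> {0..1}" "r < s"
    have "strict_mono_on {0..1} l" "strict_mono_on {0..1} k"
      using l k by (simp_all add: time_changes_def)
    then show "k (l r) < k (l s)"
      using rs time_change_mem[OF l] by (blast intro: strict_mono_onD)
  qed
  moreover have "continuous_on {0..1} (\<lambda>t. k (l t))"
  proof (rule continuous_on_compose2[where f = l and g = k and t = "{0..1}"])
    show "continuous_on {0..1} k" "continuous_on {0..1} l" "l ` {0..1} \<subseteq> {0..1}"
      using l k by (simp_all add: time_changes_def)
  qed
  moreover have "(\<lambda>t. k (l t)) ` {0..1} = {0..1}"
    using l k image_image[of k l "{0..1}"] by (simp add: time_changes_def)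
  ultimately have kl: "(\<lambda>t. k (l t)) \<in> time_changes" by (simp add: time_changes_def)
  have "\<bar>k (l t) - t\<bar> \<le> e + e' \<and> \<bar>x t - z (k (l t))\<bar> \<le> e + e'" if "t \<in> {0..1}" for t
    using b[OF that] c[OF time_change_mem[OF l that]] by linarith
  then show ?thesis by (rule skorohod_boundsI[OF kl])
qed

lemma cadlag_bounded:
  assumes x: "x \<in> cadlag_paths"
  shows "\<exists>K. \<forall>t\<in>{0..1}. \<bar>x t\<bar> \<le> K"
proof -
  have loc: "\<exists>U K. open U \<and> t \<in> U \<and> (\<forall>s\<in>U \<inter> {0..1}. \<bar>x s\<bar> \<le> K)" if t: "t \<in> {0..1}" for t
  proof -
    have "\<exists>b>t. \<exists>K. \<forall>s\<in>{t<..<b} \<inter> {0..1}. \<bar>x s\<bar> \<le> K"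
    proof (cases "t = 1")
      case False
      then have "(x \<longlongrightarrow> x t) (at_right t)" using x t by (auto simp: cadlag_paths_def)
      then have "eventually (\<lambda>s. dist (x s) (x t) < 1) (at_right t)" by (rule tendstoD) simp
      then obtain b where "b > t" "\<And>s. s > t \<Longrightarrow> s < b \<Longrightarrow> dist (x s) (x t) < 1"
        unfolding eventually_at_right_field by auto
      then have "\<forall>s\<in>{t<..<b} \<inter> {0..1}. \<bar>x s\<bar> \<le> \<bar>x t\<bar> + 1" by (force simp: dist_real_def)
      then show ?thesis using \<open>b > t\<close> by blast
    qed (auto intro!: exI[of _ 2])
    then obtain b K1 where b: "b > t" "\<And>s. s \<in> {t<..<b} \<inter> {0..1} \<Longrightarrow> \<bar>x s\<bar> \<le> K1" by blast
    have "\<exists>a<t. \<exists>K. \<forall>s\<in>{a<..<t} \<inter> {0..1}. \<bar>x s\<bar> \<le> K"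
    proof (cases "t = 0")
      case False
      then have "t \<in> {0<..1}" using t by auto
      then obtain l where "(x \<longlongrightarrow> l) (at_left t)" using x unfolding cadlag_paths_def by blast
      then have "eventually (\<lambda>s. dist (x s) l < 1) (at_left t)" by (rule tendstoD) simp
      then obtain a where "a < t" "\<And>s. s > a \<Longrightarrow> s < t \<Longrightarrow> dist (x s) l < 1"
        unfolding eventually_at_left_field by auto
      then have "\<forall>s\<in>{a<..<t} \<inter> {0..1}. \<bar>x s\<bar> \<le> \<bar>l\<bar> + 1" by (force simp: dist_real_def)
      then show ?thesis using \<open>a < t\<close> by blast
    qed (auto intro!: exI[of _ "-1"])
    then obtain a K2 where a: "a < t" "\<And>s. s \<in> {a<..<t} \<inter> {0..1} \<Longrightarrow> \<bar>x s\<bar> \<le> K2" by blast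
    have "\<bar>x s\<bar> \<le> max (max K1 K2) \<bar>x t\<bar>" if s: "s \<in> {a<..<b} \<inter> {0..1}" for s
    proof -
      consider "s < t" | "s = t" | "s > t" by linarith
      then show ?thesis
      proof cases
        case 1 then show ?thesis using a(2)[of s] s by auto
      next
        case 3 then show ?thesis using b(2)[of s] s by auto
      qed auto
    qed
    then show ?thesis using a(1) b(1) by (intro exI[of _ "{a<..<b}"] exI[of _ "max (max K1 K2) \<bar>x t\<bar>"]) auto
  qed
  then obtain U K where UK: "\<And>t. t \<in> {0..1} \<Longrightarrow> open (U t)" "\<And>t. t \<in> {0..1} \<Longrightarrow> t \<in> U t"
      "\<And>t s. t \<in> {0..1} \<Longrightarrow> s \<in> U t \<inter> {0..1} \<Longrightarrow> \<bar>x s\<bar> \<le> K t"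
    by metis
  obtain F where F: "F \<subseteq> {0..1}" "finite F" "{0..1} \<subseteq> (\<Union>t\<in>F. U t)"
  proof (rule compactE_image[OF compact_Icc[of 0 "1::real"], of "{0..1}" U])
    show "{0..1} \<subseteq> (\<Union>t\<in>{0..1}. U t)" using UK(2) by blast
  qed (use UK(1) that in auto)
  have "\<bar>x s\<bar> \<le> (\<Sum>t\<in>F. \<bar>K t\<bar>)" if s: "s \<in> {0..1}" for s
  proof -
    obtain t where t: "t \<in> F" "s \<in> U t" using F(3) s by auto
    then have "\<bar>x s\<bar> \<le> \<bar>K t\<bar>" using UK(3)[of t s] F(1) s by force
    also have "\<dots> \<le> (\<Sum>t\<in>F. \<bar>K t\<bar>)" using t F(2) by (intro member_le_sum) auto
    finally show ?thesis .
  qed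
  then show ?thesis by blast
qed

lemma skorohod_bounds_nonempty:
  assumes "x \<in> cadlag_paths" "y \<in> cadlag_paths"
  shows "skorohod_bounds x y \<noteq> {}"
proof -
  obtain K L where "\<And>t. t \<in> {0..1} \<Longrightarrow> \<bar>x t\<bar> \<le> K" "\<And>t. t \<in> {0..1} \<Longrightarrow> \<bar>y t\<bar> \<le> L"
    using cadlag_bounded[OF assms(1)] cadlag_bounded[OF assms(2)] by blast
  then have "\<forall>t\<in>{0..1}. \<bar>t - t\<bar> \<le> \<bar>K\<bar> + \<bar>L\<bar> \<and> \<bar>x t - y t\<bar> \<le> \<bar>K\<bar> + \<bar>L\<bar>"
    by (smt (verit))
  then have "\<bar>K\<bar> + \<bar>L\<bar> \<in> skorohod_bounds x y"
    by (intro skorohod_boundsI[OF id_time_change]) blast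
  then show ?thesis by blast
qed

lemma skorohod_separated:
  assumes x: "x \<in> cadlag_paths" and y: "y \<in> cadlag_paths"
    and small: "\<And>d. d > 0 \<Longrightarrow> \<exists>e\<in>skorohod_bounds x y. e < d"
  shows "x = y"
proof -
  have ts: "\<exists>l\<in>time_changes. \<forall>t\<in>{0..1}. \<bar>l t - t\<bar> < d \<and> \<bar>x t - y (l t)\<bar> < d" if "d > 0" for d
  proof -
    obtain e l where "e < d" "l \<in> time_changes"
        "\<forall>t\<in>{0..1}. \<bar>l t - t\<bar> \<le> e \<and> \<bar>x t - y (l t)\<bar> \<le> e"
      using small[OF \<open>d > 0\<close>] unfolding skorohod_bounds_def by auto
    then show ?thesis by (intro bexI[of _ l]) (auto intro: le_less_trans)
  qed
  have "x t = y t" if t: "t \<in> {0..1}" for t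
  proof (cases "t = 1")
    case True
    have "\<bar>x t - y t\<bar> \<le> 0 + d" if d: "d > 0" for d
    proof -
      obtain l where l: "l \<in> time_changes" "\<forall>t\<in>{0..1}. \<bar>l t - t\<bar> < d \<and> \<bar>x t - y (l t)\<bar> < d"
        using ts[OF d] by blast
      then have "\<bar>x t - y (l t)\<bar> < d" using t by blast
      then show ?thesis using True time_change_at_1[OF l(1)] by simp
    qed
    then show ?thesis using field_le_epsilon[of "\<bar>x t - y t\<bar>" 0] by simp
  next
    case False
    then have "0 \<le> t" "t < 1" using t by auto
    then have xr: "(x \<longlongrightarrow> x t) (at_right t)" and yr: "(y \<longlongrightarrow> y t) (at_right t)"
      using x y by (simp_all add: cadlag_paths_def)
    have "\<bar>x t - y t\<bar> \<le> 0 + d" if d: "d > 0" for d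
    proof -
      have d3: "d / 3 > 0" using d by simp
      obtain b where b: "b > t" "\<And>s. s > t \<Longrightarrow> s < b \<Longrightarrow> \<bar>x s - x t\<bar> < d/3"
        using tendstoD[OF xr d3] unfolding eventually_at_right_field dist_real_def by auto
      obtain c where c: "c > t" "\<And>s. s > t \<Longrightarrow> s < c \<Longrightarrow> \<bar>y s - y t\<bar> < d/3"
        using tendstoD[OF yr d3] unfolding eventually_at_right_field dist_real_def by auto
      define m where "m = min 1 (min b c)"
      define s where "s = (t + m) / 2"
      have m: "t < m" "m \<le> 1" "m \<le> b" "m \<le> c" using b c t False by (auto simp: m_def)
      have s: "t < s" "s < m" using m by (auto simp: s_def)
      define r where "r = min (d/3) (min (s - t) (m - s))"
      have "r > 0" using d s by (simp add: r_def)
      then obtain l where l: "\<forall>t\<in>{0..1}. \<bar>l t - t\<bar> < r \<and> \<bar>x t - y (l t)\<bar> < r"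
        using ts by blast
      have "s \<in> {0..1}" using s m t by auto
      then have ls: "\<bar>l s - s\<bar> < r" "\<bar>x s - y (l s)\<bar> < r" using l by auto
      have "t < l s" "l s < c" using ls(1) m by (auto simp: r_def)
      then have "\<bar>y (l s) - y t\<bar> < d/3" by (rule c(2))
      moreover have "\<bar>x s - x t\<bar> < d/3" using s m b(2) by simp
      moreover have "\<bar>x s - y (l s)\<bar> < d/3" using ls(2) by (simp add: r_def)
      ultimately show ?thesis by linarith
    qed
    then show ?thesis using field_le_epsilon[of "\<bar>x t - y t\<bar>" 0] by simp
  qed
  then show ?thesis
    using x y by (intro extensionalityI[of x "{0..1}" y]) (auto simp: cadlag_paths_def)
qed

interpretation skorohod: Metric_space cadlag_paths skorohod_dist
proof
  fix x y z :: "real \<Rightarrow> real"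
  show "0 \<le> skorohod_dist x y"
    using cInf_greatest[OF skorohod_bounds_nonempty skorohod_bounds_nonneg]
    by (simp add: skorohod_dist_def)
  have "skorohod_bounds x y = skorohod_bounds y x" using skorohod_bounds_swap by blast
  then show "skorohod_dist x y = skorohod_dist y x" by (simp add: skorohod_dist_def)
  assume x: "x \<in> cadlag_paths" and y: "y \<in> cadlag_paths"
  show "skorohod_dist x y = 0 \<longleftrightarrow> x = y"
  proof
    assume "skorohod_dist x y = 0"
    then have "Inf (skorohod_bounds x y) = 0" using x y by (simp add: skorohod_dist_def)
    then have "\<exists>e\<in>skorohod_bounds x y. e < d" if "d > 0" for d
      using that cInf_lessD[OF skorohod_bounds_nonempty[OF x y], of d] by simp
    then show "x = y" by (rule skorohod_separated[OF x y])
  next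
    assume "x = y"
    then have "\<forall>t\<in>{0..1}. \<bar>t - t\<bar> \<le> 0 \<and> \<bar>x t - y t\<bar> \<le> 0" by simp
    then have "0 \<in> skorohod_bounds x y"
      by (intro skorohod_boundsI[OF id_time_change]) blast
    then have "Inf (skorohod_bounds x y) = 0"
      by (intro cInf_eq_minimum) (auto intro: skorohod_bounds_nonneg)
    then show "skorohod_dist x y = 0" using x y by (simp add: skorohod_dist_def)
  qed
  assume z: "z \<in> cadlag_paths"
  have *: "Inf (skorohod_bounds x z) \<le> e + e'"
    if "e \<in> skorohod_bounds x y" "e' \<in> skorohod_bounds y z" for e e'
    using skorohod_bounds_trans[OF that] by (rule cInf_lower) (rule skorohod_bounds_bdd_below)
  have "Inf (skorohod_bounds x z) - e' \<le> Inf (skorohod_bounds x y)"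
    if "e' \<in> skorohod_bounds y z" for e'
    using *[OF _ that] by (intro cInf_greatest skorohod_bounds_nonempty x y) (simp add: algebra_simps)
  then have "Inf (skorohod_bounds x z) - Inf (skorohod_bounds x y) \<le> Inf (skorohod_bounds y z)"
    by (intro cInf_greatest skorohod_bounds_nonempty y z) (simp add: algebra_simps)
  then show "skorohod_dist x z \<le> skorohod_dist x y + skorohod_dist y z"
    using x y z by (simp add: skorohod_dist_def)
qed

abbreviation skorohod_topology :: "(real \<Rightarrow> real) topology" where
  "skorohod_topology \<equiv> skorohod.mtopology"

definition borel_sets_of :: "'a topology \<Rightarrow> 'a measure" where
  "borel_sets_of S = sigma (topspace S) {U. openin S U}"

text \<open>Weak convergence of the laws of random elements of a topological space; measurability of the
  random elements is part of the claim, because the Bochner integral of a non-measurable function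
  is \<open>0\<close>.\<close>

definition converges_in_law ::
  "'c topology \<Rightarrow> (nat \<Rightarrow> 'a measure) \<Rightarrow> (nat \<Rightarrow> 'a \<Rightarrow> 'c) \<Rightarrow> 'b measure \<Rightarrow> ('b \<Rightarrow> 'c) \<Rightarrow> bool"
where
  "converges_in_law S M X M' X' \<longleftrightarrow>
     (\<forall>n. prob_space (M n) \<and> X n \<in> M n \<rightarrow>\<^sub>M borel_sets_of S) \<and>
     prob_space M' \<and> X' \<in> M' \<rightarrow>\<^sub>M borel_sets_of S \<and>
     (\<forall>f. continuous_map S euclideanreal f \<and> bounded (f ` topspace S) \<longrightarrow>
        (\<lambda>n. \<integral>\<omega>. f (X n \<omega>) \<partial>M n) \<longlonglongrightarrow> (\<integral>\<omega>. f (X' \<omega>) \<partial>M'))"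

definition fidi_converges ::
  "real set \<Rightarrow> 'a measure \<Rightarrow> (nat \<Rightarrow> real \<Rightarrow> 'a \<Rightarrow> real) \<Rightarrow> 'b measure \<Rightarrow> (real \<Rightarrow> 'b \<Rightarrow> real) \<Rightarrow> bool"
where
  "fidi_converges T M X M' X' \<longleftrightarrow>
     (\<forall>J. finite J \<and> J \<subseteq> T \<longrightarrow>
        converges_in_law (product_topology (\<lambda>_. euclideanreal) J)
          (\<lambda>_. M) (\<lambda>m \<omega>. \<lambda>t\<in>J. X m t \<omega>) M' (\<lambda>\<omega>. \<lambda>t\<in>J. X' t \<omega>))"

definition normalised_sum ::
  "real \<Rightarrow> (nat \<Rightarrow> 'a \<Rightarrow> nat \<Rightarrow> real) \<Rightarrow> nat \<Rightarrow> nat \<Rightarrow> real \<Rightarrow> 'a \<Rightarrow> real" where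
  "normalised_sum H Y N m t \<omega> =
     c_H H * (\<Sum>i=1..m. Y i \<omega> (nat \<lfloor>real N * t\<rfloor>)) / (real N powr H * sqrt (real m))"

end

theory Submission
  imports Defs
begin

text \<open>Consecutive steps after an even time cancel, so \<open>2 * sqrt p * Y n\<close> is the sum of the first and the
  \<open>2 n\<close>-th step and the increments of \<open>Y\<close> have second moment \<open>\<Sum>k<n. (1 - 2 * p) ^ k\<close>, \<open>n\<close> being the
  length of the increment. Mixed over \<open>p\<close> this becomes a sum of Beta integrals that telescopes, after
  multiplication with \<open>(c_H H)\<^sup>2\<close>, to \<open>fact n / Gamma (n + 1 - 2 * H) - 1 / Gamma (1 - 2 * H)\<close>, which is
  asymptotic to \<open>n powr (2 * H)\<close>. The central limit theorem yields Gaussian processes \<open>Z\<close> whose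
  covariances, by polarization, converge to that of fractional Brownian motion. Gaussian smoothing turns
  convergence of characteristic functions into convergence in law. For the Skorohod limit it suffices
  to test against bounded Lipschitz functions; the paths are compared with their restrictions to a
  coarse grid, and since Gaussian increments have all moments, a maximal inequality obtained by
  doubling the block length bounds the error uniformly in \<open>N\<close>.\<close>

section \<open>Moments of the mixing measure\<close>

text \<open>The walk is specified by conditional probabilities, so its law is first shown to exist
  and to be unique; it is realised explicitly on i.i.d. uniform variables. One noise sequence serves
  every \<open>p\<close>, which makes the mixture the image of a product measure and its moments
  iterated integrals. The weight \<open>p powr (- 2 * H)\<close> near 0 is the source of the
  exponent: it makes the mean of \<open>(1 - 2 * p) ^ k\<close> decay like
  \<open>k powr (2 * H - 1)\<close>, whose partial sums grow like \<open>n powr (2 * H)\<close>. The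
  obstacle is tightness. An increment over a time x has variance of order
  \<open>x powr (2 * H)\<close> with \<open>2 * H < 1\<close>, so second moments are too weak; after
  the inner limit the increments are Gaussian, and moments of order \<open>2 * q\<close> with
  \<open>H * q > 1\<close> give an exponent of at least 2. For a given \<open>N\<close> the limit
  process takes only \<open>N + 1\<close> values. It is therefore built from a factorisation of one
  finite covariance matrix, whose positivity is that of a variance under the mixture.\<close>

definition mean_persistence_power :: "real \<Rightarrow> nat \<Rightarrow> real" where
  "mean_persistence_power H n = Gamma (2 - 2 * H) * fact n / Gamma (real n + 2 - 2 * H)"

lemma space_mu_H: "space (mu_H H) = {0..1/2}"
  by (simp add: mu_H_def space_restrict_space)

text \<open>The substitution \<open>t = 2 * p\<close> turns the integral into
  \<open>(1 - 2 * H) * Beta (1 - 2 * H) (real n + 1)\<close>; the prefactor is absorbed by the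
  functional equation of \<open>Gamma\<close>, which gives the closed form
  \<open>mean_persistence_power\<close>.\<close>

lemma nn_integral_mu_H_power:
  assumes "0 < H" "H < 1/2"
  shows "(\<integral>\<^sup>+p. ennreal ((1 - 2 * p) ^ n) \<partial>mu_H H) = ennreal (mean_persistence_power H n)"
proof -
  let ?a = "1 - 2 * H" and ?B = "Beta (1 - 2 * H) (real n + 1)"
  have a: "?a > 0" using assms by simp
  have "((\<lambda>t. t powr (?a - 1) * (1 - t) powr (real n + 1 - 1)) has_integral ?B) {0..1}"
    using a by (intro has_integral_Beta_real) auto
  \<comment> \<open>The point 1 is exempted because \<open>0 powr 0 = 0\<close> while
    \<open>0 ^ 0 = 1\<close>, so for \<open>n = 0\<close> the two integrands differ there.\<close>
  then have "((\<lambda>t. t powr (- 2 * H) * (1 - t) ^ n) has_integral ?B) {0..1}"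
  proof (rule has_integral_spike_finite[where S="{1}", rotated 2])
    fix t :: real assume "t \<in> {0..1} - {1}"
    then show "t powr (- 2 * H) * (1 - t) ^ n = t powr (?a - 1) * (1 - t) powr (real n + 1 - 1)"
      by (auto simp: powr_realpow)
  qed simp
  from has_integral_stretch_real[OF this, of 2]
  have "((\<lambda>p. (2 * p) powr (- 2 * H) * (1 - 2 * p) ^ n) has_integral ?B / 2) ((\<lambda>x. x / 2) ` {0..1})"
    by simp
  also have "(\<lambda>x::real. x / 2) ` {0..1} = {0..1/2}"
    by (simp add: image_divide_atLeastAtMost)
  finally have I0: "((\<lambda>p. (?a * 2) * ((2 * p) powr (- 2 * H) * (1 - 2 * p) ^ n)) has_integral (?a * 2) * (?B / 2)) {0..1/2}"
    by (rule has_integral_mult_right)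
  have eq: "(?a * 2) * ((2 * p) powr (- 2 * H) * (1 - 2 * p) ^ n) =
      ?a * 2 powr ?a * p powr (- 2 * H) * (1 - 2 * p) ^ n" if p: "p \<in> {0..1/2}" for p
  proof -
    have e1: "(2 * p) powr (- 2 * H) = 2 powr (- 2 * H) * p powr (- 2 * H)"
      using p by (simp add: powr_mult)
    have e2: "2 powr ?a = 2 * 2 powr (- 2 * H)" using powr_add[of 2 1 "- 2 * H"] by simp
    have "(a * 2) * ((T * P) * R) = a * (2 * T) * P * R" for a T P R :: real by simp
    then show ?thesis unfolding e1 e2 .
  qed
  have "?a * 2 * (?B / 2) = ?a * ?B" by simp
  with has_integral_eq[OF eq I0]
  have I: "((\<lambda>p. ?a * 2 powr ?a * p powr (- 2 * H) * (1 - 2 * p) ^ n) has_integral ?a * ?B) {0..1/2}"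
    by (simp only:)
  have "(\<integral>\<^sup>+p. ennreal ((1 - 2 * p) ^ n) \<partial>mu_H H) =
      (\<integral>\<^sup>+p. ennreal (?a * 2 powr ?a * p powr (- 2 * H) * (1 - 2 * p) ^ n) \<partial>restrict_space lborel {0..1/2})"
  proof -
    have "(\<lambda>p. ennreal (?a * 2 powr ?a * p powr (- 2 * H))) \<in> borel_measurable (restrict_space lborel {0..1/2})"
         "(\<lambda>p. ennreal ((1 - 2 * p) ^ n)) \<in> borel_measurable (restrict_space lborel {0..1/2})"
      by (rule measurable_restrict_space1, measurable)+
    then have "(\<integral>\<^sup>+p. ennreal ((1 - 2 * p) ^ n) \<partial>mu_H H) =
      (\<integral>\<^sup>+p. ennreal (?a * 2 powr ?a * p powr (- 2 * H)) * ennreal ((1 - 2 * p) ^ n) \<partial>restrict_space lborel {0..1/2})"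
      unfolding mu_H_def by (rule nn_integral_density)
    also have "\<dots> = (\<integral>\<^sup>+p. ennreal (?a * 2 powr ?a * p powr (- 2 * H) * (1 - 2 * p) ^ n) \<partial>restrict_space lborel {0..1/2})"
    proof (rule nn_integral_cong)
      fix p :: real
      have "0 \<le> ?a * 2 powr ?a * p powr (- 2 * H)" using a by simp
      then show "ennreal (?a * 2 powr ?a * p powr (- 2 * H)) * ennreal ((1 - 2 * p) ^ n) =
        ennreal (?a * 2 powr ?a * p powr (- 2 * H) * (1 - 2 * p) ^ n)"
        by (rule ennreal_mult'[symmetric])
    qed
    finally show ?thesis .
  qed
  also have "\<dots> = (\<integral>\<^sup>+p. ennreal (?a * 2 powr ?a * p powr (- 2 * H) * (1 - 2 * p) ^ n) * indicator {0..1/2} p \<partial>lborel)"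
    by (rule nn_integral_restrict_space) simp
  also have "\<dots> = ennreal (?a * ?B)"
    using a by (intro nn_integral_has_integral_lebesgue'[OF _ I]) auto
  also have "?a * ?B = mean_persistence_power H n"
  proof -
    have nz: "?a \<notin> \<int>\<^sub>\<le>\<^sub>0" using a by (auto elim!: nonpos_Ints_cases)
    have "?a * Gamma ?a = Gamma (2 - 2 * H)" using Gamma_plus1[OF nz] by simp
    moreover have "Gamma (real n + 1) = fact n" using Gamma_fact[of n] by (simp add: add.commute)
    moreover have "?a * ?B = (?a * Gamma ?a) * Gamma (real n + 1) / Gamma (real n + 2 - 2 * H)"
      by (simp add: Beta_def add.commute add_diff_eq)
    ultimately show ?thesis by (simp add: mean_persistence_power_def)
  qed
  finally show ?thesis .
qed

lemma mean_persistence_power_0: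
  assumes "H < 1/2" shows "mean_persistence_power H 0 = 1"
proof -
  have "Gamma (2 - 2 * H) > 0" using assms by (intro Gamma_real_pos) simp
  then show ?thesis by (simp add: mean_persistence_power_def)
qed

lemma prob_space_mu_H:
  assumes "0 < H" "H < 1/2" shows "prob_space (mu_H H)"
  using nn_integral_mu_H_power[OF assms, of 0] assms
  by (intro prob_spaceI) (simp add: mean_persistence_power_0)

lemma borel_measurable_mu_H: "f \<in> borel_measurable borel \<Longrightarrow> f \<in> borel_measurable (mu_H H)"
  by (simp add: mu_H_def measurable_restrict_space1)

text \<open>The density of \<open>mu_H\<close> vanishes at \<open>0\<close>, because \<open>0 powr a = 0\<close>.\<close>

lemma AE_mu_H: "AE p in mu_H H. 0 < p \<and> p \<le> 1"
proof -
  have m: "(\<lambda>p. ennreal ((1 - 2 * H) * 2 powr (1 - 2 * H) * p powr (- 2 * H))) \<in> borel_measurable (restrict_space lborel {0..1/2})"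
    by (rule measurable_restrict_space1, measurable)
  have "AE p in restrict_space lborel {0..1/2}. 0 < ennreal ((1 - 2 * H) * 2 powr (1 - 2 * H) * p powr (- 2 * H)) \<longrightarrow> 0 < p \<and> p \<le> 1"
  proof (rule AE_I2, rule impI)
    fix p :: real
    assume p1: "p \<in> space (restrict_space lborel {0..1/2})"
      and p2: "0 < ennreal ((1 - 2 * H) * 2 powr (1 - 2 * H) * p powr (- 2 * H))"
    have "p \<noteq> 0"
    proof (rule notI)
      assume p0: "p = 0"
      show False using p2 unfolding p0 powr_0 mult_zero_right ennreal_0 by (rule less_irrefl[THEN notE])
    qed
    moreover have "0 \<le> p \<and> p \<le> 1 / 2" using p1 unfolding space_restrict_space by simp
    ultimately show "0 < p \<and> p \<le> 1" by linarith
  qed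
  then show ?thesis unfolding mu_H_def by (rule AE_density[OF m, THEN iffD2])
qed

lemma integral_mu_H_power:
  assumes "0 < H" "H < 1/2"
  shows "integrable (mu_H H) (\<lambda>p. (1 - 2 * p) ^ n)"
    "(\<integral>p. (1 - 2 * p) ^ n \<partial>mu_H H) = mean_persistence_power H n"
proof -
  have nn: "AE p in mu_H H. 0 \<le> (1 - 2 * p) ^ n" by (rule AE_I2) (auto simp: space_mu_H)
  have pos: "0 \<le> mean_persistence_power H n"
    using assms unfolding mean_persistence_power_def
    by (intro divide_nonneg_nonneg mult_nonneg_nonneg Gamma_real_nonneg) auto
  have m: "(\<lambda>p. (1 - 2 * p) ^ n) \<in> borel_measurable (mu_H H)" by (intro borel_measurable_mu_H) simp
  show "integrable (mu_H H) (\<lambda>p. (1 - 2 * p) ^ n)"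
    using nn_integral_mu_H_power[OF assms, of n] nn m by (intro integrableI_nonneg) auto
  show "(\<integral>p. (1 - 2 * p) ^ n \<partial>mu_H H) = mean_persistence_power H n"
    using nn_integral_mu_H_power[OF assms, of n] nn m pos by (simp add: integral_eq_nn_integral)
qed

section \<open>Growth of the increment variance\<close>

definition walk_variance :: "real \<Rightarrow> nat \<Rightarrow> real" where
  "walk_variance H n = fact n / Gamma (real n + 1 - 2 * H) - 1 / Gamma (1 - 2 * H)"

lemma walk_variance_0[simp]: "walk_variance H 0 = 0"
  by (simp add: walk_variance_def)

lemma c_H_squared:
  assumes "0 < H" "H < 1/2" shows "(c_H H)\<^sup>2 = 2 * H / Gamma (2 - 2 * H)"
proof -
  have "Gamma (2 - 2 * H) > 0" using assms by (intro Gamma_real_pos) simp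
  then show ?thesis using assms by (simp add: c_H_def)
qed

text \<open>In the difference of consecutive terms the factors \<open>n + 1\<close> and
  \<open>n + 1 - 2 * H\<close> leave exactly \<open>2 * H\<close>, the numerator of the square of
  \<open>c_H\<close>; its denominator cancels the \<open>Gamma (2 - 2 * H)\<close> of the mean
  powers.\<close>

lemma walk_variance_eq_sum:
  assumes "0 < H" "H < 1/2"
  shows "walk_variance H n = (c_H H)\<^sup>2 * (\<Sum>k<n. mean_persistence_power H k)"
proof (induction n)
  case (Suc n)
  let ?z = "real n + 1 - 2 * H"
  have z: "?z > 0" using assms by simp
  have nz: "?z \<notin> \<int>\<^sub>\<le>\<^sub>0" using z by (auto elim!: nonpos_Ints_cases)
  have G: "Gamma (?z + 1) = ?z * Gamma ?z" "Gamma ?z > 0" "Gamma (2 - 2 * H) > 0"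
    using Gamma_plus1[OF nz] z assms by (auto intro!: Gamma_real_pos)
  have "walk_variance H (Suc n) - walk_variance H n = fact (Suc n) / Gamma (?z + 1) - fact n / Gamma ?z"
    by (simp add: walk_variance_def algebra_simps)
  also have "\<dots> = 2 * H * fact n / Gamma (?z + 1)"
    unfolding G(1) using z G(2) by (simp add: divide_simps) (simp add: algebra_simps)
  also have "\<dots> = (c_H H)\<^sup>2 * mean_persistence_power H n"
    unfolding c_H_squared[OF assms] mean_persistence_power_def using G(3) by (simp add: add.commute add_diff_eq)
  finally show ?case using Suc by (simp add: algebra_simps)
qed simp

text \<open>This is Gauss' limit formula for \<open>Gamma\<close> at \<open>1 - 2 * H\<close>. The
  series has \<open>Gamma (n + 2 - 2 * H)\<close> in its denominator, one step too far; the factor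
  \<open>1 + ?z / real n\<close>, which tends to 1, moves it back.\<close>

lemma walk_variance_asymp:
  assumes "0 < H" "H < 1/2"
  shows "(\<lambda>n. walk_variance H n / real n powr (2 * H)) \<longlonglongrightarrow> 1"
proof -
  let ?z = "1 - 2 * H"
  have z: "?z > 0" using assms by simp
  have nz: "?z \<notin> \<int>\<^sub>\<le>\<^sub>0" using z by (auto elim!: nonpos_Ints_cases)
  have Gz: "Gamma ?z > 0" using z by (rule Gamma_real_pos)
  have "(\<lambda>n. Gamma_series ?z n / Gamma ?z * (1 + ?z / real n) - 1 / Gamma ?z * (real n powr (- (2 * H))))
      \<longlonglongrightarrow> Gamma ?z / Gamma ?z * (1 + 0) - 1 / Gamma ?z * 0"
  proof (intro tendsto_diff tendsto_mult tendsto_add tendsto_const)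
    show "(\<lambda>n. Gamma_series ?z n / Gamma ?z) \<longlonglongrightarrow> Gamma ?z / Gamma ?z"
      using Gz by (intro tendsto_divide Gamma_series_LIMSEQ tendsto_const) simp
    show "(\<lambda>n. ?z / real n) \<longlonglongrightarrow> 0" by (rule lim_const_over_n)
    show "(\<lambda>n. real n powr - (2 * H)) \<longlonglongrightarrow> 0"
      using assms by (intro tendsto_neg_powr filterlim_real_sequentially) auto
  qed
  then have "(\<lambda>n. Gamma_series ?z n / Gamma ?z * (1 + ?z / real n) - 1 / Gamma ?z * (real n powr (- (2 * H)))) \<longlonglongrightarrow> 1"
    using Gz by simp
  moreover
    have "eventually (\<lambda>n. Gamma_series ?z n / Gamma ?z * (1 + ?z / real n) - 1 / Gamma ?z * (real n powr (- (2 * H)))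
        = walk_variance H n / real n powr (2 * H)) sequentially"
      using eventually_gt_at_top[of 0]
    proof eventually_elim
      case (elim n)
      let ?w = "?z + real n"
      have w: "?w > 0" using z by simp
      have nw: "?w \<notin> \<int>\<^sub>\<le>\<^sub>0" using w by (auto elim!: nonpos_Ints_cases)
      have Gw: "Gamma (?w + 1) = ?w * Gamma ?w" "Gamma ?w > 0"
        using Gamma_plus1[OF nw] w by (auto intro!: Gamma_real_pos)
      have P: "pochhammer ?z (n + 1) = Gamma (?w + 1) / Gamma ?z"
        using pochhammer_Gamma[OF nz, of "n + 1"] by (simp add: add_ac)
      have "Gamma_series ?z n / Gamma ?z = fact n * real n powr ?z / (?w * Gamma ?w)"
      proof -
        have "Gamma_series ?z n = fact n * real n powr ?z / pochhammer ?z (n + 1)"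
          using elim by (simp add: Gamma_series_def powr_def)
        also have "pochhammer ?z (n + 1) = ?w * Gamma ?w / Gamma ?z" unfolding P Gw(1) ..
        finally show ?thesis using Gz by simp
      qed
      also have "real n powr ?z = real n / real n powr (2 * H)"
        using elim by (simp add: powr_diff)
      finally have eq: "Gamma_series ?z n / Gamma ?z = fact n * (real n / real n powr (2 * H)) / (?w * Gamma ?w)" .
      have "Gamma_series ?z n / Gamma ?z * (1 + ?z / real n) = fact n / Gamma ?w / real n powr (2 * H)"
      proof -
        have "1 + ?z / real n = ?w / real n" using elim by (simp add: field_simps)
        moreover have "A * (N / P) / (w * G) * (w / N) = A / G / P" if "N \<noteq> 0" "w \<noteq> 0" for A N P w G :: real
          using that by simp
        ultimately show ?thesis unfolding eq using elim w by simp
      qed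
      moreover have "?w = real n + 1 - 2 * H" by simp
      ultimately show ?case
        by (simp add: walk_variance_def powr_minus_divide diff_divide_distrib)
    qed
  ultimately show ?thesis by (rule Lim_transform_eventually)
qed

text \<open>The asymptotics says nothing about small \<open>n\<close>; this bound holds for all of
  them. At \<open>n = 0\<close> both sides vanish, since \<open>0 powr x = 0\<close>.\<close>

lemma walk_variance_bound:
  assumes "0 < H" "H < 1/2"
  obtains C where "C \<ge> 0" "\<And>n. \<bar>walk_variance H n\<bar> \<le> C * real n powr (2 * H)"
proof -
  have "Bseq (\<lambda>n. walk_variance H n / real n powr (2 * H))"
    using walk_variance_asymp[OF assms] by (intro convergent_imp_Bseq convergentI)
  then obtain C where C: "C > 0" "\<And>n. norm (walk_variance H n / real n powr (2 * H)) \<le> C"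
    by (auto elim!: BseqE)
  have "\<bar>walk_variance H n\<bar> \<le> C * real n powr (2 * H)" for n
  proof (cases "n = 0")
    case False
    then have "real n powr (2 * H) > 0" by simp
    then show ?thesis using C(2)[of n] by (simp add: abs_divide field_simps)
  qed simp
  then show ?thesis using C(1) by (intro that[of C]) auto
qed

lemma walk_variance_scaling:
  fixes a :: "nat \<Rightarrow> nat"
  assumes H: "0 < H" "H < 1/2"
    and a: "(\<lambda>N. real (a N) / real N) \<longlonglongrightarrow> s"
  shows "(\<lambda>N. walk_variance H (a N) / real N powr (2 * H)) \<longlonglongrightarrow> s powr (2 * H)"
proof -
  have s: "s \<ge> 0" using a by (rule LIMSEQ_le_const) auto
  have p: "(\<lambda>N. (real (a N) / real N) powr (2 * H)) \<longlonglongrightarrow> s powr (2 * H)"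
    using a H by (intro tendsto_powr'[OF _ tendsto_const]) auto
  show ?thesis
  proof (cases "s = 0")
    \<comment> \<open>For \<open>s = 0\<close> the indices \<open>a N\<close> need not tend to
      infinity, so the bound valid for every index takes the place of the asymptotics.\<close>
    case True
    obtain C where C: "C \<ge> 0" "\<And>n. \<bar>walk_variance H n\<bar> \<le> C * real n powr (2 * H)"
      using walk_variance_bound[OF H] by blast
    have "(\<lambda>N. C * (real (a N) / real N) powr (2 * H)) \<longlonglongrightarrow> C * s powr (2 * H)"
      by (intro tendsto_intros p)
    then have "(\<lambda>N. C * (real (a N) / real N) powr (2 * H)) \<longlonglongrightarrow> 0" using True by simp
    then have "(\<lambda>N. walk_variance H (a N) / real N powr (2 * H)) \<longlonglongrightarrow> 0"
    proof (rule Lim_null_comparison[rotated], intro always_eventually allI)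
      fix N
      show "norm (walk_variance H (a N) / real N powr (2 * H)) \<le> C * (real (a N) / real N) powr (2 * H)"
        using divide_right_mono[OF C(2)[of "a N"], of "real N powr (2 * H)"] by (simp add: powr_divide)
    qed
    then show ?thesis using True by simp
  next
    case False
    then have s: "s > 0" using s by simp
    have "filterlim (\<lambda>N. real (a N) / real N * real N) at_top sequentially"
      by (rule filterlim_tendsto_pos_mult_at_top[OF a s filterlim_real_sequentially])
    then have "filterlim (\<lambda>N. real (a N)) at_top sequentially"
      by (rule filterlim_mono_eventually[OF _ order_refl order_refl])
        (use eventually_gt_at_top[of 0] in eventually_elim, simp)
    then have fa: "filterlim a at_top sequentially"
      by (simp add: filterlim_sequentially_iff_filterlim_real)
    have "(\<lambda>N. walk_variance H (a N) / real (a N) powr (2 * H) * (real (a N) / real N) powr (2 * H)) \<longlonglongrightarrow> 1 * s powr (2 * H)"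
      by (intro tendsto_mult p filterlim_compose[OF walk_variance_asymp[OF H] fa])
    moreover have "eventually (\<lambda>N. walk_variance H (a N) / real (a N) powr (2 * H) * (real (a N) / real N) powr (2 * H) =
          walk_variance H (a N) / real N powr (2 * H)) sequentially"
      proof (intro always_eventually allI)
        fix N
        show "walk_variance H (a N) / real (a N) powr (2 * H) * (real (a N) / real N) powr (2 * H) =
          walk_variance H (a N) / real N powr (2 * H)"
          by (cases "a N = 0") (simp_all add: powr_divide)
      qed
    ultimately show ?thesis unfolding mult_1 by (rule Lim_transform_eventually)
  qed
qed

section \<open>A maximal inequality for increments\<close>

text \<open>Choose t with \<open>(1 + t) ^ p = 2\<close>: either y is at most t x and the first term
  alone suffices, or x is below y / t and the second does. The weight 2 is small enough for the
  doubling argument, where 1 + 2 has to stay below 4.\<close>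

lemma power_sum_le_two_plus:
  assumes "0 < p"
  shows "\<exists>C\<ge>0. \<forall>x\<ge>0. \<forall>y\<ge>0. (x + y :: real) ^ p \<le> 2 * x ^ p + C * y ^ p"
proof -
  define t where "t = root p 2 - 1"
  have t: "t > 0" "(1 + t) ^ p = 2" using assms by (auto simp: t_def)
  have "(x + y) ^ p \<le> 2 * x ^ p + (1 / t + 1) ^ p * y ^ p" if "x \<ge> 0" "y \<ge> 0" for x y :: real
  proof -
    have nn: "0 \<le> (1 / t + 1) ^ p * y ^ p" "0 \<le> x ^ p" using that t by auto
    show ?thesis
  proof (cases "y \<le> t * x")
    case True
    have "(x + y) ^ p \<le> ((1 + t) * x) ^ p"
      using True that by (intro power_mono) (simp_all add: distrib_right)
    also have "\<dots> = 2 * x ^ p" by (simp add: power_mult_distrib t)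
    finally show ?thesis using nn by linarith
  next
    case False
    have "x \<le> y / t" using False t by (simp add: pos_le_divide_eq mult.commute)
    then have "(x + y) ^ p \<le> ((1 / t + 1) * y) ^ p"
      using that t by (intro power_mono) (simp_all add: distrib_right)
    also have "\<dots> = (1 / t + 1) ^ p * y ^ p" by (simp add: power_mult_distrib)
    finally show ?thesis using nn by linarith
  qed
  qed
  then show ?thesis using t by (intro exI[of _ "(1 / t + 1) ^ p"]) auto
qed

definition max_incr :: "(nat \<Rightarrow> 'a \<Rightarrow> real) \<Rightarrow> nat \<Rightarrow> nat \<Rightarrow> 'a \<Rightarrow> real" where
  "max_incr S a L \<omega> = (MAX i\<in>{..L}. \<bar>S (a + i) \<omega> - S a \<omega>\<bar>)"

lemma max_incr_ge: "i \<le> L \<Longrightarrow> \<bar>S (a + i) \<omega> - S a \<omega>\<bar> \<le> max_incr S a L \<omega>"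
  unfolding max_incr_def by (rule Max_ge) auto

lemma max_incr_nonneg: "0 \<le> max_incr S a L \<omega>"
  using max_incr_ge[of 0 L S a \<omega>] by simp

lemma max_incr_attained: "\<exists>i\<le>L. max_incr S a L \<omega> = \<bar>S (a + i) \<omega> - S a \<omega>\<bar>"
proof -
  have "max_incr S a L \<omega> \<in> (\<lambda>i. \<bar>S (a + i) \<omega> - S a \<omega>\<bar>) ` {..L}"
    unfolding max_incr_def by (rule Max_in) auto
  then show ?thesis by auto
qed

lemma borel_measurable_max_incr[measurable]:
  assumes [measurable]: "\<And>n. S n \<in> borel_measurable M"
  shows "max_incr S a L \<in> borel_measurable M"
  unfolding max_incr_def[abs_def] by (rule borel_measurable_Max) auto

text \<open>An index in the right half is reached through the midpoint \<open>a + L\<close>. A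
  maximum of two bounds instead of a sum keeps the weight of the left block equal to one after
  taking powers.\<close>

lemma max_incr_double:
  "max_incr S a (2 * L) \<omega> \<le> max (max_incr S a L \<omega>) (max_incr S (a + L) L \<omega> + \<bar>S (a + L) \<omega> - S a \<omega>\<bar>)"
proof -
  obtain i where i: "i \<le> 2 * L" "max_incr S a (2 * L) \<omega> = \<bar>S (a + i) \<omega> - S a \<omega>\<bar>"
    using max_incr_attained[of "2 * L" S a \<omega>] by blast
  show ?thesis
  proof (cases "i \<le> L")
    case True
    then show ?thesis using i max_incr_ge[OF True, of S a \<omega>] by simp
  next
    case False
    define j where "j = i - L"
    have j: "j \<le> L" "i = L + j" using False i by (auto simp: j_def)
    have "\<bar>S (a + i) \<omega> - S a \<omega>\<bar> \<le> \<bar>S (a + L + j) \<omega> - S (a + L) \<omega>\<bar> + \<bar>S (a + L) \<omega> - S a \<omega>\<bar>"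
    proof -
      have e: "a + i = a + L + j" using j(2) by simp
      show ?thesis unfolding e by linarith
    qed
    then show ?thesis using max_incr_ge[OF j(1), of S "a + L" \<omega>] i by simp
  qed
qed

text \<open>The induction doubles the block length: since the increment moment is quadratic in the length
  while only three halves enter with weight one, the constant is reproduced.\<close>

lemma max_incr_moment:
  assumes "0 < p"
  shows "\<exists>K\<ge>0. \<forall>(M :: 'a measure) S c. prob_space M \<longrightarrow> (\<forall>n. S n \<in> borel_measurable M) \<longrightarrow> c \<ge> 0 \<longrightarrow>
    (\<forall>n m. integrable M (\<lambda>\<omega>. \<bar>S n \<omega> - S m \<omega>\<bar> ^ p) \<and>
            (\<integral>\<omega>. \<bar>S n \<omega> - S m \<omega>\<bar> ^ p \<partial>M) \<le> c * (real n - real m)\<^sup>2) \<longrightarrow>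
    (\<forall>a r. integrable M (\<lambda>\<omega>. max_incr S a (2 ^ r) \<omega> ^ p) \<and>
            (\<integral>\<omega>. max_incr S a (2 ^ r) \<omega> ^ p \<partial>M) \<le> K * c * 4 ^ r)"
proof -
  obtain C where C: "C \<ge> 0" "\<And>x y. x \<ge> 0 \<Longrightarrow> y \<ge> 0 \<Longrightarrow> (x + y :: real) ^ p \<le> 2 * x ^ p + C * y ^ p"
    using power_sum_le_two_plus[OF assms] by blast
  \<comment> \<open>The induction step needs \<open>3 * K + C \<le> 4 * K\<close>, that is
    \<open>K \<ge> C\<close>, and blocks of length one need \<open>K \<ge> 1\<close>. As
    \<open>C\<close> comes from \<open>p\<close> alone, \<open>K\<close> is the same for all
    processes.\<close>
  define K where "K = C + 1"
  have main: "integrable M (\<lambda>\<omega>. max_incr S a (2 ^ r) \<omega> ^ p) \<and>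
            (\<integral>\<omega>. max_incr S a (2 ^ r) \<omega> ^ p \<partial>M) \<le> K * c * 4 ^ r"
    if M: "prob_space M" and [measurable]: "\<And>n. S n \<in> borel_measurable M" and c: "c \<ge> 0"
      and int: "\<And>n m. integrable M (\<lambda>\<omega>. \<bar>S n \<omega> - S m \<omega>\<bar> ^ p)"
      and bd: "\<And>n m. (\<integral>\<omega>. \<bar>S n \<omega> - S m \<omega>\<bar> ^ p \<partial>M) \<le> c * (real n - real m)\<^sup>2"
    for M :: "'a measure" and S c a r
  proof (induction r arbitrary: a)
    case 0
    have "max_incr S a (2 ^ 0) \<omega> = \<bar>S (a + 1) \<omega> - S a \<omega>\<bar>" for \<omega>
    proof -
      have "{..1} = {0, 1::nat}" by auto
      then show ?thesis by (simp add: max_incr_def)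
    qed
    moreover have "c * (real (a + 1) - real a)\<^sup>2 \<le> K * c"
      using mult_nonneg_nonneg[OF C(1) c] by (simp add: K_def algebra_simps)
    ultimately show ?case using int[of "a+1" a] bd[of "a+1" a] by simp
  next
    case (Suc r)
    let ?u = "\<lambda>\<omega>. max_incr S a (2 ^ r) \<omega> ^ p" and ?v = "\<lambda>\<omega>. max_incr S (a + 2 ^ r) (2 ^ r) \<omega> ^ p"
      and ?w = "\<lambda>\<omega>. \<bar>S (a + 2 ^ r) \<omega> - S a \<omega>\<bar> ^ p"
    have le: "max_incr S a (2 ^ Suc r) \<omega> ^ p \<le> ?u \<omega> + (2 * ?v \<omega> + C * ?w \<omega>)" for \<omega>
    proof -
      have "max_incr S a (2 ^ Suc r) \<omega> \<le> max (max_incr S a (2 ^ r) \<omega>)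
           (max_incr S (a + 2 ^ r) (2 ^ r) \<omega> + \<bar>S (a + 2 ^ r) \<omega> - S a \<omega>\<bar>)"
        using max_incr_double[of S a "2 ^ r" \<omega>] by simp
      then consider "max_incr S a (2 ^ Suc r) \<omega> \<le> max_incr S a (2 ^ r) \<omega>"
        | "max_incr S a (2 ^ Suc r) \<omega> \<le> max_incr S (a + 2 ^ r) (2 ^ r) \<omega> + \<bar>S (a + 2 ^ r) \<omega> - S a \<omega>\<bar>"
        by linarith
      moreover have nn: "0 \<le> ?u \<omega>" "0 \<le> ?v \<omega>" "0 \<le> C * ?w \<omega>"
        using C(1) by (simp_all add: max_incr_nonneg)
      ultimately show ?thesis
      proof cases
        case 1
        then have "max_incr S a (2 ^ Suc r) \<omega> ^ p \<le> ?u \<omega>"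
          by (intro power_mono) (auto intro: max_incr_nonneg)
        then show ?thesis using nn by linarith
      next
        case 2
        then have "max_incr S a (2 ^ Suc r) \<omega> ^ p \<le>
            (max_incr S (a + 2 ^ r) (2 ^ r) \<omega> + \<bar>S (a + 2 ^ r) \<omega> - S a \<omega>\<bar>) ^ p"
          by (intro power_mono) (auto intro: max_incr_nonneg)
        also have "\<dots> \<le> 2 * ?v \<omega> + C * ?w \<omega>" by (intro C(2)) (auto intro: max_incr_nonneg)
        finally show ?thesis using nn by linarith
      qed
    qed
    have i: "integrable M ?u" "integrable M ?v" "integrable M ?w" using Suc.IH int by auto
    have i': "integrable M (\<lambda>\<omega>. ?u \<omega> + (2 * ?v \<omega> + C * ?w \<omega>))" using i by simp
    have i2: "integrable M (\<lambda>\<omega>. max_incr S a (2 ^ Suc r) \<omega> ^ p)"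
    proof (rule Bochner_Integration.integrable_bound[OF i'])
      show "AE \<omega> in M. norm (max_incr S a (2 ^ Suc r) \<omega> ^ p) \<le> norm (?u \<omega> + (2 * ?v \<omega> + C * ?w \<omega>))"
      proof (rule AE_I2)
        fix \<omega>
        have "0 \<le> max_incr S a (2 ^ Suc r) \<omega> ^ p" by (intro zero_le_power max_incr_nonneg)
        then show "norm (max_incr S a (2 ^ Suc r) \<omega> ^ p) \<le> norm (?u \<omega> + (2 * ?v \<omega> + C * ?w \<omega>))"
          using le[of \<omega>] by (simp only: real_norm_def)
      qed
    qed measurable
    have "(\<integral>\<omega>. max_incr S a (2 ^ Suc r) \<omega> ^ p \<partial>M) \<le> (\<integral>\<omega>. ?u \<omega> + (2 * ?v \<omega> + C * ?w \<omega>) \<partial>M)"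
      using i2 i' le by (intro integral_mono) auto
    also have "\<dots> = (\<integral>\<omega>. ?u \<omega> \<partial>M) + (2 * (\<integral>\<omega>. ?v \<omega> \<partial>M) + C * (\<integral>\<omega>. ?w \<omega> \<partial>M))"
      using i by simp
    also have "\<dots> \<le> K * c * 4 ^ r + (2 * (K * c * 4 ^ r) + C * (c * (real (a + 2 ^ r) - real a)\<^sup>2))"
      using Suc.IH[of a] Suc.IH[of "a + 2 ^ r"] bd[of "a + 2 ^ r" a] C(1)
      by (intro add_mono mult_left_mono conjunct2[OF Suc.IH]) simp_all
    also have "(real (a + 2 ^ r) - real a)\<^sup>2 = 4 ^ r"
    proof -
      have "(2::real) ^ r * 2 ^ r = 4 ^ r" by (subst power_mult_distrib[symmetric]) simp
      then show ?thesis by (simp add: power2_eq_square)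
    qed
    also have "K * c * 4 ^ r + (2 * (K * c * 4 ^ r) + C * (c * 4 ^ r)) \<le> K * c * 4 ^ Suc r"
      using c by (simp add: K_def algebra_simps)
    finally show ?case using i2 by blast
  qed
  show ?thesis
  proof (rule exI[of _ K], rule conjI)
    show "K \<ge> 0" using C by (simp add: K_def)
    show "\<forall>(M :: 'a measure) S c. prob_space M \<longrightarrow> (\<forall>n. S n \<in> borel_measurable M) \<longrightarrow> c \<ge> 0 \<longrightarrow>
      (\<forall>n m. integrable M (\<lambda>\<omega>. \<bar>S n \<omega> - S m \<omega>\<bar> ^ p) \<and>
            (\<integral>\<omega>. \<bar>S n \<omega> - S m \<omega>\<bar> ^ p \<partial>M) \<le> c * (real n - real m)\<^sup>2) \<longrightarrow>
      (\<forall>a r. integrable M (\<lambda>\<omega>. max_incr S a (2 ^ r) \<omega> ^ p) \<and>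
            (\<integral>\<omega>. max_incr S a (2 ^ r) \<omega> ^ p \<partial>M) \<le> K * c * 4 ^ r)"
      by (intro allI impI, rule main) simp_all
  qed
qed

section \<open>Gaussian vectors from a covariance\<close>

text \<open>One step of the Cholesky decomposition: subtracting the rank one part of the last index keeps
  the form positive. If \<open>K n n = 0\<close> then \<open>K i n = 0\<close> by positivity, which matches \<open>x / 0 = 0\<close>.\<close>

lemma cholesky:
  fixes K :: "nat \<Rightarrow> nat \<Rightarrow> real"
  assumes "\<And>i j. K i j = K j i"
    and "\<And>x. 0 \<le> (\<Sum>i<n. \<Sum>j<n. x i * x j * K i j)"
  shows "\<exists>a. \<forall>i<n. \<forall>j<n. K i j = (\<Sum>l<n. a i l * a j l)"
  using assms
proof (induction n arbitrary: K)
  case 0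
  then show ?case by simp
next
  case (Suc n)
  have expand: "(\<Sum>i<Suc n. \<Sum>j<Suc n. x i * x j * K i j) =
      (\<Sum>i<n. \<Sum>j<n. x i * x j * K i j) + 2 * x n * (\<Sum>i<n. x i * K i n) + x n * x n * K n n" for x
  proof -
    have "(\<Sum>j<n. x n * x j * K n j) = (\<Sum>j<n. x j * K j n) * x n"
      unfolding sum_distrib_right by (intro sum.cong refl) (subst Suc.prems(1)[of n], simp)
    moreover have "(\<Sum>i<n. x i * x n * K i n) = (\<Sum>j<n. x j * K j n) * x n"
      unfolding sum_distrib_right by (intro sum.cong refl) simp
    ultimately show ?thesis by (simp add: sum.distrib)
  qed
  have Knn: "K n n \<ge> 0"
  proof -
    have "0 \<le> (\<Sum>i<Suc n. \<Sum>j<Suc n. of_bool (i = n) * of_bool (j = n) * K i j)"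
      by (rule Suc.prems(2))
    then show ?thesis unfolding expand[of "\<lambda>i. of_bool (i = n)"] by simp
  qed
  have Kin: "K i n = 0" if "K n n = 0" "i < n" for i
  proof (rule ccontr)
    assume ne: "K i n \<noteq> 0"
    \<comment> \<open>With this t the form evaluates to -1 at the vector with entry 1 at
      \<open>i\<close> and t at \<open>n\<close>.\<close>
    define t where "t = - (K i i + 1) / (2 * K i n)"
    let ?x = "\<lambda>k. if k = n then t else of_bool (k = i)"
    have d: "(if k = n then t else of_bool (k = i)) = of_bool (k = i)" if "k < n" for k
      using that by simp
    have "(\<Sum>k<n. \<Sum>j<n. ?x k * ?x j * K k j) = (\<Sum>k<n. \<Sum>j<n. of_bool (k = i) * of_bool (j = i) * K k j)"
      by (intro sum.cong refl) (simp add: d)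
    also have "\<dots> = K i i" using \<open>i < n\<close> by (simp add: mult.assoc flip: sum_distrib_left)
    finally have 1: "(\<Sum>k<n. \<Sum>j<n. ?x k * ?x j * K k j) = K i i" .
    have "(\<Sum>k<n. ?x k * K k n) = (\<Sum>k<n. of_bool (k = i) * K k n)"
      by (intro sum.cong refl) (simp add: d)
    then have 2: "(\<Sum>k<n. ?x k * K k n) = K i n" using \<open>i < n\<close> by simp
    have "0 \<le> (\<Sum>k<Suc n. \<Sum>j<Suc n. ?x k * ?x j * K k j)" by (rule Suc.prems(2))
    then have "0 \<le> K i i + 2 * t * K i n" unfolding expand[of ?x] 1 2 using that by simp
    also have "2 * t * K i n = - (K i i + 1)" using ne by (simp add: t_def)
    finally show False by simp
  qed
  define K' where "K' i j = K i j - K i n * K j n / K n n" for i j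
  have "\<exists>a. \<forall>i<n. \<forall>j<n. K' i j = (\<Sum>l<n. a i l * a j l)"
  proof (rule Suc.IH)
    show "K' i j = K' j i" for i j unfolding K'_def by (subst Suc.prems(1)) (simp only: mult.commute)
    show "0 \<le> (\<Sum>i<n. \<Sum>j<n. x i * x j * K' i j)" for x
    proof -
      define s where "s = (\<Sum>i<n. x i * K i n)"
      \<comment> \<open>The last entry minimises the form over the free coordinate (completion of
        the square). If \<open>K n n = 0\<close> it is 0 by division by zero, and the subtracted
        term is 0 as well.\<close>
      let ?y = "\<lambda>i. if i = n then - s / K n n else x i"
      have d: "?y k = x k" if "k < n" for k using that by simp
      have 1: "(\<Sum>i<n. \<Sum>j<n. ?y i * ?y j * K i j) = (\<Sum>i<n. \<Sum>j<n. x i * x j * K i j)"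
        and 2: "(\<Sum>i<n. ?y i * K i n) = s"
        by (auto simp: s_def intro!: sum.cong)
      have "(\<Sum>i<n. \<Sum>j<n. x i * x j * K' i j) =
          (\<Sum>i<n. \<Sum>j<n. x i * x j * K i j) - (\<Sum>i<n. \<Sum>j<n. (x i * K i n) * (x j * K j n)) / K n n"
        by (simp add: K'_def sum_subtractf sum_divide_distrib algebra_simps)
      also have "(\<Sum>i<n. \<Sum>j<n. (x i * K i n) * (x j * K j n)) = s * s"
        by (simp add: s_def sum_product)
      also have "(\<Sum>i<n. \<Sum>j<n. x i * x j * K i j) - s * s / K n n = (\<Sum>i<Suc n. \<Sum>j<Suc n. ?y i * ?y j * K i j)"
        unfolding expand[of ?y] 1 2 by (cases "K n n = 0") (auto simp: field_simps)
      finally show ?thesis using Suc.prems(2)[of ?y] by simp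
    qed
  qed
  then obtain a where a: "\<And>i j. i < n \<Longrightarrow> j < n \<Longrightarrow> K' i j = (\<Sum>l<n. a i l * a j l)" by blast
  \<comment> \<open>The new column carries the rank one part; the entry of row \<open>n\<close> in
    it is \<open>K n n / sqrt (K n n)\<close>, and the rest of that row vanishes.\<close>
  define b where "b i l = (if l = n then K i n / sqrt (K n n) else if i = n then 0 else a i l)" for i l
  have "K i j = (\<Sum>l<Suc n. b i l * b j l)" if ij: "i < Suc n" "j < Suc n" for i j
  proof -
    have last: "b i n * b j n = K i n * K j n / K n n" using Knn by (simp add: b_def)
    consider "i < n" "j < n" | "i = n" | "j = n" using ij by linarith
    then show ?thesis
    proof cases
      case 1
      then have "(\<Sum>l<n. b i l * b j l) = K' i j" unfolding a[OF 1] by (intro sum.cong) (auto simp: b_def)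
      then show ?thesis using last by (simp add: K'_def)
    next
      case 2
      then have "(\<Sum>l<n. b i l * b j l) = 0" by (intro sum.neutral) (auto simp: b_def)
      moreover have "K i j = K i n * K j n / K n n"
      proof -
        have "K n j = K j n" by (rule Suc.prems(1))
        then show ?thesis using 2 Kin[of j] ij by (cases "K n n = 0"; cases "j = n") simp_all
      qed
      ultimately show ?thesis using last by simp
    next
      case 3
      then have "(\<Sum>l<n. b i l * b j l) = 0" by (intro sum.neutral) (auto simp: b_def)
      moreover have "K i j = K i n * K j n / K n n"
        using 3 Kin[of i] ij by (cases "K n n = 0"; cases "i = n") auto
      ultimately show ?thesis using last by simp
    qed
  qed
  then show ?case by (intro exI[of _ b]) blast
qed

section \<open>Probability metrics and Lipschitz test functions\<close>

text \<open>Used for two distances: the \<open>l1\<close> distance on coordinate tuples and the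
  Skorohod distance. Separation is left out because the former is interpreted for every index set,
  and over an infinite one its sum is 0. The carrier is explicit because
  \<open>skorohod_dist\<close> is meaningful on cadlag paths only.\<close>

locale pseudo_dist =
  fixes S :: "'a set" and d :: "'a \<Rightarrow> 'a \<Rightarrow> real"
  assumes d_nonneg: "x \<in> S \<Longrightarrow> y \<in> S \<Longrightarrow> 0 \<le> d x y"
    and d_refl: "x \<in> S \<Longrightarrow> d x x = 0"
    and d_sym: "x \<in> S \<Longrightarrow> y \<in> S \<Longrightarrow> d x y = d y x"
    and d_tri: "x \<in> S \<Longrightarrow> y \<in> S \<Longrightarrow> z \<in> S \<Longrightarrow> d x z \<le> d x y + d y z"
begin

definition bounded_lipschitz :: "('a \<Rightarrow> real) \<Rightarrow> bool" where
  "bounded_lipschitz h \<longleftrightarrow> (\<exists>K. \<forall>x\<in>S. \<bar>h x\<bar> \<le> K) \<and>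
     (\<exists>L\<ge>0. \<forall>x\<in>S. \<forall>y\<in>S. \<bar>h x - h y\<bar> \<le> L * d x y)"

text \<open>The infimal convolution of \<open>f\<close> with \<open>k\<close> times the distance
  (Pasch-Hausdorff envelope), which is the largest minorant of a nonnegative \<open>f\<close> with
  Lipschitz constant \<open>k\<close>.\<close>

definition lip_minorant :: "('a \<Rightarrow> real) \<Rightarrow> nat \<Rightarrow> 'a \<Rightarrow> real" where
  "lip_minorant f k x = (INF y\<in>S. f y + real k * d x y)"

lemma lip_minorant_bdd:
  assumes "\<And>y. y \<in> S \<Longrightarrow> 0 \<le> f y" "x \<in> S"
  shows "bdd_below ((\<lambda>y. f y + real k * d x y) ` S)"
  using assms d_nonneg by (intro bdd_belowI[of _ 0]) (auto intro!: add_nonneg_nonneg mult_nonneg_nonneg)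

lemma lip_minorant_le:
  assumes "\<And>y. y \<in> S \<Longrightarrow> 0 \<le> f y" "x \<in> S"
  shows "lip_minorant f k x \<le> f x"
proof -
  have "lip_minorant f k x \<le> f x + real k * d x x"
    unfolding lip_minorant_def using assms by (intro cINF_lower lip_minorant_bdd) auto
  then show ?thesis using d_refl assms by simp
qed

lemma lip_minorant_nonneg:
  assumes "\<And>y. y \<in> S \<Longrightarrow> 0 \<le> f y" "x \<in> S"
  shows "0 \<le> lip_minorant f k x"
  unfolding lip_minorant_def using assms d_nonneg
  by (intro cINF_greatest) (auto intro!: add_nonneg_nonneg mult_nonneg_nonneg)

lemma lip_minorant_lipschitz_aux:
  assumes "\<And>y. y \<in> S \<Longrightarrow> 0 \<le> f y" "x \<in> S" "y \<in> S"
  shows "lip_minorant f k x \<le> lip_minorant f k y + real k * d x y"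
proof -
  have "lip_minorant f k x - real k * d x y \<le> f z + real k * d y z" if "z \<in> S" for z
  proof -
    have "lip_minorant f k x \<le> f z + real k * d x z"
      unfolding lip_minorant_def using assms that by (intro cINF_lower lip_minorant_bdd) auto
    also have "\<dots> \<le> f z + real k * (d x y + d y z)"
      using d_tri[OF assms(2,3) that] by (intro add_left_mono mult_left_mono) auto
    finally show ?thesis by (simp add: algebra_simps)
  qed
  then have "lip_minorant f k x - real k * d x y \<le> lip_minorant f k y"
    unfolding lip_minorant_def[of f k y] using assms by (intro cINF_greatest) auto
  then show ?thesis by simp
qed

lemma bounded_lipschitz_lip_minorant:
  assumes "\<And>y. y \<in> S \<Longrightarrow> 0 \<le> f y" "\<And>y. y \<in> S \<Longrightarrow> f y \<le> (K::real)"
  shows "bounded_lipschitz (lip_minorant f k)"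
  unfolding bounded_lipschitz_def
proof (intro conjI exI ballI)
  show "\<bar>lip_minorant f k x\<bar> \<le> K" if "x \<in> S" for x
    using lip_minorant_nonneg[of f x k] lip_minorant_le[of f x k] assms that by force
  show "real k \<ge> 0" by simp
  show "\<bar>lip_minorant f k x - lip_minorant f k y\<bar> \<le> real k * d x y" if "x \<in> S" "y \<in> S" for x y
    using lip_minorant_lipschitz_aux[of f x y k] lip_minorant_lipschitz_aux[of f y x k] assms(1) that
      d_sym[of x y] by force
qed

text \<open>Near \<open>x\<close> the values of \<open>f\<close> are almost \<open>f x\<close>; at
  distance \<open>r\<close> or more the penalty exceeds the bound \<open>K\<close>, hence
  \<open>f x\<close>, as soon as \<open>k * r > K\<close>. So the infimum is almost
  \<open>f x\<close> for large \<open>k\<close>.\<close>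

lemma lip_minorant_tendsto:
  assumes f: "\<And>y. y \<in> S \<Longrightarrow> 0 \<le> f y" "\<And>y. y \<in> S \<Longrightarrow> f y \<le> (K::real)" and x: "x \<in> S"
    and cont: "\<And>e. e > 0 \<Longrightarrow> \<exists>r>0. \<forall>y\<in>S. d x y < r \<longrightarrow> \<bar>f y - f x\<bar> < e"
  shows "(\<lambda>k. lip_minorant f k x) \<longlonglongrightarrow> f x"
proof (rule LIMSEQ_I)
  fix e :: real assume e: "e > 0"
  then obtain r where r: "r > 0" "\<And>y. y \<in> S \<Longrightarrow> d x y < r \<Longrightarrow> \<bar>f y - f x\<bar> < e / 2"
    using cont[of "e/2"] by auto
  obtain k0 where k0: "real k0 * r > K" using ex_less_of_nat_mult[OF r(1)] by auto
  have "norm (lip_minorant f k x - f x) < e" if k: "k \<ge> k0" for k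
  proof -
    have "f x - e/2 \<le> f y + real k * d x y" if y: "y \<in> S" for y
    proof (cases "d x y < r")
      case True
      then have "f x - e/2 \<le> f y" using r(2)[OF y True] by linarith
      then show ?thesis using d_nonneg[OF x y] by (simp add: add_increasing2)
    next
      case False
      have "f x \<le> K" using f x by auto
      also have "K \<le> real k0 * r" using k0 by simp
      also have "\<dots> \<le> real k * d x y" using k False r(1) by (intro mult_mono) auto
      finally show ?thesis using f(1)[OF y] e by linarith
    qed
    then have "f x - e/2 \<le> lip_minorant f k x"
      unfolding lip_minorant_def using x by (intro cINF_greatest) auto
    then show ?thesis using lip_minorant_le[of f x k] f(1) x e by force
  qed
  then show "\<exists>no. \<forall>n\<ge>no. norm (lip_minorant f n x - f x) < e" by blast
qed

text \<open>The lower half of a portmanteau argument: a Lipschitz minorant whose limit integral is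
  within \<open>e / 2\<close> of that of \<open>f\<close> is fixed first, and its integrals converge
  by hypothesis.\<close>

lemma integral_liminf_of_lipschitz:
  fixes X :: "nat \<Rightarrow> 'b \<Rightarrow> 'a" and X' :: "'c \<Rightarrow> 'a"
  assumes M: "\<And>n. prob_space (M n)" "prob_space M'"
    and X: "\<And>n \<omega>. \<omega> \<in> space (M n) \<Longrightarrow> X n \<omega> \<in> S" "\<And>\<omega>. \<omega> \<in> space M' \<Longrightarrow> X' \<omega> \<in> S"
    and meas: "\<And>h n. bounded_lipschitz h \<Longrightarrow> (\<lambda>\<omega>. h (X n \<omega>)) \<in> borel_measurable (M n)"
              "\<And>h. bounded_lipschitz h \<Longrightarrow> (\<lambda>\<omega>. h (X' \<omega>)) \<in> borel_measurable M'"
    and conv: "\<And>h. bounded_lipschitz h \<Longrightarrow> (\<lambda>n. \<integral>\<omega>. h (X n \<omega>) \<partial>M n) \<longlonglongrightarrow> (\<integral>\<omega>. h (X' \<omega>) \<partial>M')"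
    and fm: "\<And>n. (\<lambda>\<omega>. f (X n \<omega>)) \<in> borel_measurable (M n)" "(\<lambda>\<omega>. f (X' \<omega>)) \<in> borel_measurable M'"
    and f: "\<And>y. y \<in> S \<Longrightarrow> 0 \<le> f y" "\<And>y. y \<in> S \<Longrightarrow> f y \<le> (K::real)"
    and cont: "\<And>x e. x \<in> S \<Longrightarrow> e > 0 \<Longrightarrow> \<exists>r>0. \<forall>y\<in>S. d x y < r \<longrightarrow> \<bar>f y - f x\<bar> < e"
    and e: "e > 0"
  shows "eventually (\<lambda>n. (\<integral>\<omega>. f (X n \<omega>) \<partial>M n) > (\<integral>\<omega>. f (X' \<omega>) \<partial>M') - e) sequentially"
proof -
  have F: "bounded_lipschitz (lip_minorant f k)" for k
    using f by (rule bounded_lipschitz_lip_minorant)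
  interpret M': prob_space M' by fact
  have "(\<lambda>k. \<integral>\<omega>. lip_minorant f k (X' \<omega>) \<partial>M') \<longlonglongrightarrow> (\<integral>\<omega>. f (X' \<omega>) \<partial>M')"
  proof (rule integral_dominated_convergence[where w="\<lambda>_. K"])
    show "AE \<omega> in M'. norm (lip_minorant f k (X' \<omega>)) \<le> K" for k
    proof (rule AE_I2)
      fix \<omega> assume "\<omega> \<in> space M'"
      then show "norm (lip_minorant f k (X' \<omega>)) \<le> K"
        using lip_minorant_nonneg[of f "X' \<omega>" k] lip_minorant_le[of f "X' \<omega>" k] f X(2)[of \<omega>] by force
    qed
    show "AE \<omega> in M'. (\<lambda>k. lip_minorant f k (X' \<omega>)) \<longlonglongrightarrow> f (X' \<omega>)"
      using X(2) by (intro AE_I2 lip_minorant_tendsto[OF f]) (auto intro: cont)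
  qed (use fm meas(2)[OF F] in auto)
  then have "eventually (\<lambda>k. (\<integral>\<omega>. lip_minorant f k (X' \<omega>) \<partial>M') > (\<integral>\<omega>. f (X' \<omega>) \<partial>M') - e/2) sequentially"
    using e by (intro order_tendstoD(1)) auto
  then obtain k where k: "(\<integral>\<omega>. lip_minorant f k (X' \<omega>) \<partial>M') > (\<integral>\<omega>. f (X' \<omega>) \<partial>M') - e/2"
    by (auto simp: eventually_sequentially)
  have "eventually (\<lambda>n. (\<integral>\<omega>. lip_minorant f k (X n \<omega>) \<partial>M n) > (\<integral>\<omega>. lip_minorant f k (X' \<omega>) \<partial>M') - e/2) sequentially"
    using e by (intro order_tendstoD(1)[OF conv[OF F]]) auto
  then show ?thesis
  proof eventually_elim
    case (elim n)
    interpret Mn: prob_space "M n" by fact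
    have "(\<integral>\<omega>. lip_minorant f k (X n \<omega>) \<partial>M n) \<le> (\<integral>\<omega>. f (X n \<omega>) \<partial>M n)"
    proof (rule integral_mono)
      show "integrable (M n) (\<lambda>\<omega>. lip_minorant f k (X n \<omega>))"
        using X(1) lip_minorant_nonneg[of f _ k] lip_minorant_le[of f _ k] f
        by (intro Mn.integrable_const_bound[where B=K] AE_I2 meas F) force
      show "integrable (M n) (\<lambda>\<omega>. f (X n \<omega>))"
        using X(1) f by (intro Mn.integrable_const_bound[where B=K] AE_I2 fm) force
    qed (use X(1) f in \<open>auto intro!: lip_minorant_le\<close>)
    then show ?case using elim k by linarith
  qed
qed

text \<open>The one-sided result is applied to the nonnegative functions \<open>K + f\<close> and
  \<open>K - f\<close>, which bounds the integrals of \<open>f\<close> from below and from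
  above.\<close>

theorem convergence_of_lipschitz:
  fixes X :: "nat \<Rightarrow> 'b \<Rightarrow> 'a" and X' :: "'c \<Rightarrow> 'a"
  assumes M: "\<And>n. prob_space (M n)" "prob_space M'"
    and X: "\<And>n \<omega>. \<omega> \<in> space (M n) \<Longrightarrow> X n \<omega> \<in> S" "\<And>\<omega>. \<omega> \<in> space M' \<Longrightarrow> X' \<omega> \<in> S"
    and meas: "\<And>h n. bounded_lipschitz h \<Longrightarrow> (\<lambda>\<omega>. h (X n \<omega>)) \<in> borel_measurable (M n)"
              "\<And>h. bounded_lipschitz h \<Longrightarrow> (\<lambda>\<omega>. h (X' \<omega>)) \<in> borel_measurable M'"
    and conv: "\<And>h. bounded_lipschitz h \<Longrightarrow> (\<lambda>n. \<integral>\<omega>. h (X n \<omega>) \<partial>M n) \<longlonglongrightarrow> (\<integral>\<omega>. h (X' \<omega>) \<partial>M')"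
    and fm: "\<And>n. (\<lambda>\<omega>. f (X n \<omega>)) \<in> borel_measurable (M n)" "(\<lambda>\<omega>. f (X' \<omega>)) \<in> borel_measurable M'"
    and f: "\<And>y. y \<in> S \<Longrightarrow> \<bar>f y\<bar> \<le> (K::real)"
    and cont: "\<And>x e. x \<in> S \<Longrightarrow> e > 0 \<Longrightarrow> \<exists>r>0. \<forall>y\<in>S. d x y < r \<longrightarrow> \<bar>f y - f x\<bar> < e"
  shows "(\<lambda>n. \<integral>\<omega>. f (X n \<omega>) \<partial>M n) \<longlonglongrightarrow> (\<integral>\<omega>. f (X' \<omega>) \<partial>M')"
proof -
  have int: "integrable (M n) (\<lambda>\<omega>. f (X n \<omega>))" for n
  proof -
    interpret Mn: prob_space "M n" by fact
    show ?thesis using X(1) f by (intro Mn.integrable_const_bound[where B=K] AE_I2 fm) auto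
  qed
  interpret M': prob_space M' by fact
  have int': "integrable M' (\<lambda>\<omega>. f (X' \<omega>))"
    using X(2) f by (intro M'.integrable_const_bound[where B=K] AE_I2 fm) auto
  have up: "eventually (\<lambda>n. (\<integral>\<omega>. f (X n \<omega>) \<partial>M n) > (\<integral>\<omega>. f (X' \<omega>) \<partial>M') - e) sequentially" if "e > 0" for e
  proof -
    have "eventually (\<lambda>n. (\<integral>\<omega>. K + f (X n \<omega>) \<partial>M n) > (\<integral>\<omega>. K + f (X' \<omega>) \<partial>M') - e) sequentially"
    proof (rule integral_liminf_of_lipschitz[OF M X meas conv, where f="\<lambda>x. K + f x" and K="2*K"])
      show "0 \<le> K + f y" "K + f y \<le> 2 * K" if "y \<in> S" for y using f[OF that] by auto
    qed (use fm that in \<open>auto intro: cont\<close>)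
    moreover have "(\<integral>\<omega>. K + f (X n \<omega>) \<partial>M n) = K + (\<integral>\<omega>. f (X n \<omega>) \<partial>M n)" for n
      using int[of n] prob_space.prob_space[OF M(1)[of n]] prob_space.finite_measure[OF M(1)[of n]]
      by (simp add: finite_measure.integrable_const)
    moreover have "(\<integral>\<omega>. K + f (X' \<omega>) \<partial>M') = K + (\<integral>\<omega>. f (X' \<omega>) \<partial>M')"
      using int' M'.prob_space by simp
    ultimately show ?thesis by simp
  qed
  have down: "eventually (\<lambda>n. (\<integral>\<omega>. f (X n \<omega>) \<partial>M n) < (\<integral>\<omega>. f (X' \<omega>) \<partial>M') + e) sequentially" if "e > 0" for e
  proof -
    have "eventually (\<lambda>n. (\<integral>\<omega>. K - f (X n \<omega>) \<partial>M n) > (\<integral>\<omega>. K - f (X' \<omega>) \<partial>M') - e) sequentially"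
    proof (rule integral_liminf_of_lipschitz[OF M X meas conv, where f="\<lambda>x. K - f x" and K="2*K"])
      show "0 \<le> K - f y" "K - f y \<le> 2 * K" if "y \<in> S" for y using f[OF that] by auto
      show "\<exists>r>0. \<forall>y\<in>S. d x y < r \<longrightarrow> \<bar>(K - f y) - (K - f x)\<bar> < e" if "x \<in> S" "e > 0" for x e
        using cont[OF that] by (simp add: abs_minus_commute)
    qed (use fm that in auto)
    moreover have "(\<integral>\<omega>. K - f (X n \<omega>) \<partial>M n) = K - (\<integral>\<omega>. f (X n \<omega>) \<partial>M n)" for n
      using int[of n] prob_space.prob_space[OF M(1)[of n]] prob_space.finite_measure[OF M(1)[of n]]
      by (simp add: finite_measure.integrable_const)
    moreover have "(\<integral>\<omega>. K - f (X' \<omega>) \<partial>M') = K - (\<integral>\<omega>. f (X' \<omega>) \<partial>M')"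
      using int' M'.prob_space by simp
    ultimately show ?thesis by (simp add: algebra_simps)
  qed
  show ?thesis
  proof (rule order_tendstoI)
    fix a assume "a < (\<integral>\<omega>. f (X' \<omega>) \<partial>M')"
    then show "eventually (\<lambda>n. a < (\<integral>\<omega>. f (X n \<omega>) \<partial>M n)) sequentially"
      using up[of "(\<integral>\<omega>. f (X' \<omega>) \<partial>M') - a"] by (auto elim: eventually_mono)
  next
    fix a assume "(\<integral>\<omega>. f (X' \<omega>) \<partial>M') < a"
    then show "eventually (\<lambda>n. (\<integral>\<omega>. f (X n \<omega>) \<partial>M n) < a) sequentially"
      using down[of "a - (\<integral>\<omega>. f (X' \<omega>) \<partial>M')"] by (auto elim: eventually_mono)
  qed
qed

end

section \<open>Gaussian smoothing and a continuity theorem\<close>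

lemma abs_integral_le:
  fixes f g :: "'a \<Rightarrow> real"
  assumes "integrable M f" "integrable M g" "\<And>x. x \<in> space M \<Longrightarrow> \<bar>f x\<bar> \<le> g x"
  shows "\<bar>\<integral>x. f x \<partial>M\<bar> \<le> (\<integral>x. g x \<partial>M)"
proof -
  have "\<bar>\<integral>x. f x \<partial>M\<bar> \<le> (\<integral>x. \<bar>f x\<bar> \<partial>M)" by (rule integral_abs_bound)
  also have "\<dots> \<le> (\<integral>x. g x \<partial>M)" using assms by (intro integral_mono) auto
  finally show ?thesis .
qed

text \<open>For \<open>s > 0\<close> this is the density at \<open>y\<close> of \<open>x\<close>
  plus independent centred normal noise of standard deviation \<open>s\<close> in every coordinate
  of \<open>J\<close>.\<close>

definition gauss_kernel :: "'i set \<Rightarrow> real \<Rightarrow> ('i \<Rightarrow> real) \<Rightarrow> ('i \<Rightarrow> real) \<Rightarrow> real" where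
  "gauss_kernel J s x y = (\<Prod>t\<in>J. normal_density (x t) s (y t))"

interpretation LB: product_sigma_finite "\<lambda>_. lborel :: real measure"
  by (rule product_sigma_finite.intro) (rule lborel.sigma_finite_measure_axioms)

interpretation SN: product_sigma_finite "\<lambda>_. std_normal_distribution"
  by (rule product_sigma_finite.intro) (rule prob_space_imp_sigma_finite, rule prob_space_normal_density, simp)

lemma gauss_kernel_nonneg: "0 \<le> gauss_kernel J s x y"
  unfolding gauss_kernel_def by (intro prod_nonneg) simp

lemma gauss_kernel_integral:
  assumes "finite J" "0 < s"
  shows "integrable (\<Pi>\<^sub>M t\<in>J. lborel) (gauss_kernel J s x)"
    "(\<integral>y. gauss_kernel J s x y \<partial>(\<Pi>\<^sub>M t\<in>J. lborel)) = 1"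
proof -
  have i: "integrable lborel (normal_density (x t) s)" for t using assms(2) by (rule integrable_normal_density)
  show "integrable (\<Pi>\<^sub>M t\<in>J. lborel) (gauss_kernel J s x)"
    unfolding gauss_kernel_def[abs_def] by (rule LB.product_integrable_prod[OF assms(1) i])
  show "(\<integral>y. gauss_kernel J s x y \<partial>(\<Pi>\<^sub>M t\<in>J. lborel)) = 1"
    unfolding gauss_kernel_def LB.product_integral_prod[OF assms(1) i] using assms(2) by simp
qed

lemma gauss_kernel_first_moment:
  assumes J: "finite J" "u \<in> J" and s: "0 < s"
  shows "integrable (\<Pi>\<^sub>M t\<in>J. lborel) (\<lambda>y. \<bar>x u - y u\<bar> * gauss_kernel J s x y)"
    "(\<integral>y. \<bar>x u - y u\<bar> * gauss_kernel J s x y \<partial>(\<Pi>\<^sub>M t\<in>J. lborel)) = s * sqrt (2 / pi)"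
proof -
  \<comment> \<open>The weight is put into the factor of the coordinate \<open>u\<close>, so that
    the integrand stays a product over the coordinates.\<close>
  define f where "f t z = (if t = u then normal_density (x t) s z * \<bar>z - x t\<bar> else normal_density (x t) s z)" for t z
  have b: "has_bochner_integral lborel (\<lambda>z. normal_density (x u) s z * \<bar>z - x u\<bar>) (s * sqrt (2 / pi))"
    using normal_moment_abs_odd[OF s, of "x u" 0] by simp
  have i: "integrable lborel (f t)" for t
  proof (cases "t = u")
    case True
    then show ?thesis using b unfolding f_def by (simp add: has_bochner_integral_iff)
  next
    case False
    then show ?thesis using integrable_normal_density[OF s] unfolding f_def by simp
  qed
  have eq: "\<bar>x u - y u\<bar> * gauss_kernel J s x y = (\<Prod>t\<in>J. f t (y t))" for y
  proof -
    have "(\<Prod>t\<in>J - {u}. f t (y t)) = (\<Prod>t\<in>J - {u}. normal_density (x t) s (y t))"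
      by (rule prod.cong) (auto simp: f_def)
    then show ?thesis
      unfolding gauss_kernel_def prod.remove[OF J] by (simp add: f_def abs_minus_commute)
  qed
  show "integrable (\<Pi>\<^sub>M t\<in>J. lborel) (\<lambda>y. \<bar>x u - y u\<bar> * gauss_kernel J s x y)"
    unfolding eq by (rule LB.product_integrable_prod[OF J(1) i])
  have "(\<Prod>t\<in>J - {u}. integral\<^sup>L lborel (f t)) = 1"
    using s unfolding f_def[abs_def] by (intro prod.neutral ballI) simp
  moreover have "integral\<^sup>L lborel (f u) = s * sqrt (2 / pi)"
    using b unfolding f_def by (simp add: has_bochner_integral_iff)
  ultimately have "(\<Prod>t\<in>J. integral\<^sup>L lborel (f t)) = s * sqrt (2 / pi)"
    unfolding prod.remove[OF J] by simp
  then show "(\<integral>y. \<bar>x u - y u\<bar> * gauss_kernel J s x y \<partial>(\<Pi>\<^sub>M t\<in>J. lborel)) = s * sqrt (2 / pi)"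
    unfolding eq LB.product_integral_prod[OF J(1) i] .
qed

definition l1_dist :: "'i set \<Rightarrow> ('i \<Rightarrow> real) \<Rightarrow> ('i \<Rightarrow> real) \<Rightarrow> real" where
  "l1_dist J x y = (\<Sum>t\<in>J. \<bar>x t - y t\<bar>)"

text \<open>The noise moves each coordinate by \<open>s * sqrt (2 / pi)\<close> on average, and
  \<open>f\<close> changes by at most \<open>L\<close> times the total displacement. The bound is
  uniform in \<open>x\<close>, hence survives integration over any law.\<close>

lemma smoothing_error:
  assumes J: "finite J" and s: "0 < s"
    and f: "f \<in> borel_measurable (\<Pi>\<^sub>M t\<in>J. lborel)" "\<And>y. y \<in> extensional J \<Longrightarrow> \<bar>f y\<bar> \<le> K"
    and lip: "\<And>x y. x \<in> extensional J \<Longrightarrow> y \<in> extensional J \<Longrightarrow> \<bar>f x - f y\<bar> \<le> L * l1_dist J x y"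
    and x: "x \<in> extensional J"
  shows "\<bar>f x - (\<integral>y. f y * gauss_kernel J s x y \<partial>(\<Pi>\<^sub>M t\<in>J. lborel))\<bar> \<le> s * (L * real (card J) * sqrt (2 / pi))"
proof -
  let ?M = "\<Pi>\<^sub>M t\<in>J. lborel :: real measure" and ?k = "gauss_kernel J s x"
  note [measurable] = f(1)
  note k = gauss_kernel_integral[OF J s, of x]
  have sp: "y \<in> extensional J" if "y \<in> space ?M" for y using that by (simp add: space_PiM PiE_iff)
  have km[measurable]: "?k \<in> borel_measurable ?M" using k(1) by (rule borel_measurable_integrable)
  have ik: "integrable ?M (\<lambda>y. f y * ?k y)"
  proof (rule Bochner_Integration.integrable_bound)
    show "integrable ?M (\<lambda>y. K * ?k y)" using k(1) by simp
    show "AE y in ?M. norm (f y * ?k y) \<le> norm (K * ?k y)"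
    proof (rule AE_I2)
      fix y assume "y \<in> space ?M"
      then have "\<bar>f y\<bar> \<le> \<bar>K\<bar>" using f(2)[OF sp] by fastforce
      then show "norm (f y * ?k y) \<le> norm (K * ?k y)" by (simp add: abs_mult mult_right_mono)
    qed
  qed measurable
  have i1: "integrable ?M (\<lambda>y. \<Sum>t\<in>J. \<bar>x t - y t\<bar> * ?k y)"
    by (rule Bochner_Integration.integrable_sum) (rule gauss_kernel_first_moment(1)[OF J _ s])
  have "f x - (\<integral>y. f y * ?k y \<partial>?M) = (\<integral>y. (f x - f y) * ?k y \<partial>?M)"
    using k ik by (simp add: left_diff_distrib)
  also have "\<bar>\<dots>\<bar> \<le> (\<integral>y. L * (\<Sum>t\<in>J. \<bar>x t - y t\<bar> * ?k y) \<partial>?M)"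
  proof (rule abs_integral_le)
    show "integrable ?M (\<lambda>y. (f x - f y) * ?k y)" using k ik by (simp add: left_diff_distrib)
    show "integrable ?M (\<lambda>y. L * (\<Sum>t\<in>J. \<bar>x t - y t\<bar> * ?k y))" using i1 by simp
    fix y assume "y \<in> space ?M"
    then have "\<bar>f x - f y\<bar> * ?k y \<le> (L * l1_dist J x y) * ?k y"
      by (intro mult_right_mono lip x sp gauss_kernel_nonneg)
    then show "\<bar>(f x - f y) * ?k y\<bar> \<le> L * (\<Sum>t\<in>J. \<bar>x t - y t\<bar> * ?k y)"
      using gauss_kernel_nonneg[of J s x y] by (simp add: abs_mult l1_dist_def sum_distrib_right mult.assoc)
  qed
  also have "\<dots> = L * (\<Sum>t\<in>J. s * sqrt (2 / pi))"
    using gauss_kernel_first_moment[OF J _ s, of _ x] by (simp add: Bochner_Integration.integral_sum)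
  also have "\<dots> = s * (L * real (card J) * sqrt (2 / pi))" by simp
  finally show ?thesis .
qed

lemma iexp_sum: "finite J \<Longrightarrow> iexp (\<Sum>t\<in>J. a t) = (\<Prod>t\<in>J. iexp (a t))"
  by (simp add: sum_distrib_left exp_sum)

text \<open>The Gaussian is, up to a constant, its own characteristic function.\<close>

lemma gauss_kernel_char:
  assumes J: "finite J" and s: "0 < s"
  shows "complex_of_real (gauss_kernel J s x y) = complex_of_real ((1 / sqrt (2 * pi * s\<^sup>2)) ^ card J) *
    (\<integral>\<zeta>. iexp (\<Sum>t\<in>J. (y t - x t) / s * \<zeta> t) \<partial>(\<Pi>\<^sub>M t\<in>J. std_normal_distribution))"
proof -
  interpret S: prob_space std_normal_distribution by (rule prob_space_normal_density) simp
  have i: "integrable std_normal_distribution (\<lambda>z. iexp ((y t - x t) / s * z))" for t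
    by (rule S.integrable_iexp) simp_all
  have "(\<integral>\<zeta>. iexp (\<Sum>t\<in>J. (y t - x t) / s * \<zeta> t) \<partial>(\<Pi>\<^sub>M t\<in>J. std_normal_distribution)) =
      (\<Prod>t\<in>J. \<integral>z. iexp ((y t - x t) / s * z) \<partial>std_normal_distribution)"
    unfolding iexp_sum[OF J] by (rule SN.product_integral_prod[OF J i])
  also have "\<dots> = (\<Prod>t\<in>J. complex_of_real (exp (- (((y t - x t) / s)\<^sup>2) / 2)))"
  proof -
    have "(\<integral>z. iexp (t * z) \<partial>std_normal_distribution) = complex_of_real (exp (- (t\<^sup>2) / 2))" for t
      using fun_cong[OF char_std_normal_distribution, of t] unfolding char_def .
    then show ?thesis by (simp only:)
  qed
  also have "complex_of_real ((1 / sqrt (2 * pi * s\<^sup>2)) ^ card J) * \<dots> =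
      (\<Prod>t\<in>J. complex_of_real (1 / sqrt (2 * pi * s\<^sup>2) * exp (- (((y t - x t) / s)\<^sup>2) / 2)))"
    by (simp add: prod_dividef power_divide)
  also have "\<dots> = complex_of_real (gauss_kernel J s x y)"
    unfolding gauss_kernel_def normal_density_def of_real_prod
    by (simp add: power_divide mult.commute)
  finally show ?thesis by simp
qed

lemma measurable_gauss_kernel_pair:
  assumes X: "X \<in> M \<rightarrow>\<^sub>M (\<Pi>\<^sub>M t\<in>J. borel)"
  shows "(\<lambda>z. gauss_kernel J s (X (fst z)) (snd z)) \<in> borel_measurable (M \<Otimes>\<^sub>M (\<Pi>\<^sub>M t\<in>J. lborel))"
  unfolding gauss_kernel_def normal_density_def
proof (intro borel_measurable_prod)
  fix t assume t: "t \<in> J"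
  have [measurable]: "(\<lambda>\<omega>. X \<omega> t) \<in> borel_measurable M"
    by (rule measurable_compose[OF X measurable_component_singleton[OF t]])
  have "(\<lambda>y. y t) \<in> (\<Pi>\<^sub>M t\<in>J. lborel) \<rightarrow>\<^sub>M lborel" by (rule measurable_component_singleton[OF t])
  then have [measurable]: "(\<lambda>y. y t) \<in> borel_measurable (\<Pi>\<^sub>M t\<in>J. lborel)" by simp
  show "(\<lambda>z. 1 / sqrt (2 * pi * s\<^sup>2) * exp (- (snd z t - X (fst z) t)\<^sup>2 / (2 * s\<^sup>2)))
      \<in> borel_measurable (M \<Otimes>\<^sub>M (\<Pi>\<^sub>M t\<in>J. lborel))" by measurable
qed

definition smoothed_density :: "'i set \<Rightarrow> real \<Rightarrow> 'b measure \<Rightarrow> ('b \<Rightarrow> 'i \<Rightarrow> real) \<Rightarrow> ('i \<Rightarrow> real) \<Rightarrow> real" where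
  "smoothed_density J s M X y = (\<integral>\<omega>. gauss_kernel J s (X \<omega>) y \<partial>M)"

text \<open>After exchanging the integrals, the law of \<open>X\<close> enters only through its
  characteristic function, integrated against a fixed Gaussian law. Hence convergence of
  characteristic functions passes to the densities by dominated convergence.\<close>

lemma smoothed_density_char:
  assumes J: "finite J" and s: "0 < s" and M: "prob_space M" and X: "X \<in> M \<rightarrow>\<^sub>M (\<Pi>\<^sub>M t\<in>J. borel)"
  shows "complex_of_real (smoothed_density J s M X y) = complex_of_real ((1 / sqrt (2 * pi * s\<^sup>2)) ^ card J) *
    (\<integral>\<zeta>. iexp (\<Sum>t\<in>J. y t / s * \<zeta> t) * (\<integral>\<omega>. iexp (\<Sum>t\<in>J. (- \<zeta> t / s) * X \<omega> t) \<partial>M)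
      \<partial>(\<Pi>\<^sub>M t\<in>J. std_normal_distribution))"
proof -
  interpret M: prob_space M by fact
  interpret S: prob_space "\<Pi>\<^sub>M t\<in>J. std_normal_distribution" by (rule prob_space_PiM) (rule prob_space_normal_density, simp)
  interpret SM: pair_prob_space "\<Pi>\<^sub>M t\<in>J. std_normal_distribution" M ..
  let ?S = "\<Pi>\<^sub>M t\<in>J. std_normal_distribution"
  have Xt[measurable]: "(\<lambda>\<omega>. X \<omega> t) \<in> borel_measurable M" if "t \<in> J" for t
    by (rule measurable_compose[OF X measurable_component_singleton[OF that]])
  have zt[measurable]: "(\<lambda>\<zeta>. \<zeta> t) \<in> borel_measurable ?S" if "t \<in> J" for t
  proof -
    have "(\<lambda>\<zeta>. \<zeta> t) \<in> ?S \<rightarrow>\<^sub>M std_normal_distribution" by (rule measurable_component_singleton[OF that])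
    then show ?thesis by simp
  qed
  let ?a = "\<lambda>\<zeta> \<omega>. \<Sum>t\<in>J. (y t - X \<omega> t) / s * \<zeta> t"
  have m: "(\<lambda>z. ?a (fst z) (snd z)) \<in> borel_measurable (?S \<Otimes>\<^sub>M M)"
  proof (rule borel_measurable_sum)
    fix t assume t: "t \<in> J"
    note [measurable] = Xt[OF t] zt[OF t]
    show "(\<lambda>z. (y t - X (snd z) t) / s * fst z t) \<in> borel_measurable (?S \<Otimes>\<^sub>M M)" by measurable
  qed
  have int: "integrable (?S \<Otimes>\<^sub>M M) (case_prod (\<lambda>\<zeta> \<omega>. iexp (?a \<zeta> \<omega>)))"
  proof (rule SM.P.integrable_const_bound[where B = 1])
    show "case_prod (\<lambda>\<zeta> \<omega>. iexp (?a \<zeta> \<omega>)) \<in> borel_measurable (?S \<Otimes>\<^sub>M M)"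
      unfolding case_prod_beta' using m by measurable
  qed (simp add: case_prod_beta')
  have "complex_of_real (smoothed_density J s M X y) = (\<integral>\<omega>. complex_of_real (gauss_kernel J s (X \<omega>) y) \<partial>M)"
    unfolding smoothed_density_def by (rule integral_complex_of_real[symmetric])
  also have "\<dots> = complex_of_real ((1 / sqrt (2 * pi * s\<^sup>2)) ^ card J) * (\<integral>\<omega>. (\<integral>\<zeta>. iexp (?a \<zeta> \<omega>) \<partial>?S) \<partial>M)"
    unfolding gauss_kernel_char[OF J s] by (rule integral_mult_right_zero)
  also have "(\<integral>\<omega>. (\<integral>\<zeta>. iexp (?a \<zeta> \<omega>) \<partial>?S) \<partial>M) = (\<integral>\<zeta>. (\<integral>\<omega>. iexp (?a \<zeta> \<omega>) \<partial>M) \<partial>?S)"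
    by (rule SM.Fubini_integral[OF int])
  also have "\<dots> = (\<integral>\<zeta>. iexp (\<Sum>t\<in>J. y t / s * \<zeta> t) * (\<integral>\<omega>. iexp (\<Sum>t\<in>J. (- \<zeta> t / s) * X \<omega> t) \<partial>M) \<partial>?S)"
  proof (rule Bochner_Integration.integral_cong[OF refl])
    fix \<zeta>
    have "?a \<zeta> \<omega> = (\<Sum>t\<in>J. y t / s * \<zeta> t) + (\<Sum>t\<in>J. (- \<zeta> t / s) * X \<omega> t)" for \<omega>
      unfolding sum.distrib[symmetric] by (rule sum.cong) (simp_all add: diff_divide_distrib left_diff_distrib)
    then have "iexp (?a \<zeta> \<omega>) = iexp (\<Sum>t\<in>J. y t / s * \<zeta> t) * iexp (\<Sum>t\<in>J. (- \<zeta> t / s) * X \<omega> t)" for \<omega>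
      by (simp only: of_real_add distrib_left exp_add)
    then show "(\<integral>\<omega>. iexp (?a \<zeta> \<omega>) \<partial>M) = iexp (\<Sum>t\<in>J. y t / s * \<zeta> t) * (\<integral>\<omega>. iexp (\<Sum>t\<in>J. (- \<zeta> t / s) * X \<omega> t) \<partial>M)"
      by (simp only: integral_mult_right_zero)
  qed
  finally show ?thesis .
qed

lemma smoothed_density_integral:
  assumes J: "finite J" and s: "0 < s" and M: "prob_space M" and X: "X \<in> M \<rightarrow>\<^sub>M (\<Pi>\<^sub>M t\<in>J. borel)"
    and f: "f \<in> borel_measurable (\<Pi>\<^sub>M t\<in>J. lborel)" "\<And>y. y \<in> extensional J \<Longrightarrow> \<bar>f y\<bar> \<le> K"
  shows "integrable (\<Pi>\<^sub>M t\<in>J. lborel) (\<lambda>y. f y * smoothed_density J s M X y)"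
    "integrable M (\<lambda>\<omega>. \<integral>y. f y * gauss_kernel J s (X \<omega>) y \<partial>(\<Pi>\<^sub>M t\<in>J. lborel))"
    "(\<integral>y. f y * smoothed_density J s M X y \<partial>(\<Pi>\<^sub>M t\<in>J. lborel)) =
     (\<integral>\<omega>. (\<integral>y. f y * gauss_kernel J s (X \<omega>) y \<partial>(\<Pi>\<^sub>M t\<in>J. lborel)) \<partial>M)"
proof -
  interpret M: prob_space M by fact
  interpret Lf: finite_product_sigma_finite "\<lambda>_. lborel :: real measure" J by standard (rule J)
  let ?L = "\<Pi>\<^sub>M t\<in>J. lborel :: real measure"
  interpret PP: pair_sigma_finite M "?L" ..
  note [measurable] = f(1)
  have km[measurable]: "(\<lambda>z. gauss_kernel J s (X (fst z)) (snd z)) \<in> borel_measurable (M \<Otimes>\<^sub>M ?L)"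
    by (rule measurable_gauss_kernel_pair[OF X])
  have int: "integrable (M \<Otimes>\<^sub>M ?L) (\<lambda>z. gauss_kernel J s (X (fst z)) (snd z))"
  proof (rule PP.Fubini_integrable)
    show "integrable M (\<lambda>\<omega>. \<integral>y. norm (gauss_kernel J s (X (fst (\<omega>, y))) (snd (\<omega>, y))) \<partial>?L)"
      using gauss_kernel_integral[OF J s] by (simp add: abs_of_nonneg gauss_kernel_nonneg)
    show "AE \<omega> in M. integrable ?L (\<lambda>y. gauss_kernel J s (X (fst (\<omega>, y))) (snd (\<omega>, y)))"
      using gauss_kernel_integral[OF J s] by simp
  qed (rule km)
  have int': "integrable (M \<Otimes>\<^sub>M ?L) (case_prod (\<lambda>\<omega> y. f y * gauss_kernel J s (X \<omega>) y))"
    unfolding case_prod_beta'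
  proof (rule Bochner_Integration.integrable_bound)
    show "integrable (M \<Otimes>\<^sub>M ?L) (\<lambda>z. K * gauss_kernel J s (X (fst z)) (snd z))" using int by simp
    show "AE z in M \<Otimes>\<^sub>M ?L. norm (f (snd z) * gauss_kernel J s (X (fst z)) (snd z)) \<le> norm (K * gauss_kernel J s (X (fst z)) (snd z))"
    proof (rule AE_I2)
      fix z assume "z \<in> space (M \<Otimes>\<^sub>M ?L)"
      then have "snd z \<in> extensional J" by (auto simp: space_pair_measure space_PiM PiE_iff)
      then have "\<bar>f (snd z)\<bar> \<le> \<bar>K\<bar>" using f(2) by fastforce
      then show "norm (f (snd z) * gauss_kernel J s (X (fst z)) (snd z)) \<le> norm (K * gauss_kernel J s (X (fst z)) (snd z))"
        by (simp add: abs_mult mult_right_mono)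
    qed
  qed measurable
  show "integrable M (\<lambda>\<omega>. \<integral>y. f y * gauss_kernel J s (X \<omega>) y \<partial>?L)"
    using PP.integrable_fst'[OF int'] by simp
  have "integrable ?L (\<lambda>y. \<integral>\<omega>. f y * gauss_kernel J s (X \<omega>) y \<partial>M)"
    using PP.integrable_snd[OF int'] by simp
  then show "integrable ?L (\<lambda>y. f y * smoothed_density J s M X y)"
    unfolding smoothed_density_def by simp
  show "(\<integral>y. f y * smoothed_density J s M X y \<partial>?L) = (\<integral>\<omega>. (\<integral>y. f y * gauss_kernel J s (X \<omega>) y \<partial>?L) \<partial>M)"
    using PP.Fubini_integral[OF int'] unfolding smoothed_density_def by simp
qed

text \<open>No tightness argument occurs: for fixed \<open>s\<close> the smoothed laws have
  densities that converge pointwise and therefore in mean, and the smoothing is removed at a cost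
  proportional to \<open>s\<close>, the same for all \<open>n\<close>.\<close>

theorem levy_continuity_lipschitz:
  fixes X :: "nat \<Rightarrow> 'b \<Rightarrow> 'i \<Rightarrow> real" and X' :: "'c \<Rightarrow> 'i \<Rightarrow> real"
  assumes J: "finite J"
    and M: "\<And>n. prob_space (M n)" "prob_space M'"
    and X: "\<And>n. X n \<in> M n \<rightarrow>\<^sub>M (\<Pi>\<^sub>M t\<in>J. borel)" "X' \<in> M' \<rightarrow>\<^sub>M (\<Pi>\<^sub>M t\<in>J. borel)"
    and char: "\<And>a. (\<lambda>n. \<integral>\<omega>. iexp (\<Sum>t\<in>J. a t * X n \<omega> t) \<partial>M n) \<longlonglongrightarrow> (\<integral>\<omega>. iexp (\<Sum>t\<in>J. a t * X' \<omega> t) \<partial>M')"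
    and f: "f \<in> borel_measurable (\<Pi>\<^sub>M t\<in>J. borel)" "\<And>y. y \<in> extensional J \<Longrightarrow> \<bar>f y\<bar> \<le> K"
    and lip: "\<And>x y. x \<in> extensional J \<Longrightarrow> y \<in> extensional J \<Longrightarrow> \<bar>f x - f y\<bar> \<le> L * l1_dist J x y"
  shows "(\<lambda>n. \<integral>\<omega>. f (X n \<omega>) \<partial>M n) \<longlonglongrightarrow> (\<integral>\<omega>. f (X' \<omega>) \<partial>M')"
proof -
  let ?P = "\<Pi>\<^sub>M t\<in>J. lborel :: real measure"
  have sP: "sets ?P = sets (\<Pi>\<^sub>M t\<in>J. borel :: real measure)" by (rule sets_PiM_cong) simp_all
  have fP: "f \<in> borel_measurable ?P" using f(1) by (simp only: measurable_cong_sets[OF sP refl])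
  have ext: "X n \<omega> \<in> extensional J" if "\<omega> \<in> space (M n)" for n \<omega>
    using measurable_space[OF X(1) that] by (simp add: space_PiM PiE_iff)
  have ext': "X' \<omega> \<in> extensional J" if "\<omega> \<in> space M'" for \<omega>
    using measurable_space[OF X(2) that] by (simp add: space_PiM PiE_iff)
  have smooth: "(\<lambda>n. \<integral>\<omega>. (\<integral>y. f y * gauss_kernel J s (X n \<omega>) y \<partial>?P) \<partial>M n) \<longlonglongrightarrow>
      (\<integral>\<omega>. (\<integral>y. f y * gauss_kernel J s (X' \<omega>) y \<partial>?P) \<partial>M')" if s: "0 < s" for s
  proof -
    let ?d = "\<lambda>n. smoothed_density J s (M n) (X n)" and ?d' = "smoothed_density J s M' X'"
    let ?S = "\<Pi>\<^sub>M t\<in>J. std_normal_distribution"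
    interpret S: prob_space ?S by (rule prob_space_PiM) (rule prob_space_normal_density, simp)
    have one: "integrable ?P (smoothed_density J s N Z)" "(\<integral>y. smoothed_density J s N Z y \<partial>?P) = 1"
      if "prob_space N" "Z \<in> N \<rightarrow>\<^sub>M (\<Pi>\<^sub>M t\<in>J. borel)" for N :: "'z measure" and Z
    proof -
      interpret N: prob_space N by fact
      show "integrable ?P (smoothed_density J s N Z)" "(\<integral>y. smoothed_density J s N Z y \<partial>?P) = 1"
        using smoothed_density_integral[OF J s that, of "\<lambda>_. 1" 1] gauss_kernel_integral[OF J s] N.prob_space
        by simp_all
    qed
    note d = one[OF M(1) X(1)] and d' = one[OF M(2) X(2)]
    have dnn: "0 \<le> smoothed_density J s N Z y" for N :: "'z measure" and Z y
      unfolding smoothed_density_def by (rule Bochner_Integration.integral_nonneg) (rule gauss_kernel_nonneg)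
    have conv: "(\<lambda>n. ?d n y) \<longlonglongrightarrow> ?d' y" for y
    proof -
      have "(\<lambda>n. complex_of_real (?d n y)) \<longlonglongrightarrow> complex_of_real (?d' y)"
        unfolding smoothed_density_char[OF J s M(1) X(1)] smoothed_density_char[OF J s M(2) X(2)]
      proof (intro tendsto_mult tendsto_const integral_dominated_convergence[where w = "\<lambda>_. 1"])
        have m: "(\<lambda>\<zeta>. iexp (\<Sum>t\<in>J. y t / s * \<zeta> t) * (\<integral>\<omega>. iexp (\<Sum>t\<in>J. (- \<zeta> t / s) * Z \<omega> t) \<partial>N)) \<in> borel_measurable ?S"
          if N: "prob_space N" and Z: "Z \<in> N \<rightarrow>\<^sub>M (\<Pi>\<^sub>M t\<in>J. borel)" for N :: "'z measure" and Z
        proof -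
          interpret N: prob_space N by fact
          have Zt: "(\<lambda>\<omega>. Z \<omega> t) \<in> borel_measurable N" if "t \<in> J" for t
            by (rule measurable_compose[OF Z measurable_component_singleton[OF that]])
          have zt: "(\<lambda>\<zeta>. \<zeta> t) \<in> borel_measurable ?S" if "t \<in> J" for t
          proof -
            have "(\<lambda>\<zeta>. \<zeta> t) \<in> ?S \<rightarrow>\<^sub>M std_normal_distribution" by (rule measurable_component_singleton[OF that])
            then show ?thesis by simp
          qed
          have [measurable]: "(\<lambda>z. \<Sum>t\<in>J. (- fst z t / s) * Z (snd z) t) \<in> borel_measurable (?S \<Otimes>\<^sub>M N)"
          proof (rule borel_measurable_sum)
            fix t assume t: "t \<in> J"
            note [measurable] = Zt[OF t] zt[OF t]
            show "(\<lambda>z. (- fst z t / s) * Z (snd z) t) \<in> borel_measurable (?S \<Otimes>\<^sub>M N)" by measurable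
          qed
          have [measurable]: "(\<lambda>\<zeta>. \<Sum>t\<in>J. y t / s * \<zeta> t) \<in> borel_measurable ?S"
            by (intro borel_measurable_sum borel_measurable_times borel_measurable_const zt)
          have [measurable]: "(\<lambda>\<zeta>. \<integral>\<omega>. iexp (\<Sum>t\<in>J. (- \<zeta> t / s) * Z \<omega> t) \<partial>N) \<in> borel_measurable ?S"
            by (rule N.borel_measurable_lebesgue_integral) (unfold case_prod_beta', measurable)
          show ?thesis by measurable
        qed
        show "(\<lambda>\<zeta>. iexp (\<Sum>t\<in>J. y t / s * \<zeta> t) * (\<integral>\<omega>. iexp (\<Sum>t\<in>J. (- \<zeta> t / s) * X' \<omega> t) \<partial>M')) \<in> borel_measurable ?S"
          by (rule m[OF M(2) X(2)])
        show "(\<lambda>\<zeta>. iexp (\<Sum>t\<in>J. y t / s * \<zeta> t) * (\<integral>\<omega>. iexp (\<Sum>t\<in>J. (- \<zeta> t / s) * X n \<omega> t) \<partial>M n)) \<in> borel_measurable ?S" for n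
          by (rule m[OF M(1) X(1)])
        show "AE \<zeta> in ?S. (\<lambda>n. iexp (\<Sum>t\<in>J. y t / s * \<zeta> t) * (\<integral>\<omega>. iexp (\<Sum>t\<in>J. (- \<zeta> t / s) * X n \<omega> t) \<partial>M n))
            \<longlonglongrightarrow> iexp (\<Sum>t\<in>J. y t / s * \<zeta> t) * (\<integral>\<omega>. iexp (\<Sum>t\<in>J. (- \<zeta> t / s) * X' \<omega> t) \<partial>M')"
          by (intro AE_I2 tendsto_mult tendsto_const char)
        show "AE \<zeta> in ?S. norm (iexp (\<Sum>t\<in>J. y t / s * \<zeta> t) * (\<integral>\<omega>. iexp (\<Sum>t\<in>J. (- \<zeta> t / s) * X n \<omega> t) \<partial>M n)) \<le> 1" for n
        proof (rule AE_I2)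
          fix \<zeta>
          have "norm (\<integral>\<omega>. iexp (\<Sum>t\<in>J. (- \<zeta> t / s) * X n \<omega> t) \<partial>M n) \<le> (\<integral>\<omega>. norm (iexp (\<Sum>t\<in>J. (- \<zeta> t / s) * X n \<omega> t)) \<partial>M n)"
            by (rule integral_norm_bound)
          also have "\<dots> = 1" using prob_space.prob_space[OF M(1)[of n]] by simp
          finally show "norm (iexp (\<Sum>t\<in>J. y t / s * \<zeta> t) * (\<integral>\<omega>. iexp (\<Sum>t\<in>J. (- \<zeta> t / s) * X n \<omega> t) \<partial>M n)) \<le> 1"
            by (simp add: norm_mult)
        qed
      qed simp
      then show ?thesis by (simp only: tendsto_of_real_iff)
    qed
    \<comment> \<open>Scheffe: all these densities have integral 1, so pointwise convergence
      improves to convergence in mean, which is strong enough for every bounded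
      \<open>f\<close>.\<close>
    have sch: "(\<lambda>n. \<integral>\<^sup>+y. norm (?d n y - ?d' y) \<partial>?P) \<longlonglongrightarrow> 0"
    proof (rule Scheffe_lemma2)
      show "?d n \<in> borel_measurable ?P" for n using d(1) by (rule borel_measurable_integrable)
      show "integrable ?P ?d'" by (rule d'(1))
      show "AE y in ?P. (\<lambda>n. ?d n y) \<longlonglongrightarrow> ?d' y" by (intro AE_I2 conv)
      show "(\<integral>\<^sup>+y. norm (?d n y) \<partial>?P) \<le> (\<integral>\<^sup>+y. norm (?d' y) \<partial>?P)" for n
        using d[of n] d' by (simp add: nn_integral_eq_integral abs_of_nonneg dnn)
    qed
    have "(\<lambda>n. \<integral>y. \<bar>?d n y - ?d' y\<bar> \<partial>?P) \<longlonglongrightarrow> 0"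
    proof -
      have "(\<integral>\<^sup>+y. norm (?d n y - ?d' y) \<partial>?P) = ennreal (\<integral>y. \<bar>?d n y - ?d' y\<bar> \<partial>?P)" for n
        using d(1)[of n] d'(1) by (subst nn_integral_eq_integral) simp_all
      then have "(\<lambda>n. ennreal (\<integral>y. \<bar>?d n y - ?d' y\<bar> \<partial>?P)) \<longlonglongrightarrow> ennreal 0" using sch by simp
      then show ?thesis by (subst (asm) tendsto_ennreal_iff) simp_all
    qed
    then have K0: "(\<lambda>n. \<bar>K\<bar> * (\<integral>y. \<bar>?d n y - ?d' y\<bar> \<partial>?P)) \<longlonglongrightarrow> 0"
      using tendsto_mult_right_zero by blast
    note I = smoothed_density_integral[OF J s M(1) X(1) fP f(2)] and I' = smoothed_density_integral[OF J s M(2) X(2) fP f(2)]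
    have "(\<lambda>n. (\<integral>y. f y * ?d n y \<partial>?P) - (\<integral>y. f y * ?d' y \<partial>?P)) \<longlonglongrightarrow> 0"
    proof (rule Lim_null_comparison[OF _ K0], intro always_eventually allI)
      fix n
      have "(\<integral>y. f y * ?d n y \<partial>?P) - (\<integral>y. f y * ?d' y \<partial>?P) = (\<integral>y. f y * (?d n y - ?d' y) \<partial>?P)"
        using I(1)[of n] I'(1) by (simp add: right_diff_distrib)
      also have "norm \<dots> \<le> (\<integral>y. \<bar>K\<bar> * \<bar>?d n y - ?d' y\<bar> \<partial>?P)"
        unfolding real_norm_def
      proof (rule abs_integral_le)
        show "integrable ?P (\<lambda>y. f y * (?d n y - ?d' y))" using I(1)[of n] I'(1) by (simp add: right_diff_distrib)
        show "integrable ?P (\<lambda>y. \<bar>K\<bar> * \<bar>?d n y - ?d' y\<bar>)" using d(1)[of n] d'(1) by simp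
        fix y assume "y \<in> space ?P"
        then have "\<bar>f y\<bar> \<le> K" by (intro f(2)) (simp add: space_PiM PiE_iff)
        then have "\<bar>f y\<bar> \<le> \<bar>K\<bar>" by linarith
        then show "\<bar>f y * (?d n y - ?d' y)\<bar> \<le> \<bar>K\<bar> * \<bar>?d n y - ?d' y\<bar>"
          unfolding abs_mult by (rule mult_right_mono) simp
      qed
      finally show "norm ((\<integral>y. f y * ?d n y \<partial>?P) - (\<integral>y. f y * ?d' y \<partial>?P)) \<le> \<bar>K\<bar> * (\<integral>y. \<bar>?d n y - ?d' y\<bar> \<partial>?P)"
        by simp
    qed
    moreover have "(\<integral>y. f y * ?d n y \<partial>?P) = (\<integral>\<omega>. (\<integral>y. f y * gauss_kernel J s (X n \<omega>) y \<partial>?P) \<partial>M n)" for n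
      by (rule smoothed_density_integral(3)[OF J s M(1) X(1) fP]) (rule f(2))
    moreover have "(\<integral>y. f y * ?d' y \<partial>?P) = (\<integral>\<omega>. (\<integral>y. f y * gauss_kernel J s (X' \<omega>) y \<partial>?P) \<partial>M')"
      by (rule smoothed_density_integral(3)[OF J s M(2) X(2) fP]) (rule f(2))
    ultimately show ?thesis by (simp only: LIM_zero_iff)
  qed
  define C where "C = L * real (card J) * sqrt (2 / pi)"
  have err: "\<bar>(\<integral>\<omega>. f (Z \<omega>) \<partial>N) - (\<integral>\<omega>. (\<integral>y. f y * gauss_kernel J s (Z \<omega>) y \<partial>?P) \<partial>N)\<bar> \<le> s * C"
    if s: "0 < s" and N: "prob_space N" and Z: "Z \<in> N \<rightarrow>\<^sub>M (\<Pi>\<^sub>M t\<in>J. borel)" for s and N :: "'z measure" and Z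
  proof -
    interpret N: prob_space N by fact
    have e: "Z \<omega> \<in> extensional J" if "\<omega> \<in> space N" for \<omega>
      using measurable_space[OF Z that] by (simp add: space_PiM PiE_iff)
    have i1: "integrable N (\<lambda>\<omega>. f (Z \<omega>))"
      using e f(2) by (intro N.integrable_const_bound[where B = K] AE_I2 measurable_compose[OF Z f(1)]) simp
    note i2 = smoothed_density_integral(2)[OF J s N Z fP f(2)]
    have "\<bar>\<integral>\<omega>. f (Z \<omega>) - (\<integral>y. f y * gauss_kernel J s (Z \<omega>) y \<partial>?P) \<partial>N\<bar> \<le> (\<integral>\<omega>. s * C \<partial>N)"
    proof (rule abs_integral_le)
      show "integrable N (\<lambda>\<omega>. f (Z \<omega>) - (\<integral>y. f y * gauss_kernel J s (Z \<omega>) y \<partial>?P))"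
        by (rule Bochner_Integration.integrable_diff[OF i1 i2])
      show "\<bar>f (Z \<omega>) - (\<integral>y. f y * gauss_kernel J s (Z \<omega>) y \<partial>?P)\<bar> \<le> s * C" if "\<omega> \<in> space N" for \<omega>
        unfolding C_def by (rule smoothing_error[OF J s fP f(2) lip e[OF that]])
    qed simp
    then show ?thesis using i1 i2 N.prob_space by simp
  qed
  show ?thesis
  proof (rule LIMSEQ_I)
    fix e :: real assume e: "0 < e"
    \<comment> \<open>The denominator has \<open>\<bar>C\<bar> + 1\<close> because \<open>C\<close>
      may vanish and the sign of \<open>L\<close> is not fixed; each of the three errors is then at
      most a third of \<open>e\<close>.\<close>
    define s where "s = e / (3 * (\<bar>C\<bar> + 1))"
    have s: "0 < s" using e by (simp add: s_def)
    have "s * C \<le> s * (\<bar>C\<bar> + 1)" using s by (intro mult_left_mono) auto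
    also have "\<dots> = e / 3"
    proof -
      have "x / (3 * c) * c = x / 3" if "c \<noteq> 0" for x c :: real using that by simp
      moreover have "\<bar>C\<bar> + 1 \<noteq> 0" by linarith
      ultimately show ?thesis unfolding s_def by blast
    qed
    finally have sC: "s * C \<le> e / 3" .
    let ?a = "\<lambda>n. \<integral>\<omega>. (\<integral>y. f y * gauss_kernel J s (X n \<omega>) y \<partial>?P) \<partial>M n"
    let ?b = "\<integral>\<omega>. (\<integral>y. f y * gauss_kernel J s (X' \<omega>) y \<partial>?P) \<partial>M'"
    obtain n0 where n0: "\<And>n. n \<ge> n0 \<Longrightarrow> norm (?a n - ?b) < e / 3"
      using LIMSEQ_D[OF smooth[OF s], of "e / 3"] e by auto
    have "norm ((\<integral>\<omega>. f (X n \<omega>) \<partial>M n) - (\<integral>\<omega>. f (X' \<omega>) \<partial>M')) < e" if "n \<ge> n0" for n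
      using n0[OF that] err[OF s M(1)[of n] X(1)[of n]] err[OF s M(2) X(2)] sC unfolding real_norm_def by linarith
    then show "\<exists>no. \<forall>n\<ge>no. norm ((\<integral>\<omega>. f (X n \<omega>) \<partial>M n) - (\<integral>\<omega>. f (X' \<omega>) \<partial>M')) < e" by blast
  qed
qed

section \<open>Convergence in law on finite-dimensional spaces\<close>

lemma borel_sets_of_space: "space (borel_sets_of S) = topspace S"
  unfolding borel_sets_of_def by (rule space_measure_of) (auto dest: openin_subset)

lemma borel_sets_of_open: "openin S U \<Longrightarrow> U \<in> sets (borel_sets_of S)"
proof -
  have "sets (borel_sets_of S) = sigma_sets (topspace S) {U. openin S U}"
    unfolding borel_sets_of_def by (rule sets_measure_of) (auto dest: openin_subset)
  then show "openin S U \<Longrightarrow> U \<in> sets (borel_sets_of S)" by auto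
qed

lemma measurable_borel_sets_ofI:
  assumes "\<And>\<omega>. \<omega> \<in> space M \<Longrightarrow> X \<omega> \<in> topspace S"
    and "\<And>U. openin S U \<Longrightarrow> X -` U \<inter> space M \<in> sets M"
  shows "X \<in> M \<rightarrow>\<^sub>M borel_sets_of S"
  unfolding borel_sets_of_def using assms by (intro measurable_measure_of) (auto dest: openin_subset)

lemma continuous_map_borel_measurable:
  assumes "continuous_map S euclideanreal f"
  shows "f \<in> borel_measurable (borel_sets_of S)"
proof (rule borel_measurableI)
  fix V :: "real set" assume "open V"
  then have "openin S {x \<in> topspace S. f x \<in> V}"
    using assms by (simp add: continuous_map_def)
  moreover have "f -` V \<inter> space (borel_sets_of S) = {x \<in> topspace S. f x \<in> V}"
    by (auto simp: borel_sets_of_space)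
  ultimately show "f -` V \<inter> space (borel_sets_of S) \<in> sets (borel_sets_of S)"
    by (simp only: borel_sets_of_open)
qed

text \<open>Openness phrased in coordinates. It covers the open sets of the product topology as well
  as preimages under Lipschitz functions, so that a single argument makes both measurable for the
  product sigma-algebra.\<close>

definition box_open :: "'i set \<Rightarrow> ('i \<Rightarrow> real) set \<Rightarrow> bool" where
  "box_open J U \<longleftrightarrow> U \<subseteq> extensional J \<and>
     (\<forall>x\<in>U. \<exists>e>0. \<forall>y\<in>extensional J. (\<forall>t\<in>J. \<bar>y t - x t\<bar> < e) \<longrightarrow> y \<in> U)"

lemma box_open_measurable:
  assumes J: "finite J" and U: "box_open J U"
  shows "U \<in> sets (\<Pi>\<^sub>M t\<in>J. borel :: real measure)"
proof -
  define I where "I = {(q, n). q \<in> (\<Pi>\<^sub>E t\<in>J. \<rat>) \<and> (\<Pi>\<^sub>E t\<in>J. {q t - 1 / real (Suc n)<..<q t + 1 / real (Suc n)}) \<subseteq> U}"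
  have "countable ((\<Pi>\<^sub>E t\<in>J. \<rat> :: real set) \<times> (UNIV :: nat set))"
    by (intro countable_SIGMA countable_PiE J countable_rat) simp
  then have cI: "countable I" by (rule countable_subset[rotated]) (auto simp: I_def)
  have "U = (\<Union>(q, n)\<in>I. \<Pi>\<^sub>E t\<in>J. {q t - 1 / real (Suc n)<..<q t + 1 / real (Suc n)})"
  proof (intro equalityI subsetI)
    fix x assume x: "x \<in> U"
    then obtain e where e: "e > 0" "\<And>y. y \<in> extensional J \<Longrightarrow> (\<And>t. t \<in> J \<Longrightarrow> \<bar>y t - x t\<bar> < e) \<Longrightarrow> y \<in> U"
      using U unfolding box_open_def by blast
    have xe: "x \<in> extensional J" using U x unfolding box_open_def by blast
    \<comment> \<open>The rational centre is within \<open>1 / real (Suc n)\<close> of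
      \<open>x\<close>, and the points of the box are within the same distance of the centre;
      together they stay below \<open>e\<close>.\<close>
    obtain n where n: "1 / real (Suc n) < e / 2" using nat_approx_posE[of "e / 2"] e(1) by auto
    have "\<exists>r\<in>\<rat>. x t - 1 / real (Suc n) < r \<and> r < x t + 1 / real (Suc n)" for t
      by (rule Rats_dense_in_real) (use n in simp)
    then obtain q where q: "\<And>t. q t \<in> \<rat>" "\<And>t. x t - 1 / real (Suc n) < q t" "\<And>t. q t < x t + 1 / real (Suc n)"
      by metis
    let ?q = "restrict q J"
    have xq: "x \<in> (\<Pi>\<^sub>E t\<in>J. {?q t - 1 / real (Suc n)<..<?q t + 1 / real (Suc n)})"
    proof (rule PiE_I)
      fix t assume "t \<in> J"
      then show "x t \<in> {?q t - 1 / real (Suc n)<..<?q t + 1 / real (Suc n)}" using q(2,3)[of t] by simp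
    next
      fix t assume "t \<notin> J" then show "x t = undefined" using xe by (simp add: extensional_def)
    qed
    have "(\<Pi>\<^sub>E t\<in>J. {?q t - 1 / real (Suc n)<..<?q t + 1 / real (Suc n)}) \<subseteq> U"
    proof
      fix y assume y: "y \<in> (\<Pi>\<^sub>E t\<in>J. {?q t - 1 / real (Suc n)<..<?q t + 1 / real (Suc n)})"
      show "y \<in> U"
      proof (rule e(2))
        show "y \<in> extensional J" using y by (simp add: PiE_iff)
        fix t assume t: "t \<in> J"
        then have "y t \<in> {q t - 1 / real (Suc n)<..<q t + 1 / real (Suc n)}" using PiE_mem[OF y t] by simp
        then have "q t - 1 / real (Suc n) < y t" "y t < q t + 1 / real (Suc n)" by simp_all
        then show "\<bar>y t - x t\<bar> < e" using q(2,3)[of t] n by linarith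
      qed
    qed
    then have "(?q, n) \<in> I" using q(1) by (simp add: I_def)
    then show "x \<in> (\<Union>(q, n)\<in>I. \<Pi>\<^sub>E t\<in>J. {q t - 1 / real (Suc n)<..<q t + 1 / real (Suc n)})"
      using xq by blast
  qed (auto simp: I_def)
  also have "\<dots> \<in> sets (\<Pi>\<^sub>M t\<in>J. borel)"
  proof (rule sets.countable_UN''[OF cI])
    show "(case i of (q, n) \<Rightarrow> \<Pi>\<^sub>E t\<in>J. {q t - 1 / real (Suc n)<..<q t + 1 / real (Suc n)}) \<in> sets (\<Pi>\<^sub>M t\<in>J. borel)" for i
      by (cases i) (simp add: sets_PiM_I_finite[OF J])
  qed
  finally show ?thesis .
qed

lemma box_open_product_topology:
  assumes J: "finite J" and U: "openin (product_topology (\<lambda>_. euclideanreal) J) U"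
  shows "box_open J U"
  unfolding box_open_def
proof (intro conjI ballI)
  show "U \<subseteq> extensional J" using openin_subset[OF U] by (auto simp: PiE_iff)
  fix x assume x: "x \<in> U"
  from bspec[OF U[unfolded openin_product_topology_alt] x]
  obtain V where V0: "\<forall>t\<in>J. openin euclideanreal (V t)" and VU: "x \<in> Pi\<^sub>E J V" "Pi\<^sub>E J V \<subseteq> U" by (elim exE conjE)
  have V: "\<And>t. t \<in> J \<Longrightarrow> open (V t)" "x \<in> Pi\<^sub>E J V" "Pi\<^sub>E J V \<subseteq> U"
    using V0 VU unfolding open_openin[symmetric] by blast+
  have "\<exists>e>0. \<forall>z. \<bar>z - x t\<bar> < e \<longrightarrow> z \<in> V t" if t: "t \<in> J" for t
    using bspec[OF V(1)[OF t, unfolded open_dist] PiE_mem[OF V(2) t]] unfolding dist_real_def .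
  then obtain e where e: "\<And>t. t \<in> J \<Longrightarrow> e t > 0" "\<And>t z. t \<in> J \<Longrightarrow> \<bar>z - x t\<bar> < e t \<Longrightarrow> z \<in> V t" by metis
  \<comment> \<open>Inserting 1 keeps the set nonempty when \<open>J\<close> is empty.\<close>
  define r where "r = Min (insert 1 (e ` J))"
  have r0: "r > 0" unfolding r_def using J e(1) by simp
  have re: "r \<le> e t" if "t \<in> J" for t unfolding r_def using J that by simp
  show "\<exists>e>0. \<forall>y\<in>extensional J. (\<forall>t\<in>J. \<bar>y t - x t\<bar> < e) \<longrightarrow> y \<in> U"
  proof (intro exI conjI ballI impI)
    show "r > 0" by (rule r0)
    fix y assume y: "y \<in> extensional J" "\<forall>t\<in>J. \<bar>y t - x t\<bar> < r"
    have "y \<in> Pi\<^sub>E J V"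
    proof (rule PiE_I)
      fix t assume t: "t \<in> J"
      have "\<bar>y t - x t\<bar> < r" using y(2) t by (rule bspec)
      then have "\<bar>y t - x t\<bar> < e t" using re[OF t] by linarith
      then show "y t \<in> V t" by (rule e(2)[OF t])
    qed (use y(1) in \<open>simp add: extensional_def\<close>)
    then show "y \<in> U" using V(3) by blast
  qed
qed

lemma measurable_product_topology:
  assumes J: "finite J" and X: "\<And>t. t \<in> J \<Longrightarrow> X t \<in> borel_measurable M"
  shows "(\<lambda>\<omega>. \<lambda>t\<in>J. X t \<omega>) \<in> M \<rightarrow>\<^sub>M borel_sets_of (product_topology (\<lambda>_. euclideanreal) J)"
    "(\<lambda>\<omega>. \<lambda>t\<in>J. X t \<omega>) \<in> M \<rightarrow>\<^sub>M (\<Pi>\<^sub>M t\<in>J. borel)"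
proof -
  show P: "(\<lambda>\<omega>. \<lambda>t\<in>J. X t \<omega>) \<in> M \<rightarrow>\<^sub>M (\<Pi>\<^sub>M t\<in>J. borel)" by (rule measurable_restrict) (rule X)
  show "(\<lambda>\<omega>. \<lambda>t\<in>J. X t \<omega>) \<in> M \<rightarrow>\<^sub>M borel_sets_of (product_topology (\<lambda>_. euclideanreal) J)"
  proof (rule measurable_borel_sets_ofI)
    fix U assume "openin (product_topology (\<lambda>_. euclideanreal) J) U"
    then have "U \<in> sets (\<Pi>\<^sub>M t\<in>J. borel)" by (intro box_open_measurable[OF J] box_open_product_topology[OF J])
    then show "(\<lambda>\<omega>. \<lambda>t\<in>J. X t \<omega>) -` U \<inter> space M \<in> sets M" by (rule measurable_sets[OF P])
  qed simp
qed

interpretation l1: pseudo_dist "extensional J" "l1_dist J" for J :: "'i set"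
proof
  show "l1_dist J x z \<le> l1_dist J x y + l1_dist J y z" for x y z :: "'i \<Rightarrow> real"
    unfolding l1_dist_def sum.distrib[symmetric] by (intro sum_mono) linarith
qed (auto simp: l1_dist_def sum_nonneg abs_minus_commute)

lemma l1_lipschitz_measurable:
  assumes J: "finite J" and lip: "\<And>x y. x \<in> extensional J \<Longrightarrow> y \<in> extensional J \<Longrightarrow> \<bar>f x - f y\<bar> \<le> L * l1_dist J x y"
    and L: "L \<ge> 0"
  shows "f \<in> borel_measurable (\<Pi>\<^sub>M t\<in>J. borel)"
proof (rule borel_measurableI)
  fix V :: "real set" assume V: "open V"
  have "box_open J {x \<in> extensional J. f x \<in> V}"
    unfolding box_open_def
  proof (intro conjI ballI)
    fix x assume "x \<in> {x \<in> extensional J. f x \<in> V}"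
    then have x: "x \<in> extensional J" "f x \<in> V" by simp_all
    obtain r where r: "r > 0" "\<And>z. \<bar>z - f x\<bar> < r \<Longrightarrow> z \<in> V"
      using bspec[OF V[unfolded open_dist] x(2)] unfolding dist_real_def by blast
    \<comment> \<open>Each coordinate moves by less than \<open>e\<close>, so the sum is at most
      \<open>card J * e\<close>. The added ones keep the denominator positive when
      \<open>L = 0\<close> or \<open>J = {}\<close>.\<close>
    define e where "e = r / ((L + 1) * (real (card J) + 1))"
    have e: "e > 0" unfolding e_def using r(1) L by (intro divide_pos_pos mult_pos_pos) linarith+
    show "\<exists>e>0. \<forall>y\<in>extensional J. (\<forall>t\<in>J. \<bar>y t - x t\<bar> < e) \<longrightarrow> y \<in> {x \<in> extensional J. f x \<in> V}"
    proof (intro exI conjI ballI impI)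
      show "e > 0" by (rule e)
      fix y assume y: "y \<in> extensional J" "\<forall>t\<in>J. \<bar>y t - x t\<bar> < e"
      have "l1_dist J y x \<le> (\<Sum>t\<in>J. e)" unfolding l1_dist_def using y(2) by (intro sum_mono) force
      then have "l1_dist J y x \<le> real (card J) * e" by simp
      then have "L * l1_dist J y x \<le> L * (real (card J) * e)" using L by (rule mult_left_mono)
      also have "\<dots> < (L + 1) * ((real (card J) + 1) * e)"
      proof -
        have "L * (real (card J) * e) \<le> L * ((real (card J) + 1) * e)"
          using L e by (intro mult_left_mono mult_right_mono) simp_all
        moreover have "0 < (real (card J) + 1) * e" using e by (intro mult_pos_pos) simp_all
        ultimately show ?thesis by (simp only: distrib_right[of L 1] mult_1)
      qed
      also have "\<dots> = r"
      proof -
        have "L + 1 \<noteq> 0" "real (card J) + 1 \<noteq> 0" using L by linarith+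
        then show ?thesis unfolding e_def by simp
      qed
      finally have "\<bar>f y - f x\<bar> < r" using lip[OF y(1) x(1)] by linarith
      then show "y \<in> {x \<in> extensional J. f x \<in> V}" using r(2) y(1) by simp
    qed
  qed auto
  then have "{x \<in> extensional J. f x \<in> V} \<in> sets (\<Pi>\<^sub>M t\<in>J. borel)" by (rule box_open_measurable[OF J])
  moreover have "f -` V \<inter> space (\<Pi>\<^sub>M t\<in>J. borel :: real measure) = {x \<in> extensional J. f x \<in> V}"
    by (auto simp: space_PiM PiE_iff extensional_def)
  ultimately show "f -` V \<inter> space (\<Pi>\<^sub>M t\<in>J. borel) \<in> sets (\<Pi>\<^sub>M t\<in>J. borel)" by (simp only:)
qed

lemma box_open_l1_continuous:
  assumes J: "finite J" and f: "continuous_map (product_topology (\<lambda>_. euclideanreal) J) euclideanreal f"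
    and x: "x \<in> extensional J" and e: "e > 0"
  shows "\<exists>r>0. \<forall>y\<in>extensional J. l1_dist J x y < r \<longrightarrow> \<bar>f y - f x\<bar> < e"
proof -
  have tp: "topspace (product_topology (\<lambda>_. euclideanreal) J) = extensional J" by (auto simp: PiE_iff extensional_def)
  let ?U = "{y \<in> topspace (product_topology (\<lambda>_. euclideanreal) J). f y \<in> ball (f x) e}"
  have "openin (product_topology (\<lambda>_. euclideanreal) J) ?U"
    by (rule openin_continuous_map_preimage[OF f]) simp
  then have "box_open J ?U" by (rule box_open_product_topology[OF J])
  moreover have "x \<in> ?U" unfolding tp using x e by simp
  ultimately obtain r where r: "r > 0" "\<And>y. y \<in> extensional J \<Longrightarrow> (\<forall>t\<in>J. \<bar>y t - x t\<bar> < r) \<Longrightarrow> y \<in> ?U"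
    unfolding box_open_def by blast
  have "\<bar>f y - f x\<bar> < e" if y: "y \<in> extensional J" "l1_dist J x y < r" for y
  proof -
    have "\<bar>y t - x t\<bar> < r" if "t \<in> J" for t
    proof -
      have "\<bar>x t - y t\<bar> \<le> l1_dist J x y" unfolding l1_dist_def using J that by (intro member_le_sum) auto
      then show ?thesis using y(2) by linarith
    qed
    then have "y \<in> ?U" using r(2)[OF y(1)] by blast
    then show ?thesis by (simp add: dist_real_def abs_minus_commute)
  qed
  then show ?thesis using r(1) by blast
qed

text \<open>Bounded continuous test functions are continuous for the \<open>l1\<close> distance and
  so reduce to Lipschitz ones, for which convergence of the characteristic functions
  suffices.\<close>

theorem converges_in_law_of_char:
  fixes X :: "nat \<Rightarrow> 'i \<Rightarrow> 'b \<Rightarrow> real" and X' :: "'i \<Rightarrow> 'c \<Rightarrow> real"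
  assumes J: "finite J"
    and M: "\<And>n. prob_space (M n)" "prob_space M'"
    and X: "\<And>n t. t \<in> J \<Longrightarrow> X n t \<in> borel_measurable (M n)" "\<And>t. t \<in> J \<Longrightarrow> X' t \<in> borel_measurable M'"
    and char: "\<And>a. (\<lambda>n. \<integral>\<omega>. iexp (\<Sum>t\<in>J. a t * X n t \<omega>) \<partial>M n) \<longlonglongrightarrow> (\<integral>\<omega>. iexp (\<Sum>t\<in>J. a t * X' t \<omega>) \<partial>M')"
  shows "converges_in_law (product_topology (\<lambda>_. euclideanreal) J) M (\<lambda>n \<omega>. \<lambda>t\<in>J. X n t \<omega>) M' (\<lambda>\<omega>. \<lambda>t\<in>J. X' t \<omega>)"
  unfolding converges_in_law_def
proof (intro conjI allI impI M)
  show b: "(\<lambda>\<omega>. \<lambda>t\<in>J. X n t \<omega>) \<in> M n \<rightarrow>\<^sub>M borel_sets_of (product_topology (\<lambda>_. euclideanreal) J)" for n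
    by (rule measurable_product_topology(1)[OF J X(1)])
  show b': "(\<lambda>\<omega>. \<lambda>t\<in>J. X' t \<omega>) \<in> M' \<rightarrow>\<^sub>M borel_sets_of (product_topology (\<lambda>_. euclideanreal) J)"
    by (rule measurable_product_topology(1)[OF J X(2)])
  have p: "(\<lambda>\<omega>. \<lambda>t\<in>J. X n t \<omega>) \<in> M n \<rightarrow>\<^sub>M (\<Pi>\<^sub>M t\<in>J. borel)" for n
    by (rule measurable_product_topology(2)[OF J X(1)])
  have p': "(\<lambda>\<omega>. \<lambda>t\<in>J. X' t \<omega>) \<in> M' \<rightarrow>\<^sub>M (\<Pi>\<^sub>M t\<in>J. borel)"
    by (rule measurable_product_topology(2)[OF J X(2)])
  fix f assume f: "continuous_map (product_topology (\<lambda>_. euclideanreal) J) euclideanreal f \<and>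
    bounded (f ` topspace (product_topology (\<lambda>_. euclideanreal) J))"
  have tp: "topspace (product_topology (\<lambda>_. euclideanreal) J) = extensional J" by (auto simp: PiE_iff extensional_def)
  obtain K where K: "\<And>y. y \<in> extensional J \<Longrightarrow> \<bar>f y\<bar> \<le> K"
    using f unfolding tp bounded_iff by auto
  note fm = continuous_map_borel_measurable[OF conjunct1[OF f]]
  have hm: "h \<in> borel_measurable (\<Pi>\<^sub>M t\<in>J. borel)" if h: "l1.bounded_lipschitz J h" for h
    using h unfolding l1.bounded_lipschitz_def by (elim conjE exE) (rule l1_lipschitz_measurable[OF J], blast, simp)
  show "(\<lambda>n. \<integral>\<omega>. f (\<lambda>t\<in>J. X n t \<omega>) \<partial>M n) \<longlonglongrightarrow> (\<integral>\<omega>. f (\<lambda>t\<in>J. X' t \<omega>) \<partial>M')"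
  proof (rule l1.convergence_of_lipschitz[where J = J and K = K and M = M and M' = M' and f = f
        and X = "\<lambda>n \<omega>. \<lambda>t\<in>J. X n t \<omega>" and X' = "\<lambda>\<omega>. \<lambda>t\<in>J. X' t \<omega>"])
    show "(\<lambda>t\<in>J. X n t \<omega>) \<in> extensional J" "(\<lambda>t\<in>J. X' t \<omega>') \<in> extensional J" for n \<omega> \<omega>' by simp_all
    fix h assume h: "l1.bounded_lipschitz J h"
    show "(\<lambda>\<omega>. h (\<lambda>t\<in>J. X n t \<omega>)) \<in> borel_measurable (M n)" for n
      by (rule measurable_compose[OF p hm[OF h]])
    show "(\<lambda>\<omega>. h (\<lambda>t\<in>J. X' t \<omega>)) \<in> borel_measurable M'"
      by (rule measurable_compose[OF p' hm[OF h]])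
    obtain K' L where KL: "\<And>y. y \<in> extensional J \<Longrightarrow> \<bar>h y\<bar> \<le> K'"
      "\<And>x y. x \<in> extensional J \<Longrightarrow> y \<in> extensional J \<Longrightarrow> \<bar>h x - h y\<bar> \<le> L * l1_dist J x y"
      using h unfolding l1.bounded_lipschitz_def by blast
    show "(\<lambda>n. \<integral>\<omega>. h (\<lambda>t\<in>J. X n t \<omega>) \<partial>M n) \<longlonglongrightarrow> (\<integral>\<omega>. h (\<lambda>t\<in>J. X' t \<omega>) \<partial>M')"
    proof (rule levy_continuity_lipschitz[OF J M p p' _ hm[OF h] KL])
      have "(\<Sum>t\<in>J. a t * (\<lambda>t\<in>J. z t) t) = (\<Sum>t\<in>J. a t * z t)" for a z :: "'i \<Rightarrow> real" by (rule sum.cong) simp_all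
      then show "(\<lambda>n. \<integral>\<omega>. iexp (\<Sum>t\<in>J. a t * (\<lambda>t\<in>J. X n t \<omega>) t) \<partial>M n) \<longlonglongrightarrow> (\<integral>\<omega>. iexp (\<Sum>t\<in>J. a t * (\<lambda>t\<in>J. X' t \<omega>) t) \<partial>M')" for a
        using char[of a] by (simp only:)
    qed
  next
    show "(\<lambda>\<omega>. f (\<lambda>t\<in>J. X n t \<omega>)) \<in> borel_measurable (M n)" for n by (rule measurable_compose[OF b fm])
    show "(\<lambda>\<omega>. f (\<lambda>t\<in>J. X' t \<omega>)) \<in> borel_measurable M'" by (rule measurable_compose[OF b' fm])
    show "\<bar>f y\<bar> \<le> K" if "y \<in> extensional J" for y by (rule K[OF that])
    show "\<exists>r>0. \<forall>y\<in>extensional J. l1_dist J x y < r \<longrightarrow> \<bar>f y - f x\<bar> < e" if "x \<in> extensional J" "e > 0" for x e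
      by (rule box_open_l1_continuous[OF J conjunct1[OF f] that])
  qed (use M in auto)
qed

section \<open>Skorohod space and step paths\<close>

context Metric_space
begin

lemma openin_mtopology_ball:
  "openin mtopology U \<longleftrightarrow> U \<subseteq> M \<and> (\<forall>x\<in>U. \<exists>r>0. \<forall>y\<in>M. d x y < r \<longrightarrow> y \<in> U)"
proof
  assume U: "openin mtopology U"
  show "U \<subseteq> M \<and> (\<forall>x\<in>U. \<exists>r>0. \<forall>y\<in>M. d x y < r \<longrightarrow> y \<in> U)"
  proof (intro conjI ballI)
    show UM: "U \<subseteq> M" using U by (simp add: openin_mtopology)
    fix x assume x: "x \<in> U"
    then obtain r where r: "r > 0" "mball x r \<subseteq> U" using U unfolding openin_mtopology by blast
    have "y \<in> U" if "y \<in> M" "d x y < r" for y using r(2) that x UM by (auto simp: mball_def)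
    then show "\<exists>r>0. \<forall>y\<in>M. d x y < r \<longrightarrow> y \<in> U" using r(1) by blast
  qed
next
  assume R: "U \<subseteq> M \<and> (\<forall>x\<in>U. \<exists>r>0. \<forall>y\<in>M. d x y < r \<longrightarrow> y \<in> U)"
  show "openin mtopology U"
    unfolding openin_mtopology
  proof (intro conjI allI impI)
    show "U \<subseteq> M" using R by blast
    fix x assume "x \<in> U"
    then obtain r where "r > 0" "\<forall>y\<in>M. d x y < r \<longrightarrow> y \<in> U" using R by blast
    then show "\<exists>r>0. mball x r \<subseteq> U" by (intro exI[of _ r]) (auto simp: mball_def)
  qed
qed

lemma continuous_map_real_iff:
  "continuous_map mtopology euclideanreal f \<longleftrightarrow> (\<forall>x\<in>M. \<forall>e>0. \<exists>r>0. \<forall>y\<in>M. d x y < r \<longrightarrow> \<bar>f y - f x\<bar> < e)"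
proof
  assume f: "continuous_map mtopology euclideanreal f"
  show "\<forall>x\<in>M. \<forall>e>0. \<exists>r>0. \<forall>y\<in>M. d x y < r \<longrightarrow> \<bar>f y - f x\<bar> < e"
  proof (intro ballI allI impI)
    fix x :: 'a and e :: real assume x: "x \<in> M" and e: "e > 0"
    have "openin mtopology {y \<in> topspace mtopology. f y \<in> ball (f x) e}"
      by (rule openin_continuous_map_preimage[OF f]) simp
    moreover have "x \<in> {y \<in> topspace mtopology. f y \<in> ball (f x) e}" using x e by simp
    ultimately obtain r where r: "r > 0" "\<forall>y\<in>M. d x y < r \<longrightarrow> y \<in> {y \<in> topspace mtopology. f y \<in> ball (f x) e}"
      unfolding openin_mtopology_ball by blast
    have "\<bar>f y - f x\<bar> < e" if "y \<in> M" "d x y < r" for y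
    proof -
      have "f y \<in> ball (f x) e" using r(2) that by blast
      then show ?thesis by (simp add: dist_real_def abs_minus_commute)
    qed
    then show "\<exists>r>0. \<forall>y\<in>M. d x y < r \<longrightarrow> \<bar>f y - f x\<bar> < e" using r(1) by blast
  qed
next
  assume R: "\<forall>x\<in>M. \<forall>e>0. \<exists>r>0. \<forall>y\<in>M. d x y < r \<longrightarrow> \<bar>f y - f x\<bar> < e"
  show "continuous_map mtopology euclideanreal f"
    unfolding continuous_map_def
  proof (intro conjI allI impI)
    fix V assume "openin euclideanreal V"
    then have V: "open V" by (rule open_openin[THEN iffD2])
    show "openin mtopology {x \<in> topspace mtopology. f x \<in> V}"
      unfolding openin_mtopology_ball
    proof (intro conjI ballI)
      fix x assume "x \<in> {x \<in> topspace mtopology. f x \<in> V}"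
      then have x: "x \<in> M" "f x \<in> V" by simp_all
      obtain e where e: "e > 0" "\<And>z. \<bar>z - f x\<bar> < e \<Longrightarrow> z \<in> V"
        using bspec[OF V[unfolded open_dist] x(2)] unfolding dist_real_def by blast
      obtain r where "r > 0" "\<forall>y\<in>M. d x y < r \<longrightarrow> \<bar>f y - f x\<bar> < e" using R x(1) e(1) by blast
      then show "\<exists>r>0. \<forall>y\<in>M. d x y < r \<longrightarrow> y \<in> {x \<in> topspace mtopology. f x \<in> V}"
        using e(2) by (intro exI[of _ r]) simp
    qed simp
  qed simp
qed

lemma lipschitz_continuous_map:
  assumes "L \<ge> 0" "\<And>x y. x \<in> M \<Longrightarrow> y \<in> M \<Longrightarrow> \<bar>f x - f y\<bar> \<le> L * d x y"
  shows "continuous_map mtopology euclideanreal f"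
  unfolding continuous_map_real_iff
proof (intro ballI allI impI)
  fix x :: 'a and e :: real assume x: "x \<in> M" and e: "e > 0"
  have L: "L + 1 > 0" using assms(1) by simp
  have "\<bar>f y - f x\<bar> < e" if y: "y \<in> M" "d x y < e / (L + 1)" for y
  proof -
    have "(L + 1) * d x y < e" using y(2) L by (simp add: pos_less_divide_eq mult.commute)
    moreover have "L * d x y \<le> (L + 1) * d x y" by (intro mult_right_mono) simp_all
    moreover have "\<bar>f x - f y\<bar> \<le> L * d x y" by (rule assms(2)[OF x y(1)])
    ultimately show ?thesis by linarith
  qed
  moreover have "e / (L + 1) > 0" using e L by (rule divide_pos_pos)
  ultimately show "\<exists>r>0. \<forall>y\<in>M. d x y < r \<longrightarrow> \<bar>f y - f x\<bar> < e" by blast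
qed

text \<open>A limit lies in the open set \<open>U\<close> iff the approximants are eventually in the set of
  points whose ball of some fixed radius lies in \<open>U\<close>; the complement of that set is a union of balls.\<close>

lemma measurable_metric_limit:
  assumes A: "\<And>k. A k \<in> N \<rightarrow>\<^sub>M borel_sets_of mtopology"
    and X: "\<And>\<omega>. \<omega> \<in> space N \<Longrightarrow> X \<omega> \<in> M"
    and lim: "\<And>\<omega>. \<omega> \<in> space N \<Longrightarrow> (\<lambda>k. d (A k \<omega>) (X \<omega>)) \<longlonglongrightarrow> 0"
  shows "X \<in> N \<rightarrow>\<^sub>M borel_sets_of mtopology"
proof (rule measurable_borel_sets_ofI)
  fix U assume U: "openin mtopology U"
  then have UM: "U \<subseteq> M" by (simp add: openin_mtopology)
  define F where "F j = {x \<in> M. \<forall>y\<in>M. d x y < 1 / real (Suc j) \<longrightarrow> y \<in> U}" for j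
  have AM: "A k \<omega> \<in> M" if "\<omega> \<in> space N" for k \<omega>
    using measurable_space[OF A that] by (simp add: borel_sets_of_space)
  have Fm: "F j \<in> sets (borel_sets_of mtopology)" for j
  proof -
    have "openin mtopology (M - F j)"
      unfolding openin_mtopology_ball
    proof (intro conjI ballI)
      fix x assume "x \<in> M - F j"
      then obtain y where xy: "x \<in> M" "y \<in> M" "d x y < 1 / real (Suc j)" "y \<notin> U" unfolding F_def by blast
      show "\<exists>r>0. \<forall>z\<in>M. d x z < r \<longrightarrow> z \<in> M - F j"
      proof (intro exI conjI ballI impI)
        show "1 / real (Suc j) - d x y > 0" using xy(3) by simp
        fix z assume z: "z \<in> M" "d x z < 1 / real (Suc j) - d x y"
        have "d z y \<le> d x z + d x y" using triangle[OF z(1) xy(1,2)] commute[of z x] by simp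
        then have "d z y < 1 / real (Suc j)" using z(2) by linarith
        then show "z \<in> M - F j" using xy(2,4) z(1) unfolding F_def by blast
      qed
    qed simp
    then have "M - F j \<in> sets (borel_sets_of mtopology)" by (rule borel_sets_of_open)
    then have "space (borel_sets_of mtopology) - (M - F j) \<in> sets (borel_sets_of mtopology)" by (rule sets.compl_sets)
    moreover have "space (borel_sets_of mtopology) - (M - F j) = F j"
      unfolding borel_sets_of_space topspace_mtopology F_def by blast
    ultimately show ?thesis by (simp only:)
  qed
  have iff: "X \<omega> \<in> U \<longleftrightarrow> (\<exists>j k0. \<forall>k\<in>{k0..}. A k \<omega> \<in> F j)" if w: "\<omega> \<in> space N" for \<omega>
  proof
    assume "X \<omega> \<in> U"
    then obtain r where r: "r > 0" "\<forall>y\<in>M. d (X \<omega>) y < r \<longrightarrow> y \<in> U" using U unfolding openin_mtopology_ball by blast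
    obtain j where j: "1 / real (Suc j) < r / 2" using nat_approx_posE[of "r / 2"] r(1) by auto
    obtain k0 where k0: "\<And>k. k \<ge> k0 \<Longrightarrow> \<bar>d (A k \<omega>) (X \<omega>)\<bar> < r / 2"
      using LIMSEQ_D[OF lim[OF w], of "r / 2"] r(1) by auto
    have "A k \<omega> \<in> F j" if k: "k \<ge> k0" for k
    proof -
      have "y \<in> U" if y: "y \<in> M" "d (A k \<omega>) y < 1 / real (Suc j)" for y
      proof -
        have "d (X \<omega>) y \<le> d (X \<omega>) (A k \<omega>) + d (A k \<omega>) y" by (rule triangle[OF X[OF w] AM[OF w] y(1)])
        also have "\<dots> < r" using k0[OF k] y(2) j commute[of "X \<omega>" "A k \<omega>"] by linarith
        finally show ?thesis using r(2) y(1) by blast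
      qed
      then show ?thesis unfolding F_def using AM[OF w] by blast
    qed
    then show "\<exists>j k0. \<forall>k\<in>{k0..}. A k \<omega> \<in> F j" by (intro exI[of _ j] exI[of _ k0]) simp
  next
    assume "\<exists>j k0. \<forall>k\<in>{k0..}. A k \<omega> \<in> F j"
    then obtain j k0 where jk: "\<And>k. k \<ge> k0 \<Longrightarrow> A k \<omega> \<in> F j" by auto
    obtain k1 where k1: "\<And>k. k \<ge> k1 \<Longrightarrow> \<bar>d (A k \<omega>) (X \<omega>)\<bar> < 1 / real (Suc j)"
      using LIMSEQ_D[OF lim[OF w], of "1 / real (Suc j)"] by auto
    have "A (max k0 k1) \<omega> \<in> F j" by (rule jk) simp
    moreover have "d (A (max k0 k1) \<omega>) (X \<omega>) < 1 / real (Suc j)" using k1[of "max k0 k1"] by linarith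
    ultimately show "X \<omega> \<in> U" using X[OF w] unfolding F_def by blast
  qed
  have "X -` U \<inter> space N = {\<omega> \<in> space N. \<exists>j k0. \<forall>k\<in>{k0..}. A k \<omega> \<in> F j}" using iff by blast
  also have "\<dots> = (\<Union>j. \<Union>k0. \<Inter>k\<in>{k0..}. A k -` F j \<inter> space N)" by auto
  also have "\<dots> \<in> sets N"
  proof (intro sets.countable_UN'')
    show "(\<Inter>k\<in>{k0..}. A k -` F j \<inter> space N) \<in> sets N" for j and k0 :: nat
      by (rule sets.countable_INT') (use measurable_sets[OF A Fm] in auto)
  qed simp_all
  finally show "X -` U \<inter> space N \<in> sets N" .
qed (use X in simp)

end

section \<open>Step paths and their Skorohod distance\<close>

definition step_path :: "nat \<Rightarrow> (nat \<Rightarrow> real) \<Rightarrow> real \<Rightarrow> real" where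
  "step_path k g = (\<lambda>t\<in>{0..1}. g (nat \<lfloor>real k * t\<rfloor>))"

lemma step_path_apply: "t \<in> {0..1} \<Longrightarrow> step_path k g t = g (nat \<lfloor>real k * t\<rfloor>)"
  by (simp add: step_path_def)

lemma floor_eventually_right:
  "eventually (\<lambda>s. \<lfloor>real k * s\<rfloor> = \<lfloor>real k * t\<rfloor>) (at_right t)"
proof (cases "k = 0")
  case False
  then have k: "real k > 0" by simp
  define b where "b = (of_int \<lfloor>real k * t\<rfloor> + 1) / real k"
  have tb: "t < b"
  proof -
    have "real k * t < of_int \<lfloor>real k * t\<rfloor> + 1" by linarith
    then show ?thesis unfolding b_def using k by (simp add: pos_less_divide_eq mult.commute)
  qed
  show ?thesis
    unfolding eventually_at_right_field
  proof (intro exI conjI allI impI)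
    show "t < b" by (rule tb)
    fix s assume s: "t < s" "s < b"
    have "real k * t \<le> real k * s" using s(1) k by simp
    moreover have "real k * s < of_int \<lfloor>real k * t\<rfloor> + 1"
      using s(2) k unfolding b_def by (simp add: pos_less_divide_eq mult.commute)
    ultimately show "\<lfloor>real k * s\<rfloor> = \<lfloor>real k * t\<rfloor>" by linarith
  qed
qed simp

text \<open>The ceiling gives the left limit also at grid points, where the floor jumps. The case
  \<open>k = 0\<close> is separate because the floor is then 0 while the formula yields -1.\<close>

lemma floor_eventually_left:
  "eventually (\<lambda>s. \<lfloor>real k * s\<rfloor> = \<lceil>real k * t\<rceil> - 1) (at_left t) \<or> k = 0"
proof (cases "k = 0")
  case False
  then have k: "real k > 0" by simp
  define a where "a = (of_int \<lceil>real k * t\<rceil> - 1) / real k"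
  have at: "a < t"
  proof -
    have "of_int \<lceil>real k * t\<rceil> - 1 < real k * t" by linarith
    then show ?thesis unfolding a_def using k by (simp add: pos_divide_less_eq mult.commute)
  qed
  have "eventually (\<lambda>s. \<lfloor>real k * s\<rfloor> = \<lceil>real k * t\<rceil> - 1) (at_left t)"
    unfolding eventually_at_left_field
  proof (intro exI conjI allI impI)
    show "a < t" by (rule at)
    fix s assume s: "a < s" "s < t"
    have "real k * s < real k * t" using s(2) k by simp
    moreover have "of_int \<lceil>real k * t\<rceil> - 1 < real k * s"
      using s(1) k unfolding a_def by (simp add: pos_divide_less_eq mult.commute)
    ultimately show "\<lfloor>real k * s\<rfloor> = \<lceil>real k * t\<rceil> - 1" by linarith
  qed
  then show ?thesis by blast
qed simp

lemma eventually_at_right_unit: "t \<in> {0..<1} \<Longrightarrow> eventually (\<lambda>s. s \<in> {0..1}) (at_right (t::real))"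
  unfolding eventually_at_right_field by (intro exI[of _ 1]) auto

lemma eventually_at_left_unit: "t \<in> {0<..1} \<Longrightarrow> eventually (\<lambda>s. s \<in> {0..1}) (at_left (t::real))"
  unfolding eventually_at_left_field by (intro exI[of _ 0]) auto

lemma step_path_cadlag: "step_path k g \<in> cadlag_paths"
  unfolding cadlag_paths_def mem_Collect_eq
proof (intro conjI ballI)
  show "step_path k g \<in> extensional {0..1}" by (simp add: step_path_def)
  fix t :: real
  { assume t: "t \<in> {0..<1}"
    have "eventually (\<lambda>s. step_path k g s = step_path k g t) (at_right t)"
      using floor_eventually_right[of k t] eventually_at_right_unit[OF t]
    proof eventually_elim
      case (elim s)
      have "t \<in> {0..1}" using t by simp
      then show ?case using elim by (simp only: step_path_apply)
    qed
    then show "(step_path k g \<longlongrightarrow> step_path k g t) (at_right t)" by (rule tendsto_eventually) }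
  assume t: "t \<in> {0<..1}"
  have "eventually (\<lambda>s. \<lfloor>real k * s\<rfloor> = (if k = 0 then 0 else \<lceil>real k * t\<rceil> - 1)) (at_left t)"
    using floor_eventually_left[of k t] by (cases "k = 0") simp_all
  then have "eventually (\<lambda>s. step_path k g s = g (nat (if k = 0 then 0 else \<lceil>real k * t\<rceil> - 1))) (at_left t)"
    using eventually_at_left_unit[OF t]
    by eventually_elim (simp only: step_path_apply)
  then show "\<exists>l. (step_path k g \<longlongrightarrow> l) (at_left t)" by (intro exI tendsto_eventually)
qed

lemma continuous_cadlag:
  assumes "continuous_on {0..1} b"
  shows "(\<lambda>t\<in>{0..1}. b t) \<in> cadlag_paths"
  unfolding cadlag_paths_def mem_Collect_eq
proof (intro conjI ballI)
  show "(\<lambda>t\<in>{0..1}. b t) \<in> extensional {0..1}" by simp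
  fix t :: real
  { assume t: "t \<in> {0..<1}"
    have "(b \<longlongrightarrow> b t) (at t within {0..1})" using assms t unfolding continuous_on_def by auto
    then have "(b \<longlongrightarrow> b t) (at t within {t..1})" by (rule tendsto_within_subset) (use t in auto)
    moreover have "at t within {t..1} = at_right t" using t by (intro at_within_Icc_at_right) simp
    ultimately have "(b \<longlongrightarrow> b t) (at_right t)" by simp
    moreover have "eventually (\<lambda>s. b s = (\<lambda>t\<in>{0..1}. b t) s) (at_right t)"
      using eventually_at_right_unit[OF t] by eventually_elim simp
    moreover have "(\<lambda>t\<in>{0..1}. b t) t = b t" using t by simp
    ultimately show "((\<lambda>t\<in>{0..1}. b t) \<longlongrightarrow> (\<lambda>t\<in>{0..1}. b t) t) (at_right t)"
      by (simp only: Lim_transform_eventually) }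
  assume t: "t \<in> {0<..1}"
  have "(b \<longlongrightarrow> b t) (at t within {0..1})" using assms t unfolding continuous_on_def by auto
  then have "(b \<longlongrightarrow> b t) (at t within {0..t})" by (rule tendsto_within_subset) (use t in auto)
  moreover have "at t within {0..t} = at_left t" using t by (intro at_within_Icc_at_left) simp
  ultimately have "(b \<longlongrightarrow> b t) (at_left t)" by simp
  moreover have "eventually (\<lambda>s. b s = (\<lambda>t\<in>{0..1}. b t) s) (at_left t)"
    using eventually_at_left_unit[OF t] by eventually_elim simp
  ultimately have "((\<lambda>t\<in>{0..1}. b t) \<longlongrightarrow> b t) (at_left t)" by (rule Lim_transform_eventually)
  then show "\<exists>l. ((\<lambda>t\<in>{0..1}. b t) \<longlongrightarrow> l) (at_left t)" by blast
qed

text \<open>The identity is an admissible time change. As the limit paths are continuous, uniform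
  comparison loses nothing here, and every explicit upper bound on the Skorohod distance below is
  obtained in this way.\<close>

lemma skorohod_dist_le_sup:
  assumes "x \<in> cadlag_paths" "y \<in> cadlag_paths" and b: "\<And>t. t \<in> {0..1} \<Longrightarrow> \<bar>x t - y t\<bar> \<le> e"
  shows "skorohod_dist x y \<le> e"
proof -
  have e: "0 \<le> e" using b[of 0] by simp
  have "e \<in> skorohod_bounds x y"
    by (rule skorohod_boundsI[OF id_time_change]) (use b e in simp)
  then show ?thesis
    unfolding skorohod_dist_def using assms(1,2) by (simp add: cInf_lower skorohod_bounds_bdd_below)
qed

text \<open>The index \<open>k\<close> itself occurs, at time 1, so a step path with parameter
  \<open>k\<close> depends on \<open>k + 1\<close> values.\<close>

lemma step_index: "t \<in> {0..1} \<Longrightarrow> nat \<lfloor>real k * t\<rfloor> \<le> k"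
proof -
  assume t: "t \<in> {0..1}"
  have "real k * t \<le> real k * 1" using t by (intro mult_left_mono) auto
  then have "\<lfloor>real k * t\<rfloor> \<le> int k" by linarith
  then show ?thesis by simp
qed

lemma step_path_dist:
  assumes "\<And>n. n \<le> k \<Longrightarrow> \<bar>g n - h n\<bar> \<le> e"
  shows "skorohod_dist (step_path k g) (step_path k h) \<le> e"
proof (rule skorohod_dist_le_sup[OF step_path_cadlag step_path_cadlag])
  fix t :: real assume t: "t \<in> {0..1}"
  show "\<bar>step_path k g t - step_path k h t\<bar> \<le> e"
    unfolding step_path_apply[OF t] by (rule assms[OF step_index[OF t]])
qed

text \<open>Only finitely many coordinates matter and the Skorohod distance is at most their largest
  difference, so \<open>step_path k\<close> is continuous from sequences with the product topology,
  whose Borel sets are those of \<open>seq_space\<close>.\<close>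

lemma measurable_step_path:
  assumes G: "\<And>n. (\<lambda>\<omega>. G \<omega> n) \<in> borel_measurable N"
  shows "(\<lambda>\<omega>. step_path k (G \<omega>)) \<in> N \<rightarrow>\<^sub>M borel_sets_of skorohod_topology"
proof (rule measurable_borel_sets_ofI)
  fix U assume U: "openin skorohod_topology U"
  let ?V = "{g. step_path k g \<in> U}"
  have "open ?V"
    unfolding open_subopen[of ?V]
  proof (rule ballI)
    fix g assume "g \<in> ?V"
    then have "step_path k g \<in> U" by simp
    then obtain r where r: "r > 0" "\<forall>y\<in>cadlag_paths. skorohod_dist (step_path k g) y < r \<longrightarrow> y \<in> U"
      using U unfolding skorohod.openin_mtopology_ball by blast
    let ?W = "\<Inter>n\<in>{..k}. {h::nat \<Rightarrow> real. \<bar>g n - h n\<bar> < r / 2}"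
    have "open ?W"
    proof (intro open_INT ballI)
      fix n
      have c: "continuous_on UNIV (\<lambda>h::nat \<Rightarrow> real. h n)" by (rule continuous_on_product_coordinates)
      show "open {h::nat \<Rightarrow> real. \<bar>g n - h n\<bar> < r / 2}" by (intro open_Collect_less continuous_intros c)
    qed simp
    moreover have "g \<in> ?W" using r(1) by simp
    moreover have "?W \<subseteq> ?V"
    proof
      fix h assume h: "h \<in> ?W"
      have "skorohod_dist (step_path k g) (step_path k h) \<le> r / 2"
        by (rule step_path_dist) (use h in \<open>auto intro: less_imp_le\<close>)
      then show "h \<in> ?V" using r step_path_cadlag[of k h] by simp
    qed
    ultimately show "\<exists>T. open T \<and> g \<in> T \<and> T \<subseteq> ?V" by blast
  qed
  then have "?V \<in> sets seq_space" by (simp only: sets_PiM_equal_borel borel_open)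
  moreover have "G \<in> N \<rightarrow>\<^sub>M seq_space" by (rule measurable_PiM_single') (simp_all add: G)
  ultimately have "G -` ?V \<inter> space N \<in> sets N" by (rule measurable_sets[rotated])
  then show "(\<lambda>\<omega>. step_path k (G \<omega>)) -` U \<inter> space N \<in> sets N" by (simp only: vimage_Collect_eq vimage_def mem_Collect_eq)
qed (simp add: step_path_cadlag)

lemma step_path_continuous_limit:
  assumes b: "continuous_on {0..1} b" and e: "e > 0"
  shows "\<exists>k0. \<forall>k\<ge>k0. skorohod_dist (step_path (Suc k) (\<lambda>j. b (real j / real (Suc k)))) (\<lambda>t\<in>{0..1}. b t) \<le> e"
proof -
  have "uniformly_continuous_on {0..1} b" by (rule compact_uniformly_continuous[OF b]) simp
  then obtain r where r: "r > 0" "\<And>s t. s \<in> {0..1} \<Longrightarrow> t \<in> {0..1} \<Longrightarrow> dist t s < r \<Longrightarrow> dist (b t) (b s) < e"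
    using e unfolding uniformly_continuous_on_def by metis
  obtain k0 where k0: "1 / real (Suc k0) < r" using nat_approx_posE[OF r(1)] by auto
  have "skorohod_dist (step_path (Suc k) (\<lambda>j. b (real j / real (Suc k)))) (\<lambda>t\<in>{0..1}. b t) \<le> e" if k: "k \<ge> k0" for k
  proof (rule skorohod_dist_le_sup[OF step_path_cadlag continuous_cadlag[OF b]])
    fix t :: real assume t: "t \<in> {0..1}"
    let ?n = "real (Suc k)"
    let ?s = "real (nat \<lfloor>?n * t\<rfloor>) / ?n"
    have n: "?n > 0" by simp
    have nn: "0 \<le> \<lfloor>?n * t\<rfloor>" using t by simp
    have s: "?n * ?s = of_int \<lfloor>?n * t\<rfloor>" using n nn by simp
    have "?n * ?s \<le> ?n * t" unfolding s by linarith
    then have st: "?s \<le> t" using n by (simp only: mult_le_cancel_left_pos)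
    have "?n * t < ?n * ?s + 1" unfolding s by linarith
    then have "?n * (t - ?s) < 1" by (simp only: right_diff_distrib)
    then have "t - ?s < 1 / ?n" using n by (simp only: pos_less_divide_eq mult.commute)
    also have "\<dots> \<le> 1 / real (Suc k0)" using k by (intro divide_left_mono) simp_all
    finally have "t - ?s < r" using k0 by linarith
    then have "dist ?s t < r" using st by (simp only: dist_real_def)
    moreover have "?s \<in> {0..1}"
    proof -
      have "0 \<le> ?s" by simp
      moreover have "t \<le> 1" using t by simp
      then have "?s \<le> 1" by (rule order_trans[OF st])
      ultimately show ?thesis by (simp only: atLeastAtMost_iff)
    qed
    ultimately have "dist (b ?s) (b t) < e" using t by (intro r(2))
    then show "\<bar>step_path (Suc k) (\<lambda>j. b (real j / real (Suc k))) t - (\<lambda>t\<in>{0..1}. b t) t\<bar> \<le> e"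
      unfolding step_path_apply[OF t] using t by (simp add: dist_real_def)
  qed
  then show ?thesis by blast
qed

lemma measurable_continuous_process:
  assumes B: "\<And>t. t \<in> {0..1} \<Longrightarrow> B t \<in> borel_measurable N"
    and c: "\<And>\<omega>. \<omega> \<in> space N \<Longrightarrow> continuous_on {0..1} (\<lambda>t. B t \<omega>)"
  shows "(\<lambda>\<omega>. \<lambda>t\<in>{0..1}. B t \<omega>) \<in> N \<rightarrow>\<^sub>M borel_sets_of skorohod_topology"
proof (rule skorohod.measurable_metric_limit)
  \<comment> \<open>The truncation by \<open>min 1\<close> keeps all indices inside the unit
    interval, where \<open>B\<close> is known to be measurable; the fact \<open>A\<close> shows that
    the path does not change.\<close>
  let ?A = "\<lambda>k \<omega>. step_path (Suc k) (\<lambda>j. B (min 1 (real j / real (Suc k))) \<omega>)"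
  show "?A k \<in> N \<rightarrow>\<^sub>M borel_sets_of skorohod_topology" for k
    by (rule measurable_step_path) (intro B, simp)
  fix \<omega> assume w: "\<omega> \<in> space N"
  show "(\<lambda>t\<in>{0..1}. B t \<omega>) \<in> cadlag_paths" by (rule continuous_cadlag[OF c[OF w]])
  have A: "?A k \<omega> = step_path (Suc k) (\<lambda>j. B (real j / real (Suc k)) \<omega>)" for k
  proof (rule ext)
    fix t :: real
    show "?A k \<omega> t = step_path (Suc k) (\<lambda>j. B (real j / real (Suc k)) \<omega>) t"
    proof (cases "t \<in> {0..1}")
      case True
      have "real (nat \<lfloor>real (Suc k) * t\<rfloor>) / real (Suc k) \<le> 1"
        using step_index[OF True, of "Suc k"] by (simp add: divide_le_eq_1 del: of_nat_Suc)
      then show ?thesis unfolding step_path_apply[OF True] by (simp only: min_absorb2)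
    next
      case False
      then show ?thesis by (simp only: step_path_def restrict_apply if_False)
    qed
  qed
  show "(\<lambda>k. skorohod_dist (?A k \<omega>) (\<lambda>t\<in>{0..1}. B t \<omega>)) \<longlonglongrightarrow> 0"
    unfolding A
  proof (rule LIMSEQ_I)
    fix e :: real assume e: "e > 0"
    then obtain k0 where k0: "\<And>k. k \<ge> k0 \<Longrightarrow> skorohod_dist (step_path (Suc k) (\<lambda>j. B (real j / real (Suc k)) \<omega>)) (\<lambda>t\<in>{0..1}. B t \<omega>) \<le> e / 2"
      using step_path_continuous_limit[OF c[OF w], of "e / 2"] by auto
    have "norm (skorohod_dist (step_path (Suc k) (\<lambda>j. B (real j / real (Suc k)) \<omega>)) (\<lambda>t\<in>{0..1}. B t \<omega>) - 0) < e" if "k \<ge> k0" for k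
      using k0[OF that] skorohod.nonneg[of "step_path (Suc k) (\<lambda>j. B (real j / real (Suc k)) \<omega>)" "\<lambda>t\<in>{0..1}. B t \<omega>"] e
      unfolding real_norm_def diff_0_right by linarith
    then show "\<exists>no. \<forall>n\<ge>no. norm (skorohod_dist (step_path (Suc n) (\<lambda>j. B (real j / real (Suc n)) \<omega>)) (\<lambda>t\<in>{0..1}. B t \<omega>) - 0) < e" by blast
  qed
qed

interpretation sk: pseudo_dist cadlag_paths skorohod_dist
proof
  show "skorohod_dist x z \<le> skorohod_dist x y + skorohod_dist y z" if "x \<in> cadlag_paths" "y \<in> cadlag_paths" "z \<in> cadlag_paths" for x y z
    by (rule skorohod.triangle[OF that])
qed (use skorohod.nonneg skorohod.commute skorohod.mdist_zero in auto)

section \<open>Central limit theorem and Gaussian limits\<close>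

text \<open>The theorem asks for measures on real functions of a real variable, so the noise is
  indexed by the reals; the Gaussian vectors read only the coordinates at natural numbers.\<close>

definition white_noise :: "(real \<Rightarrow> real) measure" where
  "white_noise = (\<Pi>\<^sub>M i\<in>UNIV. std_normal_distribution)"

lemma prob_space_std_normal: "prob_space std_normal_distribution"
  by (rule prob_space_normal_density) simp

lemma prob_space_white_noise: "prob_space white_noise"
  unfolding white_noise_def by (rule prob_space_PiM) (rule prob_space_std_normal)

interpretation WN: prob_space white_noise by (rule prob_space_white_noise)

interpretation WP: product_prob_space "\<lambda>_::real. std_normal_distribution" "UNIV :: real set"
  by (rule product_prob_spaceI) (rule prob_space_std_normal)

lemma measurable_white_noise_coord[measurable]: "(\<lambda>\<omega>. \<omega> i) \<in> borel_measurable white_noise"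
proof -
  have "(\<lambda>\<omega>. \<omega> i) \<in> white_noise \<rightarrow>\<^sub>M std_normal_distribution"
    unfolding white_noise_def by (rule measurable_component_singleton) simp
  then show ?thesis by simp
qed

lemma distr_white_noise_coord: "distr white_noise borel (\<lambda>\<omega>. \<omega> i) = std_normal_distribution"
proof -
  have "distr white_noise borel (\<lambda>\<omega>. \<omega> i) = distr white_noise std_normal_distribution (\<lambda>\<omega>. \<omega> i)"
    by (rule distr_cong) simp_all
  also have "\<dots> = std_normal_distribution" unfolding white_noise_def by (rule WP.PiM_component) simp
  finally show ?thesis .
qed

lemma indep_white_noise: "WN.indep_vars (\<lambda>_. borel) (\<lambda>i \<omega>. \<omega> i) UNIV"
proof (subst WN.indep_vars_iff_distr_eq_PiM')
  have s: "sets (\<Pi>\<^sub>M i\<in>(UNIV::real set). borel :: real measure) = sets white_noise"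
    unfolding white_noise_def by (intro sets_PiM_cong) simp_all
  show "distr white_noise (\<Pi>\<^sub>M i\<in>UNIV. borel) (\<lambda>x. \<lambda>i\<in>UNIV. x i) = (\<Pi>\<^sub>M i\<in>UNIV. distr white_noise borel (\<lambda>\<omega>. \<omega> i))"
    unfolding distr_white_noise_coord restrict_UNIV white_noise_def[symmetric]
    by (rule distr_id2) (rule s)
qed simp_all

definition noise_sum :: "(nat \<Rightarrow> real) \<Rightarrow> nat \<Rightarrow> (real \<Rightarrow> real) \<Rightarrow> real" where
  "noise_sum b n \<omega> = (\<Sum>l<n. b l * \<omega> (real l))"

lemma measurable_noise_sum[measurable]: "noise_sum b n \<in> borel_measurable white_noise"
  unfolding noise_sum_def[abs_def] by measurable

lemma integral_std_normal_iexp: "(\<integral>x. iexp (t * x) \<partial>std_normal_distribution) = complex_of_real (exp (- (t\<^sup>2) / 2))"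
  using fun_cong[OF char_std_normal_distribution, of t] unfolding char_def .

lemma noise_sum_iexp:
  "(\<integral>\<omega>. iexp (t * noise_sum b n \<omega>) \<partial>white_noise) = complex_of_real (exp (- (t\<^sup>2 * (\<Sum>l<n. (b l)\<^sup>2)) / 2))"
proof -
  have coord: "(\<integral>\<omega>. iexp (c * \<omega> i) \<partial>white_noise) = complex_of_real (exp (- (c\<^sup>2) / 2))" for c i
  proof -
    have "(\<integral>x. iexp (c * x) \<partial>distr white_noise borel (\<lambda>\<omega>. \<omega> i)) = (\<integral>\<omega>. iexp (c * \<omega> i) \<partial>white_noise)"
      by (rule integral_distr) simp_all
    then show ?thesis unfolding distr_white_noise_coord integral_std_normal_iexp by simp
  qed
  \<comment> \<open>The term \<open>nat \<lfloor>i\<rfloor>\<close> recovers the summation index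
    \<open>l\<close> from the coordinate \<open>real l\<close>, which lets the independence over all
    real indices be restricted to the image of \<open>{..<n}\<close>.\<close>
  have "WN.indep_vars (\<lambda>_. borel) (\<lambda>i \<omega>. iexp (t * b (nat \<lfloor>i\<rfloor>) * \<omega> i)) UNIV"
    by (rule WN.indep_vars_compose2[OF indep_white_noise]) simp
  then have ind: "WN.indep_vars (\<lambda>_. borel) (\<lambda>i \<omega>. iexp (t * b (nat \<lfloor>i\<rfloor>) * \<omega> i)) (real ` {..<n})"
    by (rule WN.indep_vars_subset) simp
  have int: "integrable white_noise (\<lambda>\<omega>. iexp (t * b (nat \<lfloor>i\<rfloor>) * \<omega> i))" for i
    by (rule WN.integrable_const_bound[where B = 1]) simp_all
  have "iexp (t * noise_sum b n \<omega>) = (\<Prod>i\<in>real ` {..<n}. iexp (t * b (nat \<lfloor>i\<rfloor>) * \<omega> i))" for \<omega>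
  proof -
    have "t * noise_sum b n \<omega> = (\<Sum>l<n. t * b l * \<omega> (real l))"
      unfolding noise_sum_def sum_distrib_left by (simp add: mult.assoc)
    moreover have "(\<Prod>i\<in>real ` {..<n}. iexp (t * b (nat \<lfloor>i\<rfloor>) * \<omega> i)) = (\<Prod>l<n. iexp (t * b l * \<omega> (real l)))"
      by (subst prod.reindex) (simp_all add: inj_on_def)
    ultimately show ?thesis by (simp only: iexp_sum finite_lessThan)
  qed
  then have "(\<integral>\<omega>. iexp (t * noise_sum b n \<omega>) \<partial>white_noise) = (\<integral>\<omega>. (\<Prod>i\<in>real ` {..<n}. iexp (t * b (nat \<lfloor>i\<rfloor>) * \<omega> i)) \<partial>white_noise)"
    by (simp only:)
  also have "\<dots> = (\<Prod>i\<in>real ` {..<n}. \<integral>\<omega>. iexp (t * b (nat \<lfloor>i\<rfloor>) * \<omega> i) \<partial>white_noise)"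
    by (rule WN.indep_vars_lebesgue_integral[OF _ ind int]) simp
  also have "\<dots> = (\<Prod>l<n. complex_of_real (exp (- ((t * b l)\<^sup>2) / 2)))"
    unfolding coord by (subst prod.reindex) (simp_all add: inj_on_def)
  also have "\<dots> = complex_of_real (exp (\<Sum>l<n. - ((t * b l)\<^sup>2) / 2))"
    by (simp only: exp_sum finite_lessThan of_real_prod)
  also have "(\<Sum>l<n. - ((t * b l)\<^sup>2) / 2) = - (t\<^sup>2 * (\<Sum>l<n. (b l)\<^sup>2)) / 2"
    by (simp add: power_mult_distrib sum_negf sum_divide_distrib sum_distrib_left)
  finally show ?thesis .
qed

text \<open>Once the law is that of a multiple of one standard normal variable, the even moments of
  every order follow from the standard ones.\<close>

lemma noise_sum_law:
  "distr white_noise borel (noise_sum b n) = distr std_normal_distribution borel (\<lambda>x. sqrt (\<Sum>l<n. (b l)\<^sup>2) * x)"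
proof (rule Levy_uniqueness)
  show "real_distribution (distr white_noise borel (noise_sum b n))"
    by (rule WN.real_distribution_distr) simp
  show "real_distribution (distr std_normal_distribution borel (\<lambda>x. sqrt (\<Sum>l<n. (b l)\<^sup>2) * x))"
    by (rule prob_space.real_distribution_distr[OF prob_space_std_normal]) simp
  show "char (distr white_noise borel (noise_sum b n)) = char (distr std_normal_distribution borel (\<lambda>x. sqrt (\<Sum>l<n. (b l)\<^sup>2) * x))"
  proof
    fix t
    let ?s = "sqrt (\<Sum>l<n. (b l)\<^sup>2)"
    have s: "?s\<^sup>2 = (\<Sum>l<n. (b l)\<^sup>2)" by (rule real_sqrt_pow2) (rule sum_nonneg, simp)
    have "char (distr white_noise borel (noise_sum b n)) t = (\<integral>\<omega>. iexp (t * noise_sum b n \<omega>) \<partial>white_noise)"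
      unfolding char_def by (rule integral_distr) simp_all
    also have "\<dots> = complex_of_real (exp (- ((t * ?s)\<^sup>2) / 2))"
      unfolding noise_sum_iexp power_mult_distrib s ..
    also have "\<dots> = (\<integral>x. iexp (t * (?s * x)) \<partial>std_normal_distribution)"
      unfolding integral_std_normal_iexp[symmetric] by (simp only: mult.assoc)
    also have "\<dots> = char (distr std_normal_distribution borel (\<lambda>x. ?s * x)) t"
      unfolding char_def by (rule integral_distr[symmetric]) simp_all
    finally show "char (distr white_noise borel (noise_sum b n)) t = char (distr std_normal_distribution borel (\<lambda>x. ?s * x)) t" .
  qed
qed

lemma noise_sum_moment:
  "integrable white_noise (\<lambda>\<omega>. noise_sum b n \<omega> ^ (2 * q))"
  "(\<integral>\<omega>. noise_sum b n \<omega> ^ (2 * q) \<partial>white_noise) = fact (2 * q) / (2 ^ q * fact q) * (\<Sum>l<n. (b l)\<^sup>2) ^ q"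
proof -
  let ?s = "sqrt (\<Sum>l<n. (b l)\<^sup>2)"
  have s: "?s ^ (2 * q) = (\<Sum>l<n. (b l)\<^sup>2) ^ q"
    unfolding power_mult by (subst real_sqrt_pow2) (simp_all add: sum_nonneg)
  have i: "integrable std_normal_distribution (\<lambda>x. (?s * x) ^ (2 * q))"
    unfolding power_mult_distrib by (intro integrable_mult_right integrable_std_normal_distribution_moment)
  have "integrable (distr white_noise borel (noise_sum b n)) (\<lambda>x. x ^ (2 * q)) \<longleftrightarrow> integrable white_noise (\<lambda>\<omega>. noise_sum b n \<omega> ^ (2 * q))"
    by (rule integrable_distr_eq) simp_all
  moreover have "integrable (distr std_normal_distribution borel (\<lambda>x. ?s * x)) (\<lambda>x. x ^ (2 * q)) \<longleftrightarrow> integrable std_normal_distribution (\<lambda>x. (?s * x) ^ (2 * q))"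
    by (rule integrable_distr_eq) simp_all
  ultimately show "integrable white_noise (\<lambda>\<omega>. noise_sum b n \<omega> ^ (2 * q))" using i by (simp only: noise_sum_law)
  have "(\<integral>\<omega>. noise_sum b n \<omega> ^ (2 * q) \<partial>white_noise) = (\<integral>x. x ^ (2 * q) \<partial>distr white_noise borel (noise_sum b n))"
    by (rule integral_distr[symmetric]) simp_all
  also have "\<dots> = (\<integral>x. (?s * x) ^ (2 * q) \<partial>std_normal_distribution)"
    unfolding noise_sum_law by (rule integral_distr) simp_all
  also have "\<dots> = ?s ^ (2 * q) * (\<integral>x. x ^ (2 * q) \<partial>std_normal_distribution)"
    unfolding power_mult_distrib by (rule integral_mult_right_zero)
  also have "\<dots> = fact (2 * q) / (2 ^ q * fact q) * (\<Sum>l<n. (b l)\<^sup>2) ^ q"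
    unfolding s std_normal_distribution_even_moments by (rule mult.commute)
  finally show "(\<integral>\<omega>. noise_sum b n \<omega> ^ (2 * q) \<partial>white_noise) = fact (2 * q) / (2 ^ q * fact q) * (\<Sum>l<n. (b l)\<^sup>2) ^ q" .
qed

text \<open>The characteristic function at frequency 1 is enough, since the coefficients of a linear
  combination are part of \<open>X\<close> in the application.\<close>

lemma (in prob_space) clt_char:
  fixes X :: "nat \<Rightarrow> 'a \<Rightarrow> real"
  assumes ind: "indep_vars (\<lambda>_. borel) X UNIV"
    and dist: "\<And>i. distr M borel (X i) = \<mu>"
    and int: "\<And>i. integrable M (\<lambda>\<omega>. (X i \<omega>)\<^sup>2)"
    and mean: "\<And>i. expectation (X i) = 0"
    and var: "\<And>i. expectation (\<lambda>\<omega>. (X i \<omega>)\<^sup>2) = v"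
  shows "(\<lambda>n. \<integral>\<omega>. iexp ((\<Sum>i<n. X i \<omega>) / sqrt (real n)) \<partial>M) \<longlonglongrightarrow> complex_of_real (exp (- v / 2))"
proof -
  have rv[measurable]: "random_variable borel (X i)" for i using ind unfolding indep_vars_def by auto
  have v: "0 \<le> v" unfolding var[of 0, symmetric] by (rule Bochner_Integration.integral_nonneg) simp
  show ?thesis
  proof (cases "v = 0")
    \<comment> \<open>Combinations of zero variance do occur, for instance at time 0, while the
      central limit theorem divides by the standard deviation. Here all summands vanish almost
      everywhere.\<close>
    case True
    have "AE \<omega> in M. (X i \<omega>)\<^sup>2 = 0" for i
      using integral_nonneg_eq_0_iff_AE[OF int[of i]] var[of i] True by simp
    then have "AE \<omega> in M. \<forall>i. X i \<omega> = 0" unfolding AE_all_countable by simp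
    then have "(\<integral>\<omega>. iexp ((\<Sum>i<n. X i \<omega>) / sqrt (real n)) \<partial>M) = (\<integral>\<omega>. 1 \<partial>M)" for n
      by (intro integral_cong_AE) (auto elim!: eventually_mono)
    then have "(\<integral>\<omega>. iexp ((\<Sum>i<n. X i \<omega>) / sqrt (real n)) \<partial>M) = 1" for n
      using prob_space by simp
    then show ?thesis using True by simp
  next
    case False
    define s where "s = sqrt v"
    have s: "s > 0" "s\<^sup>2 = v" using v False by (simp_all add: s_def)
    have "weak_conv_m (\<lambda>n. distr M borel (\<lambda>\<omega>. (\<Sum>i<n. X i \<omega>) / sqrt (n * s\<^sup>2))) std_normal_distribution"
    proof (rule central_limit_theorem_zero_mean[OF ind mean s(1) int _ dist])
      show "variance (X i) = s\<^sup>2" for i using var[of i] by (simp add: mean s(2))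
    qed
    \<comment> \<open>Evaluating at \<open>s\<close> undoes the division by the standard
      deviation.\<close>
    then have "(\<lambda>n. char (distr M borel (\<lambda>\<omega>. (\<Sum>i<n. X i \<omega>) / sqrt (n * s\<^sup>2))) s) \<longlonglongrightarrow> char std_normal_distribution s"
    proof (rule levy_continuity1[rotated 2])
      show "real_distribution (distr M borel (\<lambda>\<omega>. (\<Sum>i<n. X i \<omega>) / sqrt (n * s\<^sup>2)))" for n
        by (rule real_distribution_distr) measurable
      show "real_distribution std_normal_distribution" by (rule real_dist_normal_dist)
    qed
    moreover have "char (distr M borel (\<lambda>\<omega>. (\<Sum>i<n. X i \<omega>) / sqrt (n * s\<^sup>2))) s = (\<integral>\<omega>. iexp ((\<Sum>i<n. X i \<omega>) / sqrt (real n)) \<partial>M)" for n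
    proof -
      have "char (distr M borel (\<lambda>\<omega>. (\<Sum>i<n. X i \<omega>) / sqrt (n * s\<^sup>2))) s = (\<integral>\<omega>. iexp (s * ((\<Sum>i<n. X i \<omega>) / sqrt (n * s\<^sup>2))) \<partial>M)"
        unfolding char_def by (rule integral_distr) measurable
      moreover have "s * (x / sqrt (n * s\<^sup>2)) = x / sqrt (real n)" for x
        using s(1) by (simp add: real_sqrt_mult)
      ultimately show ?thesis by (simp only:)
    qed
    ultimately show ?thesis unfolding char_std_normal_distribution s(2) by simp
  qed
qed

text \<open>In both alternatives the vanishing mean forces \<open>m = 0\<close>, and a centred
  Gaussian law is determined by its second moment; for the point mass both sides of the formula are
  1.\<close>

lemma gaussian_law_centered:
  assumes M: "prob_space M" and X[measurable]: "X \<in> borel_measurable M"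
    and g: "gaussian_law (distr M borel X)" and mean: "(\<integral>\<omega>. X \<omega> \<partial>M) = 0"
  shows "integrable M (\<lambda>\<omega>. (X \<omega>)\<^sup>2)"
    "(\<integral>\<omega>. iexp (X \<omega>) \<partial>M) = complex_of_real (exp (- (\<integral>\<omega>. (X \<omega>)\<^sup>2 \<partial>M) / 2))"
proof -
  interpret prob_space M by fact
  have sq: "integrable (distr M borel X) (\<lambda>x. x\<^sup>2) \<longleftrightarrow> integrable M (\<lambda>\<omega>. (X \<omega>)\<^sup>2)"
    by (rule integrable_distr_eq) simp_all
  have "integrable M (\<lambda>\<omega>. (X \<omega>)\<^sup>2) \<and> (\<integral>\<omega>. iexp (X \<omega>) \<partial>M) = complex_of_real (exp (- (\<integral>\<omega>. (X \<omega>)\<^sup>2 \<partial>M) / 2))"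
    using g unfolding gaussian_law_def
  proof (elim disjE exE conjE)
    fix m assume d: "distr M borel X = return borel m"
    have tr: "(\<integral>\<omega>. f (X \<omega>) \<partial>M) = f m" if "f \<in> borel_measurable borel" for f :: "real \<Rightarrow> 'z::{banach, second_countable_topology}"
    proof -
      have "(\<integral>x. f x \<partial>distr M borel X) = (\<integral>\<omega>. f (X \<omega>) \<partial>M)" by (rule integral_distr) (simp_all add: that)
      then show ?thesis unfolding d using that by (simp add: integral_return)
    qed
    have m: "m = 0" using tr[of "\<lambda>x. x"] mean by simp
    have "integrable (return borel m) (\<lambda>x. x\<^sup>2)"
    proof -
      interpret R: prob_space "return borel m" by (rule prob_space_return) simp
      have "AE x in return borel m. norm (x\<^sup>2) \<le> m\<^sup>2" by (subst AE_return) simp_all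
      then show ?thesis by (intro R.integrable_const_bound) simp_all
    qed
    then show ?thesis using sq tr[of "\<lambda>x. x\<^sup>2"] tr[of iexp] unfolding d m by simp
  next
    fix m s :: real assume s: "s > 0" and d: "distr M borel X = density lborel (\<lambda>x. ennreal (normal_density m s x))"
    have dd: "distr M lborel X = density lborel (\<lambda>x. ennreal (normal_density m s x))"
      using d by (simp cong: distr_cong)
    have D: "distributed M lborel X (normal_density m s)"
      unfolding distributed_def using dd by simp
    have m: "m = 0" using normal_distributed_expectation[OF s D] mean by simp
    have var: "expectation (\<lambda>\<omega>. (X \<omega>)\<^sup>2) = s\<^sup>2"
      using normal_distributed_variance[OF s D] mean by simp
    have "integrable lborel (\<lambda>x. normal_density m s x *\<^sub>R x\<^sup>2)"
      using integrable_normal_moment[OF s, of m 2] m by simp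
    then have "integrable (density lborel (\<lambda>x. ennreal (normal_density m s x))) (\<lambda>x. x\<^sup>2)"
      by (subst integrable_density) simp_all
    then have i: "integrable M (\<lambda>\<omega>. (X \<omega>)\<^sup>2)" using sq unfolding d by simp
    have "distributed M lborel (\<lambda>\<omega>. (X \<omega> - m) / s) std_normal_density"
      using normal_standard_normal_convert[OF s] D by simp
    then have "distr M lborel (\<lambda>\<omega>. X \<omega> / s) = std_normal_distribution"
      unfolding m distributed_def by simp
    then have d1: "distr M borel (\<lambda>\<omega>. X \<omega> / s) = std_normal_distribution" by (simp cong: distr_cong)
    have "(\<integral>x. iexp (s * x) \<partial>distr M borel (\<lambda>\<omega>. X \<omega> / s)) = (\<integral>\<omega>. iexp (s * (X \<omega> / s)) \<partial>M)"
      by (rule integral_distr) measurable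
    then have "(\<integral>\<omega>. iexp (X \<omega>) \<partial>M) = complex_of_real (exp (- (s\<^sup>2) / 2))"
      unfolding d1 integral_std_normal_iexp using s by simp
    then show ?thesis using i var by simp
  qed
  then show "integrable M (\<lambda>\<omega>. (X \<omega>)\<^sup>2)"
    "(\<integral>\<omega>. iexp (X \<omega>) \<partial>M) = complex_of_real (exp (- (\<integral>\<omega>. (X \<omega>)\<^sup>2 \<partial>M) / 2))" by blast+
qed

lemma square_sum_expand:
  "(\<Sum>t\<in>J. a t * x t)\<^sup>2 = (\<Sum>s\<in>J. \<Sum>t\<in>J. a s * a t * (x s * x t))" for x :: "'i \<Rightarrow> real"
proof -
  have "(\<Sum>t\<in>J. a t * x t)\<^sup>2 = (\<Sum>s\<in>J. \<Sum>t\<in>J. (a s * x s) * (a t * x t))"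
    unfolding power2_eq_square by (rule sum_product)
  also have "\<dots> = (\<Sum>s\<in>J. \<Sum>t\<in>J. a s * a t * (x s * x t))"
    by (intro sum.cong refl) simp
  finally show ?thesis .
qed

lemma integrable_mult_of_squares:
  assumes X: "X \<in> borel_measurable M" and Y: "Y \<in> borel_measurable M"
    and "integrable M (\<lambda>\<omega>. (X \<omega>)\<^sup>2)" "integrable M (\<lambda>\<omega>. (Y \<omega>)\<^sup>2)"
  shows "integrable M (\<lambda>\<omega>. X \<omega> * Y \<omega> :: real)"
proof (rule Bochner_Integration.integrable_bound)
  show "integrable M (\<lambda>\<omega>. (X \<omega>)\<^sup>2 + (Y \<omega>)\<^sup>2)" using assms(3,4) by (rule Bochner_Integration.integrable_add)
  show "(\<lambda>\<omega>. X \<omega> * Y \<omega>) \<in> borel_measurable M" by (rule borel_measurable_times[OF X Y])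
  show "AE \<omega> in M. norm (X \<omega> * Y \<omega>) \<le> norm ((X \<omega>)\<^sup>2 + (Y \<omega>)\<^sup>2)"
  proof (rule AE_I2)
    fix \<omega>
    have "2 * \<bar>X \<omega>\<bar> * \<bar>Y \<omega>\<bar> \<le> \<bar>X \<omega>\<bar>\<^sup>2 + \<bar>Y \<omega>\<bar>\<^sup>2" by (rule sum_squares_bound)
    moreover have "0 \<le> \<bar>X \<omega>\<bar> * \<bar>Y \<omega>\<bar>" by simp
    ultimately have "\<bar>X \<omega>\<bar> * \<bar>Y \<omega>\<bar> \<le> (X \<omega>)\<^sup>2 + (Y \<omega>)\<^sup>2" unfolding power2_abs by linarith
    then show "norm (X \<omega> * Y \<omega>) \<le> norm ((X \<omega>)\<^sup>2 + (Y \<omega>)\<^sup>2)" by (simp add: abs_mult)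
  qed
qed

lemma gaussian_process_iexp:
  fixes B :: "real \<Rightarrow> 'a \<Rightarrow> real"
  assumes M: "prob_space M" and g: "gaussian_process M T B"
    and mean: "\<And>t. t \<in> T \<Longrightarrow> (\<integral>\<omega>. B t \<omega> \<partial>M) = 0"
    and cov: "\<And>s t. s \<in> T \<Longrightarrow> t \<in> T \<Longrightarrow> (\<integral>\<omega>. B s \<omega> * B t \<omega> \<partial>M) = R s t"
    and J: "finite J" "J \<subseteq> T"
  shows "(\<integral>\<omega>. iexp (\<Sum>t\<in>J. a t * B t \<omega>) \<partial>M) = complex_of_real (exp (- (\<Sum>s\<in>J. \<Sum>t\<in>J. a s * a t * R s t) / 2))"
proof -
  interpret prob_space M by fact
  have m: "B t \<in> borel_measurable M" if "t \<in> J" for t using g J that unfolding gaussian_process_def by blast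
  have gl: "gaussian_law (distr M borel (\<lambda>\<omega>. \<Sum>t\<in>F. b t * B t \<omega>))" if "finite F" "F \<subseteq> T" for F b
    using g that unfolding gaussian_process_def by blast
  \<comment> \<open>Square integrability is read off from the Gaussian one-point laws. It makes the
    covariance integrals genuine, as the Bochner integral of a non-integrable function is 0 by
    convention.\<close>
  have sq: "integrable M (\<lambda>\<omega>. (B t \<omega>)\<^sup>2)" if t: "t \<in> J" for t
  proof (rule gaussian_law_centered(1)[OF M m[OF t] _ mean])
    show "gaussian_law (distr M borel (B t))" using gl[of "{t}" "\<lambda>_. 1"] t J(2) by auto
    show "t \<in> T" using t J(2) by blast
  qed
  have i: "integrable M (B t)" if "t \<in> J" for t
    by (rule square_integrable_imp_integrable[OF m[OF that] sq[OF that]])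
  have ii: "integrable M (\<lambda>\<omega>. B s \<omega> * B t \<omega>)" if "s \<in> J" "t \<in> J" for s t
    by (rule integrable_mult_of_squares[OF m[OF that(1)] m[OF that(2)] sq[OF that(1)] sq[OF that(2)]])
  have "(\<integral>\<omega>. (\<Sum>t\<in>J. a t * B t \<omega>) \<partial>M) = (\<Sum>t\<in>J. a t * (\<integral>\<omega>. B t \<omega> \<partial>M))"
    using i by (subst Bochner_Integration.integral_sum) simp_all
  also have "\<dots> = 0" using mean J(2) by (intro sum.neutral) auto
  finally have mean': "(\<integral>\<omega>. (\<Sum>t\<in>J. a t * B t \<omega>) \<partial>M) = 0" .
  have "(\<integral>\<omega>. (\<Sum>t\<in>J. a t * B t \<omega>)\<^sup>2 \<partial>M) = (\<Sum>s\<in>J. \<Sum>t\<in>J. a s * a t * (\<integral>\<omega>. B s \<omega> * B t \<omega> \<partial>M))"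
    unfolding square_sum_expand using ii by (simp add: Bochner_Integration.integral_sum)
  also have "\<dots> = (\<Sum>s\<in>J. \<Sum>t\<in>J. a s * a t * R s t)"
    using cov J(2) by (intro sum.cong refl) (simp add: subset_iff)
  finally have v: "(\<integral>\<omega>. (\<Sum>t\<in>J. a t * B t \<omega>)\<^sup>2 \<partial>M) = (\<Sum>s\<in>J. \<Sum>t\<in>J. a s * a t * R s t)" .
  have mm: "(\<lambda>\<omega>. \<Sum>t\<in>J. a t * B t \<omega>) \<in> borel_measurable M"
    by (intro borel_measurable_sum borel_measurable_times borel_measurable_const m)
  show ?thesis
    using gaussian_law_centered(2)[OF M mm gl[OF J] mean'] unfolding v .
qed

section \<open>Uniqueness of the alternating correlated random walk\<close>

text \<open>The positions at times \<open>0\<close> to \<open>n - 1\<close>. Integer lists form a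
  countable type, so the law of a prefix is determined by its atoms and every set of lists is an
  event.\<close>

definition path_prefix :: "(nat \<Rightarrow> 'a \<Rightarrow> int) \<Rightarrow> nat \<Rightarrow> 'a \<Rightarrow> int list" where
  "path_prefix X n \<omega> = map (\<lambda>k. X k \<omega>) [0..<n]"

lemma length_path_prefix[simp]: "length (path_prefix X n \<omega>) = n"
  by (simp add: path_prefix_def)

lemma nth_path_prefix[simp]: "k < n \<Longrightarrow> path_prefix X n \<omega> ! k = X k \<omega>"
  by (simp add: path_prefix_def)

lemma path_prefix_eq_iff: "path_prefix X n \<omega> = l \<longleftrightarrow> length l = n \<and> (\<forall>k<n. X k \<omega> = l ! k)"
  by (auto simp: list_eq_iff_nth_eq)

lemma path_prefix_vimage_sets:
  assumes "\<And>k. k < n \<Longrightarrow> X k \<in> M \<rightarrow>\<^sub>M count_space UNIV"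
  shows "{\<omega>\<in>space M. path_prefix X n \<omega> = l} \<in> sets M"
proof (cases "length l = n")
  case True
  have "{\<omega>\<in>space M. \<forall>k\<in>{..<n}. X k \<omega> = l ! k} \<in> sets M"
  proof (rule sets.sets_Collect_finite_All)
    fix k assume "k \<in> {..<n}"
    then have [measurable]: "X k \<in> M \<rightarrow>\<^sub>M count_space UNIV" using assms by simp
    show "{\<omega>\<in>space M. X k \<omega> = l ! k} \<in> sets M" by measurable
  qed simp
  moreover have "{\<omega>\<in>space M. path_prefix X n \<omega> = l} = {\<omega>\<in>space M. \<forall>k\<in>{..<n}. X k \<omega> = l ! k}"
    using True by (auto simp: path_prefix_eq_iff)
  ultimately show ?thesis by (simp only:)
next
  case False
  then have "{\<omega>\<in>space M. path_prefix X n \<omega> = l} = {}" by (auto simp: path_prefix_eq_iff)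
  then show ?thesis by (simp only: sets.empty_sets)
qed

lemma measurable_path_prefix:
  assumes "\<And>k. k < n \<Longrightarrow> X k \<in> M \<rightarrow>\<^sub>M count_space UNIV"
  shows "path_prefix X n \<in> M \<rightarrow>\<^sub>M count_space UNIV"
proof -
  have "path_prefix X n -` {l} \<inter> space M \<in> sets M" for l
  proof -
    have "path_prefix X n -` {l} \<inter> space M = {\<omega>\<in>space M. path_prefix X n \<omega> = l}" by auto
    then show ?thesis using path_prefix_vimage_sets[of n X M l, OF assms] by (simp only:)
  qed
  then show ?thesis by (subst measurable_count_space_eq2_countable) simp_all
qed

section \<open>The history sigma-algebra and conditional probabilities\<close>

lemma walk_history_generators: "(\<Union>k\<le>m. sets (vimage_algebra (space M) (X k) N)) \<subseteq> Pow (space M)"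
proof (rule UN_least)
  show "sets (vimage_algebra (space M) (X k) N) \<subseteq> Pow (space M)" for k
    using sets.space_closed[of "vimage_algebra (space M) (X k) N"] by simp
qed

lemma sets_walk_history:
  "sets (walk_history M X m) = sigma_sets (space M) (\<Union>k\<le>m. sets (vimage_algebra (space M) (X k) (count_space UNIV)))"
  unfolding walk_history_def by (rule sets_measure_of[OF walk_history_generators])

lemma space_walk_history[simp]: "space (walk_history M X m) = space M"
  unfolding walk_history_def by (rule space_measure_of[OF walk_history_generators])

lemma measurable_walk_history:
  assumes "k \<le> m" shows "X k \<in> walk_history M X m \<rightarrow>\<^sub>M count_space UNIV"
proof (rule measurableI)
  fix A :: "int set"
  have "X k -` A \<inter> space M \<in> sets (vimage_algebra (space M) (X k) (count_space UNIV))"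
    by (rule in_vimage_algebra) simp
  then show "X k -` A \<inter> space (walk_history M X m) \<in> sets (walk_history M X m)"
    using assms by (auto simp: sets_walk_history)
qed simp

text \<open>Events of this shape contain the generators and are closed under complements and
  countable unions. This replaces the abstract sigma-algebra by sets of lists of length
  \<open>m + 1\<close>.\<close>

lemma walk_history_prefix:
  assumes "A \<in> sets (walk_history M X m)"
  shows "\<exists>L. A = {\<omega>\<in>space M. path_prefix X (Suc m) \<omega> \<in> L}"
  using assms unfolding sets_walk_history
proof (induction rule: sigma_sets.induct)
  case (Basic A)
  then obtain k where k: "k \<le> m" "A \<in> sets (vimage_algebra (space M) (X k) (count_space UNIV))" by auto
  then obtain B where "A = X k -` B \<inter> space M" by (auto simp: sets_vimage_algebra2)
  then show ?case using k by (intro exI[of _ "{l. l ! k \<in> B}"]) auto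
next
  case Empty
  show ?case by (intro exI[of _ "{}"]) auto
next
  case (Compl A)
  then obtain L where "A = {\<omega>\<in>space M. path_prefix X (Suc m) \<omega> \<in> L}" by blast
  then show ?case by (intro exI[of _ "- L"]) auto
next
  case (Union A)
  then have "\<forall>i. \<exists>L. A i = {\<omega>\<in>space M. path_prefix X (Suc m) \<omega> \<in> L}" by blast
  then obtain L where "\<And>i. A i = {\<omega>\<in>space M. path_prefix X (Suc m) \<omega> \<in> L i}" by metis
  then show ?case by (intro exI[of _ "\<Union>i. L i"]) auto
qed

lemma subalgebra_walk_history:
  assumes [measurable]: "\<And>n. X n \<in> M \<rightarrow>\<^sub>M count_space UNIV"
  shows "subalgebra M (walk_history M X m)"
proof -
  have "A \<in> sets M" if A: "A \<in> sets (walk_history M X m)" for A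
  proof -
    obtain L where L: "A = {\<omega>\<in>space M. path_prefix X (Suc m) \<omega> \<in> L}" using walk_history_prefix[OF A] by blast
    have [measurable]: "path_prefix X (Suc m) \<in> M \<rightarrow>\<^sub>M count_space UNIV"
      by (rule measurable_path_prefix) measurable
    show ?thesis unfolding L by measurable
  qed
  then show ?thesis by (auto simp: subalgebra_def)
qed

lemma measurable_walk_step[measurable]:
  assumes [measurable]: "\<And>n. X n \<in> M \<rightarrow>\<^sub>M count_space UNIV"
  shows "walk_step X n \<in> M \<rightarrow>\<^sub>M count_space UNIV"
  unfolding walk_step_def[abs_def] by measurable

text \<open>Both directions are the defining property of conditional expectation, tested on the
  events of the history. The form with events serves the uniqueness proof as well as the
  verification of the constructed walk.\<close>

lemma persistence_iff:
  assumes M: "prob_space M" and X[measurable]: "\<And>n. X n \<in> M \<rightarrow>\<^sub>M count_space UNIV"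
    and D[measurable]: "D \<in> sets M"
  shows "(AE \<omega> in M. real_cond_exp M (walk_history M X m) (indicator D) \<omega> = p) \<longleftrightarrow>
    (\<forall>A\<in>sets (walk_history M X m). measure M (A \<inter> D) = p * measure M A)"
proof -
  interpret prob_space M by fact
  let ?F = "walk_history M X m"
  have sub: "subalgebra M ?F" by (rule subalgebra_walk_history) measurable
  interpret finite_measure_subalgebra M ?F
    by standard (rule sub)
  have FM: "A \<in> sets M" if "A \<in> sets ?F" for A using sub that by (auto simp: subalgebra_def)
  have iD: "integrable M (indicator D :: _ \<Rightarrow> real)"
    by (rule integrable_real_indicator) (auto simp: emeasure_eq_measure)
  have l: "(LINT \<omega>:A|M. (indicator D \<omega> :: real)) = measure M (A \<inter> D)" if "A \<in> sets ?F" for A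
  proof -
    have [measurable]: "A \<in> sets M" using FM[OF that] .
    have "(LINT \<omega>:A|M. (indicator D \<omega> :: real)) = (\<integral>\<omega>. (indicator (A \<inter> D) \<omega> :: real) \<partial>M)"
      unfolding set_lebesgue_integral_def by (intro Bochner_Integration.integral_cong) (auto simp: indicator_def)
    moreover have "A \<inter> D \<inter> space M = A \<inter> D" using sets.sets_into_space[OF FM[OF that]] by blast
    ultimately show ?thesis by simp
  qed
  have r: "(LINT \<omega>:A|M. p) = p * measure M A" if "A \<in> sets ?F" for A
    using FM[OF that] sets.sets_into_space[OF FM[OF that]]
    unfolding set_lebesgue_integral_def by (simp add: Int_absorb2)
  show ?thesis
  proof (intro iffI ballI)
    fix A assume AE: "AE \<omega> in M. real_cond_exp M ?F (indicator D) \<omega> = p" and A: "A \<in> sets ?F"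
    have [measurable]: "A \<in> sets M" using FM[OF A] .
    have "measure M (A \<inter> D) = (LINT \<omega>:A|M. real_cond_exp M ?F (indicator D) \<omega>)"
      using real_cond_exp_intA[OF iD A] l[OF A] by simp
    also have "\<dots> = (LINT \<omega>:A|M. p)"
      unfolding set_lebesgue_integral_def using AE by (intro integral_cong_AE) auto
    finally show "measure M (A \<inter> D) = p * measure M A" using r[OF A] by simp
  next
    assume *: "\<forall>A\<in>sets ?F. measure M (A \<inter> D) = p * measure M A"
    have "AE \<omega> in M. real_cond_exp M ?F (indicator D) \<omega> = (\<lambda>_. p) \<omega>"
    proof (rule real_cond_exp_charact)
      show "(LINT \<omega>:A|M. (indicator D \<omega> :: real)) = (LINT \<omega>:A|M. p)" if "A \<in> sets ?F" for A
        using * l[OF that] r[OF that] that by simp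
    qed (use iD in simp_all)
    then show "AE \<omega> in M. real_cond_exp M ?F (indicator D) \<omega> = p" by simp
  qed
qed

text \<open>The one-step transition of the prefix probabilities; the odd steps from the third on are
  forced, and lead back to the position two steps before.\<close>

definition prefix_transition :: "real \<Rightarrow> int list \<Rightarrow> int \<Rightarrow> real \<Rightarrow> real" where
  "prefix_transition p l v r =
    (let n = length l in
     if n = 0 then of_bool (v = 0)
     else if n = 1 then of_bool (l ! 0 = 0 \<and> (v = 1 \<or> v = - 1)) / 2
     else if odd n then (if v = l ! (n - 2) then r else 0)
     else if v = 2 * l ! (n - 1) - l ! (n - 2) then p * r
     else if v = l ! (n - 2) then (1 - p) * r else 0)"

abbreviation prefix_event :: "'a measure \<Rightarrow> (nat \<Rightarrow> 'a \<Rightarrow> int) \<Rightarrow> int list \<Rightarrow> 'a set" where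
  "prefix_event M X l \<equiv> {\<omega>\<in>space M. path_prefix X (length l) \<omega> = l}"

lemma prefix_event_snoc:
  "prefix_event M X (l @ [v]) = {\<omega>\<in>space M. path_prefix X (length l) \<omega> = l \<and> X (length l) \<omega> = v}"
  by (auto simp: path_prefix_def)

text \<open>The length n of \<open>l\<close> is the time of the appended position. At an odd time
  from 3 on, the alternation rule returns the walk to its position at time n - 2. At an even time
  from 2 on, \<open>2 * l ! (n - 1) - l ! (n - 2)\<close> is reached by repeating the last step and
  \<open>l ! (n - 2)\<close> by reversing it.\<close>

lemma prefix_prob_snoc:
  assumes crw: "alternating_crw p M X"
  shows "measure M (prefix_event M X (l @ [v])) = prefix_transition p l v (measure M (prefix_event M X l))"
proof -
  interpret prob_space M using crw by (simp add: alternating_crw_def)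
  have X[measurable]: "\<And>n. X n \<in> M \<rightarrow>\<^sub>M count_space UNIV" using crw by (simp add: alternating_crw_def)
  have [measurable]: "path_prefix X n \<in> M \<rightarrow>\<^sub>M count_space UNIV" for n
    by (rule measurable_path_prefix) measurable
  have X0: "AE \<omega> in M. X 0 \<omega> = 0"
    and X1: "prob {\<omega>\<in>space M. X 1 \<omega> = 1} = 1 / 2" "prob {\<omega>\<in>space M. X 1 \<omega> = - 1} = 1 / 2"
    and st: "\<And>n. n \<ge> 1 \<Longrightarrow> AE \<omega> in M. walk_step X n \<omega> = 1 \<or> walk_step X n \<omega> = - 1"
    and alt: "\<And>n. n \<ge> 1 \<Longrightarrow> AE \<omega> in M. walk_step X (2 * n + 1) \<omega> = - walk_step X (2 * n) \<omega>"
    and pers: "\<And>n. n \<ge> 1 \<Longrightarrow> AE \<omega> in M. real_cond_exp M (walk_history M X (2 * n - 1))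
          (indicator {\<omega> \<in> space M. walk_step X (2 * n) \<omega> = walk_step X (2 * n - 1) \<omega>}) \<omega> = p"
    using crw by (auto simp: alternating_crw_def)
  let ?n = "length l"
  let ?C = "prefix_event M X l" and ?C' = "{\<omega>\<in>space M. path_prefix X ?n \<omega> = l \<and> X ?n \<omega> = v}"
  have [measurable]: "?C \<in> sets M" "?C' \<in> sets M" by measurable
  have "?n = 0 \<or> ?n = 1 \<or> odd ?n \<and> ?n \<ge> 3 \<or> even ?n \<and> ?n \<ge> 2" by presburger
  then consider "?n = 0" | "?n = 1" | "odd ?n" "?n \<ge> 3" | "even ?n" "?n \<ge> 2"
    by blast
  then have "measure M ?C' = prefix_transition p l v (measure M ?C)"
  proof cases
    case 1
    have "AE \<omega> in M. (\<omega> \<in> ?C') = (\<omega> \<in> (if v = 0 then space M else {}))"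
      using X0 AE_space[of M] by eventually_elim (use 1 in \<open>auto simp: path_prefix_eq_iff\<close>)
    then have "measure M ?C' = measure M (if v = 0 then space M else {})" by (intro finite_measure_eq_AE) auto
    then show ?thesis using 1 prob_space by (simp add: prefix_transition_def)
  next
    case 2
    have "AE \<omega> in M. (\<omega> \<in> ?C') = (\<omega> \<in> (if l ! 0 = 0 \<and> (v = 1 \<or> v = - 1) then {\<omega>\<in>space M. X 1 \<omega> = v} else {}))"
      using X0 AE_space[of M] st[OF order_refl] by eventually_elim (use 2 in \<open>auto simp: path_prefix_eq_iff walk_step_def\<close>)
    then have "measure M ?C' = measure M (if l ! 0 = 0 \<and> (v = 1 \<or> v = - 1) then {\<omega>\<in>space M. X 1 \<omega> = v} else {})"
      by (intro finite_measure_eq_AE) auto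
    then show ?thesis using 2 X1 by (auto simp: prefix_transition_def)
  next
    case 3
    obtain k where k1: "?n = 2 * k + 1" using 3(1) by (rule oddE)
    have k: "?n = 2 * k + 1" "k \<ge> 1" using k1 3(2) by simp_all
    have "AE \<omega> in M. (\<omega> \<in> ?C') = (\<omega> \<in> (if v = l ! (?n - 2) then ?C else {}))"
      using AE_space[of M] alt[OF k(2)]
    proof eventually_elim
      case (elim \<omega>)
      have e: "2 * k + 1 - 1 = 2 * k" "2 * k + 1 - 2 = 2 * k - 1" "?n - 2 < ?n" using k by auto
      have "X (2 * k + 1) \<omega> - X (2 * k) \<omega> = - (X (2 * k) \<omega> - X (2 * k - 1) \<omega>)"
        using elim(2) unfolding walk_step_def e(1) .
      then have eq: "X ?n \<omega> = X (?n - 2) \<omega>" unfolding k(1) e(2) by linarith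
      show ?case
      proof (cases "path_prefix X ?n \<omega> = l")
        case True
        then have "X (?n - 2) \<omega> = l ! (?n - 2)" using e(3) by (simp only: path_prefix_eq_iff)
        then show ?thesis using elim(1) True by (simp add: eq)
      qed simp
    qed
    then have "measure M ?C' = measure M (if v = l ! (?n - 2) then ?C else {})"
      by (intro finite_measure_eq_AE) auto
    moreover have "?n \<noteq> 0" "?n \<noteq> 1" using 3(2) by linarith+
    ultimately show ?thesis using 3(1) by (simp add: prefix_transition_def Let_def)
  next
    case 4
    obtain k where k0: "?n = 2 * k" using 4(1) by (rule evenE)
    have k: "?n = 2 * k" "k \<ge> 1" using k0 4(2) by simp_all
    let ?D = "{\<omega> \<in> space M. walk_step X (2 * k) \<omega> = walk_step X (2 * k - 1) \<omega>}"
    have [measurable]: "?D \<in> sets M" by measurable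
    \<comment> \<open>A prefix of length \<open>2 * k\<close> covers the times \<open>0\<close> to
      \<open>2 * k - 1\<close>, exactly the history on which the persistence condition is
      imposed.\<close>
    have "?C \<in> sets (walk_history M X (2 * k - 1))"
    proof -
      have "X j \<in> walk_history M X (2 * k - 1) \<rightarrow>\<^sub>M count_space UNIV" if "j < ?n" for j
        using that k(1) by (intro measurable_walk_history) linarith
      from path_prefix_vimage_sets[OF this] show ?thesis by simp
    qed
    moreover have k1: "1 \<le> 2 * k" and k2: "1 \<le> 2 * k - 1" using k(2) by auto
    ultimately have CD: "measure M (?C \<inter> ?D) = p * measure M ?C"
      using pers[OF k(2)] persistence_iff[OF prob_space_axioms X, where D = ?D and m = "2 * k - 1" and p = p] by simp
    have CD': "measure M (?C - ?D) = (1 - p) * measure M ?C"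
      using CD finite_measure_Diff'[of ?C ?D] by (simp add: algebra_simps)
    have "AE \<omega> in M. (\<omega> \<in> ?C') = (\<omega> \<in> (if v = 2 * l ! (?n - 1) - l ! (?n - 2) then ?C \<inter> ?D
        else if v = l ! (?n - 2) then ?C - ?D else {}))"
      using AE_space[of M] st[OF k1] st[OF k2]
    proof eventually_elim
      case (elim \<omega>)
      have n: "?n - 2 < ?n" "?n - 1 < ?n" "?n - 1 - 1 = ?n - 2" using k by auto
      show ?case
      proof (cases "path_prefix X ?n \<omega> = l")
        case True
        then have l: "X (?n - 1) \<omega> = l ! (?n - 1)" "X (?n - 2) \<omega> = l ! (?n - 2)"
          using n by (simp_all only: path_prefix_eq_iff)
        let ?a = "l ! (?n - 2)" and ?b = "l ! (?n - 1)" and ?c = "X ?n \<omega>"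
        have st: "?c - ?b = 1 \<or> ?c - ?b = - 1" "?b - ?a = 1 \<or> ?b - ?a = - 1"
          using elim(2,3) unfolding walk_step_def k(1)[symmetric] n(3) l .
        have C': "\<omega> \<in> ?C' \<longleftrightarrow> ?c = v" and C: "\<omega> \<in> ?C" using True elim(1) by simp_all
        have "\<omega> \<in> ?D \<longleftrightarrow> walk_step X (2 * k) \<omega> = walk_step X (2 * k - 1) \<omega>" using elim(1) by simp
        then have D: "\<omega> \<in> ?D \<longleftrightarrow> ?c - ?b = ?b - ?a"
          by (simp only: walk_step_def k(1)[symmetric] n(3) l)
        consider "v = 2 * ?b - ?a" | "v \<noteq> 2 * ?b - ?a" "v = ?a" | "v \<noteq> 2 * ?b - ?a" "v \<noteq> ?a" by blast
        then show ?thesis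
        proof cases
          case 1
          have "\<omega> \<in> ?C \<inter> ?D \<longleftrightarrow> ?c - ?b = ?b - ?a" using C D by blast
          then show ?thesis unfolding C' if_P[OF 1] using 1 by linarith
        next
          case 2
          have "\<omega> \<in> ?C - ?D \<longleftrightarrow> ?c - ?b \<noteq> ?b - ?a" using C D by blast
          then show ?thesis unfolding C' if_not_P[OF 2(1)] if_P[OF 2(2)] using 2 st by linarith
        next
          case 3
          then have "?c \<noteq> v" using st by linarith
          then show ?thesis unfolding C' if_not_P[OF 3(1)] if_not_P[OF 3(2)] by blast
        qed
      qed auto
    qed
    then have "measure M ?C' = measure M (if v = 2 * l ! (?n - 1) - l ! (?n - 2) then ?C \<inter> ?D
        else if v = l ! (?n - 2) then ?C - ?D else {})"
      by (intro finite_measure_eq_AE) auto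
    moreover have "?n \<noteq> 0" "?n \<noteq> 1" using 4(2) by linarith+
    ultimately show ?thesis using CD CD' 4(1) by (simp add: prefix_transition_def Let_def)
  qed
  then show ?thesis by (simp only: prefix_event_snoc)
qed

lemma prefix_prob_unique:
  assumes "alternating_crw p M X" "alternating_crw p M' X'"
  shows "measure M (prefix_event M X l) = measure M' (prefix_event M' X' l)"
proof (induction l rule: rev_induct)
  case Nil
  have "prob_space M" "prob_space M'" using assms by (auto simp: alternating_crw_def)
  then show ?case by (simp add: path_prefix_def prob_space.prob_space)
next
  case (snoc v l)
  show ?case unfolding prefix_prob_snoc[OF assms(1)] prefix_prob_snoc[OF assms(2)] snoc ..
qed

abbreviation path_space :: "(nat \<Rightarrow> int) measure" where
  "path_space \<equiv> (\<Pi>\<^sub>M n\<in>UNIV. count_space UNIV)"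

text \<open>A cylinder over a finite \<open>J\<close> below \<open>m\<close> is a set of prefixes of
  length \<open>m\<close>, and the laws of these prefixes agree because their atoms have the same
  recursion and the same start.\<close>

lemma alternating_crw_unique:
  assumes "sets \<nu> = sets path_space" "alternating_crw p \<nu> (\<lambda>n x. x n)"
    and "sets \<nu>' = sets path_space" "alternating_crw p \<nu>' (\<lambda>n x. x n)"
  shows "\<nu> = \<nu>'"
proof (rule measure_eqI_PiM_infinite[OF assms(1,3)])
  let ?X = "\<lambda>n (x::nat \<Rightarrow> int). x n"
  interpret prob_space \<nu> using assms(2) by (simp add: alternating_crw_def)
  interpret \<nu>': prob_space \<nu>' using assms(4) by (simp add: alternating_crw_def)
  show "finite_measure \<nu>" by (rule finite_measure_axioms)
  fix A :: "nat \<Rightarrow> int set" and J :: "nat set" assume J: "finite J" "J \<subseteq> UNIV"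
  obtain m where m: "J \<subseteq> {..<m}" using finite_nat_iff_bounded J by blast
  have sp: "space \<nu> = UNIV" "space \<nu>' = UNIV"
    using sets_eq_imp_space_eq[OF assms(1)] sets_eq_imp_space_eq[OF assms(3)] by (auto simp: space_PiM)
  have X[measurable]: "?X n \<in> \<nu> \<rightarrow>\<^sub>M count_space UNIV" "?X n \<in> \<nu>' \<rightarrow>\<^sub>M count_space UNIV" for n
    using assms(2,4) by (auto simp: alternating_crw_def)
  have pm[measurable]: "path_prefix ?X m \<in> \<nu> \<rightarrow>\<^sub>M count_space UNIV" "path_prefix ?X m \<in> \<nu>' \<rightarrow>\<^sub>M count_space UNIV"
    by (auto intro!: measurable_path_prefix)
  have eq: "distr \<nu> (count_space UNIV) (path_prefix ?X m) = distr \<nu>' (count_space UNIV) (path_prefix ?X m)"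
  proof (rule measure_eqI_countable[where A=UNIV])
    fix l :: "int list"
    show "emeasure (distr \<nu> (count_space UNIV) (path_prefix ?X m)) {l} =
      emeasure (distr \<nu>' (count_space UNIV) (path_prefix ?X m)) {l}"
    proof (cases "length l = m")
      case True
      then show ?thesis using prefix_prob_unique[OF assms(2,4), of l]
        by (simp add: emeasure_distr vimage_def sp emeasure_eq_measure \<nu>'.emeasure_eq_measure)
    next
      case False
      then have "path_prefix ?X m -` {l} = {}" by (auto simp: path_prefix_eq_iff)
      then show ?thesis by (simp add: emeasure_distr)
    qed
  qed auto
  let ?L = "{l. length l = m \<and> (\<forall>j\<in>J. l ! j \<in> A j)}"
  have "prod_emb UNIV (\<lambda>_. count_space UNIV) J (Pi\<^sub>E J A) = path_prefix ?X m -` ?L"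
  proof -
    have "path_prefix ?X m x ! j = x j" if "j \<in> J" for j x using m that by auto
    then show ?thesis by (auto simp: prod_emb_def PiE_iff space_PiM)
  qed
  moreover have "emeasure \<nu> (path_prefix ?X m -` ?L) = emeasure \<nu>' (path_prefix ?X m -` ?L)"
    using arg_cong[OF eq, of "\<lambda>N. emeasure N ?L"] by (simp add: emeasure_distr sp)
  ultimately show "emeasure \<nu> (prod_emb UNIV (\<lambda>_. count_space UNIV) J (Pi\<^sub>E J A)) =
      emeasure \<nu>' (prod_emb UNIV (\<lambda>_. count_space UNIV) J (Pi\<^sub>E J A))" by simp
qed

section \<open>A construction from uniform noise\<close>

definition unit_uniform :: "real measure" where
  "unit_uniform = uniform_measure lborel {0..1}"

definition noise :: "(nat \<Rightarrow> real) measure" where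
  "noise = (\<Pi>\<^sub>M n\<in>UNIV. unit_uniform)"

lemma sets_unit_uniform[simp, measurable_cong]: "sets unit_uniform = sets borel"
  by (simp add: unit_uniform_def)

lemma prob_space_unit_uniform: "prob_space unit_uniform"
  unfolding unit_uniform_def by (rule prob_space_uniform_measure) simp_all

lemma prob_unit_uniform:
  assumes "0 \<le> p" "p \<le> 1" shows "measure unit_uniform {..p} = p"
proof -
  have "{0..1} \<inter> {..p} = {0..p}" using assms by auto
  then show ?thesis
    unfolding unit_uniform_def using assms by (subst measure_uniform_measure) (simp_all add: measure_def)
qed

lemma sets_noise[measurable_cong]: "sets noise = sets seq_space"
  unfolding noise_def by (intro sets_PiM_cong) simp_all

lemma space_noise[simp]: "space noise = UNIV"
  using sets_eq_imp_space_eq[OF sets_noise] by (simp add: space_PiM)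

interpretation noise: product_prob_space "\<lambda>_. unit_uniform" UNIV
  by (rule product_prob_spaceI) (rule prob_space_unit_uniform)

lemma prob_space_noise: "prob_space noise"
  unfolding noise_def by (rule prob_space_PiM) (rule prob_space_unit_uniform)

interpretation N: prob_space noise by (rule prob_space_noise)

lemma measurable_noise_coord[measurable]: "(\<lambda>\<omega>. \<omega> k) \<in> borel_measurable noise"
proof -
  have "(\<lambda>\<omega>. \<omega> k) \<in> borel_measurable seq_space" by (rule measurable_component_singleton) simp
  then show ?thesis by (simp only: measurable_cong_sets[OF sets_noise refl])
qed

lemma distr_noise_coord: "distr noise borel (\<lambda>\<omega>. \<omega> k) = unit_uniform"
proof -
  have "distr noise borel (\<lambda>\<omega>. \<omega> k) = distr noise unit_uniform (\<lambda>\<omega>. \<omega> k)"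
    by (rule distr_cong) simp_all
  also have "\<dots> = unit_uniform" unfolding noise_def by (rule noise.PiM_component) simp
  finally show ?thesis .
qed

lemma indep_noise: "N.indep_vars (\<lambda>_. borel) (\<lambda>k \<omega>. \<omega> k) UNIV"
proof (subst N.indep_vars_iff_distr_eq_PiM')
  show "distr noise seq_space (\<lambda>x. \<lambda>i\<in>UNIV. x i) = (\<Pi>\<^sub>M i\<in>UNIV. distr noise borel (\<lambda>\<omega>. \<omega> i))"
    unfolding distr_noise_coord restrict_UNIV noise_def[symmetric]
    by (rule distr_id2) (rule sets_noise[symmetric])
qed simp_all

lemma prob_noise_coord:
  assumes "0 \<le> p" "p \<le> 1" shows "N.prob {\<omega>. \<omega> k \<le> p} = p"
proof -
  have "measure (distr noise borel (\<lambda>\<omega>. \<omega> k)) {..p} = N.prob {\<omega>. \<omega> k \<le> p}"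
    by (subst measure_distr) (simp_all add: vimage_def)
  then show ?thesis using prob_unit_uniform[OF assms] by (simp add: distr_noise_coord)
qed

text \<open>Coordinate \<open>0\<close> of the noise chooses the direction of the first step, coordinate \<open>k \<ge> 1\<close> decides
  whether the steps \<open>2k-1\<close> and \<open>2k\<close> agree.\<close>

definition walk_factor :: "real \<Rightarrow> (nat \<Rightarrow> real) \<Rightarrow> nat \<Rightarrow> int" where
  "walk_factor p \<omega> k = (if k = 0 then (if \<omega> 0 \<le> 1 / 2 then 1 else - 1) else (if \<omega> k \<le> p then - 1 else 1))"

text \<open>A closed form instead of a recursion: steps \<open>2 * k\<close> and
  \<open>2 * k + 1\<close> cancel, so the walk is back at its first position at every odd time, and
  an even time adds just the current step. Step \<open>2 * k\<close> is minus step
  \<open>2 * k - 1\<close> times factor \<open>k\<close>, which is why the value -1 of a factor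
  stands for agreement.\<close>

definition walk_path :: "real \<Rightarrow> nat \<Rightarrow> (nat \<Rightarrow> real) \<Rightarrow> int" where
  "walk_path p m \<omega> = (if odd m then walk_factor p \<omega> 0
     else walk_factor p \<omega> 0 * (1 - (\<Prod>k=1..m div 2. walk_factor p \<omega> k)))"

lemma walk_factor_cases: "walk_factor p \<omega> k = 1 \<or> walk_factor p \<omega> k = - 1"
  by (simp add: walk_factor_def)

lemma prod_walk_factor_cases: "(\<Prod>k\<in>K. walk_factor p \<omega> k) = 1 \<or> (\<Prod>k\<in>K. walk_factor p \<omega> k) = - 1"
proof (induction K rule: infinite_finite_induct)
  case (insert k K)
  then show ?case using walk_factor_cases[of p \<omega> k] by auto
qed simp_all

lemma walk_path_odd: "walk_path p (2 * n + 1) \<omega> = walk_factor p \<omega> 0"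
  by (simp add: walk_path_def)

lemma walk_path_even: "walk_path p (2 * n) \<omega> = walk_factor p \<omega> 0 * (1 - (\<Prod>k=1..n. walk_factor p \<omega> k))"
  by (simp add: walk_path_def)

lemma walk_step_path_odd:
  "walk_step (walk_path p) (2 * n + 1) \<omega> = walk_factor p \<omega> 0 * (\<Prod>k=1..n. walk_factor p \<omega> k)"
proof -
  have e: "2 * n + 1 - 1 = 2 * n" by simp
  show ?thesis unfolding walk_step_def e walk_path_odd walk_path_even by (simp add: algebra_simps)
qed

lemma walk_step_path_even:
  assumes "n \<ge> 1"
  shows "walk_step (walk_path p) (2 * n) \<omega> = - (walk_factor p \<omega> 0 * (\<Prod>k=1..n. walk_factor p \<omega> k))"
proof -
  have e: "2 * n - 1 = 2 * (n - 1) + 1" using assms by simp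
  show ?thesis unfolding walk_step_def e walk_path_odd walk_path_even by (simp add: algebra_simps)
qed

lemma walk_step_path_agree:
  assumes "n \<ge> 1"
  shows "walk_step (walk_path p) (2 * n) \<omega> = walk_step (walk_path p) (2 * n - 1) \<omega> \<longleftrightarrow> \<omega> n \<le> p"
proof -
  obtain m where n: "n = Suc m" using assms by (cases n) auto
  have e: "2 * n - 1 = 2 * m + 1" by (simp add: n)
  have s: "(\<Prod>k=1..n. walk_factor p \<omega> k) = (\<Prod>k=1..m. walk_factor p \<omega> k) * walk_factor p \<omega> n"
    by (simp add: n)
  have f: "walk_factor p \<omega> n = (if \<omega> n \<le> p then - 1 else 1)" by (simp add: walk_factor_def n)
  have "- (a * (b * (if c then - 1 else 1))) = a * b \<longleftrightarrow> c"
    if "a = 1 \<or> a = - 1" "b = 1 \<or> b = - 1" for a b :: int and c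
    using that by auto
  from this[OF walk_factor_cases prod_walk_factor_cases] show ?thesis
    unfolding e walk_step_path_odd walk_step_path_even[OF assms] s f .
qed

lemma measurable_walk_factor[measurable]: "(\<lambda>\<omega>. walk_factor p \<omega> k) \<in> noise \<rightarrow>\<^sub>M count_space UNIV"
  unfolding walk_factor_def by measurable

lemma measurable_prod_int:
  assumes "finite K" "\<And>k. k \<in> K \<Longrightarrow> (\<lambda>\<omega>. f k \<omega> :: int) \<in> M \<rightarrow>\<^sub>M count_space UNIV"
  shows "(\<lambda>\<omega>. \<Prod>k\<in>K. f k \<omega>) \<in> M \<rightarrow>\<^sub>M count_space UNIV"
  using assms
proof (induction K rule: finite_induct)
  case (insert k K)
  then have [measurable]: "(\<lambda>\<omega>. f k \<omega>) \<in> M \<rightarrow>\<^sub>M count_space UNIV" "(\<lambda>\<omega>. \<Prod>k\<in>K. f k \<omega>) \<in> M \<rightarrow>\<^sub>M count_space UNIV"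
    by simp_all
  show ?case using insert(1,2) by simp
qed simp

lemma measurable_walk_path[measurable]: "walk_path p m \<in> noise \<rightarrow>\<^sub>M count_space UNIV"
proof -
  have [measurable]: "(\<lambda>\<omega>. \<Prod>k=1..m div 2. walk_factor p \<omega> k) \<in> noise \<rightarrow>\<^sub>M count_space UNIV"
    by (rule measurable_prod_int) simp_all
  show ?thesis unfolding walk_path_def[abs_def] by measurable
qed

text \<open>Up to time \<open>2 * n - 1\<close> the walk reads the noise coordinates below
  \<open>n\<close> only; this separates the past from the coordinate deciding step
  \<open>2 * n\<close>.\<close>

lemma walk_path_restrict:
  assumes "m < 2 * n"
  shows "walk_path p m (\<lambda>i. if i < n then \<omega> i else 0) = walk_path p m \<omega>"
proof -
  have "walk_factor p (\<lambda>i. if i < n then \<omega> i else 0) k = walk_factor p \<omega> k" if "k < n" for k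
    using that by (simp add: walk_factor_def)
  moreover have "k < n" if "k \<in> {1..m div 2}" for k using that assms by auto
  ultimately have "(\<Prod>k=1..m div 2. walk_factor p (\<lambda>i. if i < n then \<omega> i else 0) k) = (\<Prod>k=1..m div 2. walk_factor p \<omega> k)"
    "walk_factor p (\<lambda>i. if i < n then \<omega> i else 0) 0 = walk_factor p \<omega> 0"
    using assms by (auto intro!: prod.cong)
  then show ?thesis unfolding walk_path_def by (simp only:)
qed

lemma noise_future_indep:
  assumes p: "0 \<le> p" "p \<le> 1"
  shows "N.prob ({\<omega>. path_prefix (walk_path p) (2 * n) \<omega> \<in> L} \<inter> {\<omega>. \<omega> n \<le> p}) =
    p * N.prob {\<omega>. path_prefix (walk_path p) (2 * n) \<omega> \<in> L}"
proof -
  let ?ext = "\<lambda>\<eta> i. if i < n then (\<eta> i :: real) else 0"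
  let ?A = "\<lambda>\<omega>. path_prefix (walk_path p) (2 * n) (?ext (restrict \<omega> {..<n}))"
  have ext: "path_prefix (walk_path p) (2 * n) (?ext (restrict \<omega> {..<n})) = path_prefix (walk_path p) (2 * n) \<omega>" for \<omega>
  proof -
    have "?ext (restrict \<omega> {..<n}) = ?ext \<omega>" by auto
    then show ?thesis using walk_path_restrict[of _ n p \<omega>] by (simp add: path_prefix_eq_iff)
  qed
  have "N.indep_var (\<Pi>\<^sub>M i\<in>{..<n}. borel) (\<lambda>\<omega>. restrict (\<lambda>i. \<omega> i) {..<n}) (\<Pi>\<^sub>M i\<in>{n}. borel) (\<lambda>\<omega>. restrict (\<lambda>i. \<omega> i) {n})"
    by (rule N.indep_var_restrict[OF indep_noise]) simp_all
  \<comment> \<open>Two variables in \<open>indep_var\<close> must share their value type, so the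
    decision at time \<open>n\<close> is wrapped into a list with one entry, next to the list of
    past positions.\<close>
  then have "N.indep_var (count_space UNIV) ((\<lambda>\<eta>. path_prefix (walk_path p) (2 * n) (?ext \<eta>)) \<circ> (\<lambda>\<omega>. restrict (\<lambda>i. \<omega> i) {..<n}))
      (count_space UNIV) ((\<lambda>\<eta>. [of_bool (\<eta> n \<le> p)]) \<circ> (\<lambda>\<omega>. restrict (\<lambda>i. \<omega> i) {n}))"
  proof (rule N.indep_var_compose)
    have "?ext \<in> (\<Pi>\<^sub>M i\<in>{..<n}. borel) \<rightarrow>\<^sub>M seq_space"
    proof (rule measurable_PiM_single')
      show "(\<lambda>\<eta>. ?ext \<eta> i) \<in> borel_measurable (\<Pi>\<^sub>M i\<in>{..<n}. borel)" for i
        by (cases "i < n") simp_all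
    qed (simp add: space_PiM)
    then have 1: "?ext \<in> (\<Pi>\<^sub>M i\<in>{..<n}. borel) \<rightarrow>\<^sub>M noise" by (simp only: measurable_cong_sets[OF refl sets_noise])
    have "path_prefix (walk_path p) (2 * n) \<in> noise \<rightarrow>\<^sub>M count_space UNIV"
      by (rule measurable_path_prefix) (rule measurable_walk_path)
    from measurable_compose[OF 1 this]
    show "(\<lambda>\<eta>. path_prefix (walk_path p) (2 * n) (?ext \<eta>)) \<in> (\<Pi>\<^sub>M i\<in>{..<n}. borel) \<rightarrow>\<^sub>M count_space UNIV" .
    have [measurable]: "(\<lambda>\<eta>. \<eta> n) \<in> borel_measurable (\<Pi>\<^sub>M i\<in>{n}. borel)" by (rule measurable_component_singleton) simp
    show "(\<lambda>\<eta>. [of_bool (\<eta> n \<le> p) :: int]) \<in> (\<Pi>\<^sub>M i\<in>{n}. borel) \<rightarrow>\<^sub>M count_space UNIV"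
      unfolding of_bool_def by measurable
  qed
  from N.indep_varD[OF this, of L "{[1]}"]
  have "N.prob ((\<lambda>\<omega>. (?A \<omega>, [of_bool (\<omega> n \<le> p) :: int])) -` (L \<times> {[1]})) =
      N.prob (?A -` L) * N.prob ((\<lambda>\<omega>. [of_bool (\<omega> n \<le> p) :: int]) -` {[1]})"
    by (simp add: comp_def)
  moreover have "(\<lambda>\<omega>. (?A \<omega>, [of_bool (\<omega> n \<le> p) :: int])) -` (L \<times> {[1]}) = {\<omega>. path_prefix (walk_path p) (2 * n) \<omega> \<in> L} \<inter> {\<omega>. \<omega> n \<le> p}"
    unfolding ext by auto
  moreover have "?A -` L = {\<omega>. path_prefix (walk_path p) (2 * n) \<omega> \<in> L}" unfolding ext vimage_def ..
  moreover have "(\<lambda>\<omega>. [of_bool (\<omega> n \<le> p) :: int]) -` {[1]} = {\<omega>::nat \<Rightarrow> real. \<omega> n \<le> p}" by auto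
  ultimately show ?thesis using prob_noise_coord[OF p, of n] by (simp only: mult.commute)
qed

section \<open>The law of the constructed walk\<close>

definition walk_law :: "real \<Rightarrow> (nat \<Rightarrow> int) measure" where
  "walk_law p = distr noise path_space (\<lambda>\<omega> n. walk_path p n \<omega>)"

lemma measurable_walk_path_seq[measurable]: "(\<lambda>\<omega> n. walk_path p n \<omega>) \<in> noise \<rightarrow>\<^sub>M path_space"
  by (rule measurable_PiM_single') (simp_all add: space_PiM)

lemma space_walk_law[simp]: "space (walk_law p) = UNIV"
  by (simp add: walk_law_def space_PiM)

lemma AE_walk_law: "(\<And>\<omega>. P (\<lambda>n. walk_path p n \<omega>)) \<Longrightarrow> {x. P x} \<in> sets path_space \<Longrightarrow> AE x in walk_law p. P x"
  unfolding walk_law_def by (subst AE_distr_iff) (simp_all add: space_PiM)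

lemma measure_walk_law:
  "A \<in> sets path_space \<Longrightarrow> measure (walk_law p) A = N.prob {\<omega>. (\<lambda>n. walk_path p n \<omega>) \<in> A}"
  unfolding walk_law_def by (subst measure_distr) (simp_all add: vimage_def)

lemma alternating_crw_walk_law:
  assumes p: "0 \<le> p" "p \<le> 1"
  shows "alternating_crw p (walk_law p) (\<lambda>n x. x n)"
proof -
  let ?X = "\<lambda>n (x :: nat \<Rightarrow> int). x n"
  have sets: "sets (walk_law p) = sets path_space" by (simp add: walk_law_def)
  have prob: "prob_space (walk_law p)" unfolding walk_law_def by (rule N.prob_space_distr) simp
  have X: "?X n \<in> path_space \<rightarrow>\<^sub>M count_space UNIV" for n by (rule measurable_component_singleton) simp
  note [measurable] = X
  have WS[measurable]: "walk_step ?X n \<in> path_space \<rightarrow>\<^sub>M count_space UNIV" for n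
    by (rule measurable_walk_step) (rule X)
  have X': "?X n \<in> walk_law p \<rightarrow>\<^sub>M count_space UNIV" for n
    unfolding measurable_cong_sets[OF sets refl] by (rule X)
  have ms: "{x. P x} \<in> sets path_space" if "{x \<in> space path_space. P x} \<in> sets path_space" for P
    using that by (simp add: space_PiM)
  have st: "walk_step ?X n (\<lambda>n. walk_path p n \<omega>) = walk_step (walk_path p) n \<omega>" for n \<omega>
    by (simp add: walk_step_def)
  have half: "N.prob {\<omega>. \<omega> 0 \<le> 1 / 2} = 1 / 2" by (rule prob_noise_coord) simp_all
  have half': "N.prob {\<omega>. \<not> \<omega> 0 \<le> 1 / 2} = 1 / 2"
  proof -
    have m: "{\<omega>. \<omega> 0 \<le> (1/2::real)} \<in> N.events"
      using measurable_sets[OF measurable_noise_coord, of "{..1/2}" 0] by (simp add: vimage_def)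
    have "{\<omega>. \<not> \<omega> 0 \<le> (1/2::real)} = space noise - {\<omega>. \<omega> 0 \<le> 1 / 2}" by auto
    then show ?thesis using N.prob_compl[OF m] half by simp
  qed
  show ?thesis
    unfolding alternating_crw_def
  proof (intro conjI allI impI)
    show "prob_space (walk_law p)" by (rule prob)
    show "?X n \<in> walk_law p \<rightarrow>\<^sub>M count_space UNIV" for n by (rule X')
    show "AE x in walk_law p. x 0 = 0"
      by (rule AE_walk_law) (simp add: walk_path_def, rule ms, measurable)
    have one: "walk_path p 1 \<omega> = (if \<omega> 0 \<le> 1 / 2 then 1 else - 1)" for \<omega>
      by (simp add: walk_path_def walk_factor_def)
    have 1: "{x. x 1 = v} \<in> sets path_space" for v by (rule ms) measurable
    have "{\<omega>. \<omega> 0 \<le> 1/2} = {\<omega>. walk_path p 1 \<omega> = 1}" "{\<omega>. \<not> \<omega> 0 \<le> 1/2} = {\<omega>. walk_path p 1 \<omega> = - 1}"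
      unfolding one by auto
    then show "measure (walk_law p) {x \<in> space (walk_law p). x 1 = 1} = 1 / 2"
      "measure (walk_law p) {x \<in> space (walk_law p). x 1 = - 1} = 1 / 2"
      using half half' by (simp_all add: measure_walk_law[OF 1[unfolded One_nat_def]])
    show "AE x in walk_law p. walk_step ?X n x = 1 \<or> walk_step ?X n x = - 1" if "n \<ge> 1" for n
    proof (rule AE_walk_law)
      fix \<omega>
      note c = walk_factor_cases[of p \<omega> 0] prod_walk_factor_cases[of p \<omega> "{1..n div 2}"]
      have "walk_step (walk_path p) n \<omega> = 1 \<or> walk_step (walk_path p) n \<omega> = - 1"
      proof (cases "even n")
        case True
        then have n: "n = 2 * (n div 2)" "n div 2 \<ge> 1" using that by auto
        show ?thesis using walk_step_path_even[OF n(2), of p \<omega>] c unfolding n(1)[symmetric] by auto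
      next
        case False
        then have n: "n = 2 * (n div 2) + 1" by presburger
        show ?thesis using walk_step_path_odd[of p "n div 2" \<omega>] c unfolding n[symmetric] by auto
      qed
      then show "walk_step ?X n (\<lambda>n. walk_path p n \<omega>) = 1 \<or> walk_step ?X n (\<lambda>n. walk_path p n \<omega>) = - 1"
        unfolding st .
    qed (rule ms, measurable)
    show "AE x in walk_law p. walk_step ?X (2 * n + 1) x = - walk_step ?X (2 * n) x" if "n \<ge> 1" for n
    proof (rule AE_walk_law)
      fix \<omega>
      show "walk_step ?X (2 * n + 1) (\<lambda>n. walk_path p n \<omega>) = - walk_step ?X (2 * n) (\<lambda>n. walk_path p n \<omega>)"
        unfolding st walk_step_path_odd walk_step_path_even[OF that] by simp
    qed (rule ms, measurable)
    fix n :: nat assume n: "n \<ge> 1"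
    let ?D = "{x \<in> space (walk_law p). walk_step ?X (2 * n) x = walk_step ?X (2 * n - 1) x}"
    have D: "?D \<in> sets path_space" by (simp only: UNIV_I simp_thms space_walk_law) (rule ms, measurable)
    show "AE x in walk_law p. real_cond_exp (walk_law p) (walk_history (walk_law p) ?X (2 * n - 1)) (indicator ?D) x = p"
      unfolding persistence_iff[OF prob X' D[folded sets]]
    proof
      fix A assume A: "A \<in> sets (walk_history (walk_law p) ?X (2 * n - 1))"
      have e: "Suc (2 * n - 1) = 2 * n" using n by simp
      obtain L where L: "A = {x. path_prefix ?X (2 * n) x \<in> L}"
        using walk_history_prefix[OF A] unfolding e by auto
      have As: "A \<in> sets path_space"
        using A subalgebra_walk_history[of ?X "walk_law p" "2 * n - 1", OF X'] sets by (auto simp: subalgebra_def)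
      have pp: "path_prefix ?X (2 * n) (\<lambda>n. walk_path p n \<omega>) = path_prefix (walk_path p) (2 * n) \<omega>" for \<omega>
        by (simp add: path_prefix_def)
      have 1: "measure (walk_law p) A = N.prob {\<omega>. path_prefix (walk_path p) (2 * n) \<omega> \<in> L}"
        unfolding measure_walk_law[OF As] by (simp add: L pp)
      have "{\<omega>. (\<lambda>n. walk_path p n \<omega>) \<in> A \<inter> ?D} =
          {\<omega>. path_prefix (walk_path p) (2 * n) \<omega> \<in> L} \<inter> {\<omega>. \<omega> n \<le> p}"
        unfolding L Int_iff mem_Collect_eq pp st walk_step_path_agree[OF n] by auto
      then have "measure (walk_law p) (A \<inter> ?D) =
          N.prob ({\<omega>. path_prefix (walk_path p) (2 * n) \<omega> \<in> L} \<inter> {\<omega>. \<omega> n \<le> p})"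
        using measure_walk_law[OF sets.Int[OF As D]] by (simp only:)
      then show "measure (walk_law p) (A \<inter> ?D) = p * measure (walk_law p) A"
        unfolding 1 noise_future_indep[OF p] .
    qed
  qed
qed

text \<open>Existence by construction and uniqueness by prefixes give the definite description its
  meaning; from here on all computations take place on the noise.\<close>

lemma crw_law_eq:
  assumes "0 \<le> p" "p \<le> 1" shows "crw_law p = walk_law p"
  unfolding crw_law_def
proof (rule the_equality)
  have s: "sets (walk_law p) = sets path_space" by (simp add: walk_law_def)
  then show "sets (walk_law p) = sets path_space \<and> alternating_crw p (walk_law p) (\<lambda>n x. x n)"
    using alternating_crw_walk_law[OF assms] by blast
  show "\<nu> = walk_law p" if "sets \<nu> = sets path_space \<and> alternating_crw p \<nu> (\<lambda>n x. x n)" for \<nu>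
    using that s alternating_crw_walk_law[OF assms] by (intro alternating_crw_unique) blast+
qed

definition Y_path :: "real \<Rightarrow> (nat \<Rightarrow> real) \<Rightarrow> nat \<Rightarrow> real" where
  "Y_path p \<omega> n = real_of_int (walk_path p (2 * n) \<omega>) / (2 * sqrt p)"

lemma Q_law_eq:
  assumes "0 \<le> p" "p \<le> 1" shows "Q_law p = distr noise seq_space (Y_path p)"
proof -
  have [measurable]: "(\<lambda>x::nat \<Rightarrow> int. x n) \<in> path_space \<rightarrow>\<^sub>M count_space UNIV" for n
    by (rule measurable_component_singleton) simp
  have "(\<lambda>x n. real_of_int (x (2 * n)) / (2 * sqrt p)) \<in> path_space \<rightarrow>\<^sub>M seq_space"
    by (rule measurable_PiM_single') (simp_all add: space_PiM)
  then show ?thesis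
    unfolding Q_law_def crw_law_eq[OF assms] walk_law_def
    by (subst distr_distr) (simp_all add: comp_def Y_path_def[abs_def])
qed

section \<open>Covariance and conditional moments of the mixed walk\<close>

lemma integral_walk_factor:
  assumes p: "0 \<le> p" "p \<le> 1"
  shows "integrable noise (\<lambda>\<omega>. real_of_int (walk_factor p \<omega> k))"
    and "(\<integral>\<omega>. real_of_int (walk_factor p \<omega> k) \<partial>noise) = (if k = 0 then 0 else 1 - 2 * p)"
proof -
  have I: "integrable noise (\<lambda>\<omega>. indicator {\<omega>. \<omega> k \<le> c} \<omega> :: real)"
    and E: "(\<integral>\<omega>. indicator {\<omega>. \<omega> k \<le> c} \<omega> \<partial>noise) = c" if c: "0 \<le> c" "c \<le> 1" for c
  proof -
    have m: "{\<omega>. \<omega> k \<le> c} \<in> N.events"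
      using measurable_sets[OF measurable_noise_coord, of "{..c}" k] by (simp add: vimage_def)
    show "integrable noise (\<lambda>\<omega>. indicator {\<omega>. \<omega> k \<le> c} \<omega> :: real)"
      using m by (intro integrable_real_indicator) (simp_all add: N.emeasure_eq_measure)
    show "(\<integral>\<omega>. indicator {\<omega>. \<omega> k \<le> c} \<omega> \<partial>noise) = c"
      using prob_noise_coord[OF c, of k] by simp
  qed
  have eq: "real_of_int (walk_factor p \<omega> k) = (if k = 0 then - 1 + 2 * indicator {\<omega>. \<omega> k \<le> 1 / 2} \<omega>
      else 1 - 2 * indicator {\<omega>. \<omega> k \<le> p} \<omega>)" for \<omega>
    by (simp add: walk_factor_def indicator_def)
  have half: "(0::real) \<le> 1 / 2" "(1::real) / 2 \<le> 1" by simp_all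
  show "integrable noise (\<lambda>\<omega>. real_of_int (walk_factor p \<omega> k))"
    unfolding eq using I[OF p] I[OF half] by (cases "k = 0") (simp_all del: integrable_indicator_iff)
  show "(\<integral>\<omega>. real_of_int (walk_factor p \<omega> k) \<partial>noise) = (if k = 0 then 0 else 1 - 2 * p)"
  proof (cases "k = 0")
    case True
    have "(\<integral>\<omega>. - 1 + 2 * indicator {\<omega>. \<omega> k \<le> 1 / 2} \<omega> \<partial>noise) = - 1 + 2 * (1 / 2 :: real)"
      using I[OF half] E[OF half] N.prob_space
      by (subst Bochner_Integration.integral_add) (simp_all del: integrable_indicator_iff Bochner_Integration.integral_indicator integral_indicator)
    then show ?thesis using True unfolding eq by simp
  next
    case False
    have "(\<integral>\<omega>. 1 - 2 * indicator {\<omega>. \<omega> k \<le> p} \<omega> \<partial>noise) = 1 - 2 * p"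
      using I[OF p] E[OF p] N.prob_space
      by (subst Bochner_Integration.integral_diff) (simp_all del: integrable_indicator_iff Bochner_Integration.integral_indicator integral_indicator)
    then show ?thesis using False unfolding eq by simp
  qed
qed

lemma integral_prod_walk_factor:
  assumes p: "0 \<le> p" "p \<le> 1" and K: "finite K"
  shows "integrable noise (\<lambda>\<omega>. \<Prod>k\<in>K. real_of_int (walk_factor p \<omega> k))"
    and "(\<integral>\<omega>. (\<Prod>k\<in>K. real_of_int (walk_factor p \<omega> k)) \<partial>noise) = (\<Prod>k\<in>K. if k = 0 then 0 else 1 - 2 * p)"
proof -
  define f where "f k x = (if k = 0 then (if x \<le> 1 / 2 then 1 else - 1) else (if x \<le> p then - 1 else 1 :: real))"
    for k :: nat and x :: real
  have f: "real_of_int (walk_factor p \<omega> k) = f k (\<omega> k)" for \<omega> k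
    by (simp add: walk_factor_def f_def)
  have "N.indep_vars (\<lambda>_. borel) (\<lambda>k \<omega>. f k (\<omega> k)) UNIV"
  proof (rule N.indep_vars_compose2[OF indep_noise])
    show "f k \<in> borel_measurable borel" for k unfolding f_def[abs_def] by measurable
  qed
  then have ind: "N.indep_vars (\<lambda>_. borel) (\<lambda>k \<omega>. real_of_int (walk_factor p \<omega> k)) K"
    unfolding f by (rule N.indep_vars_subset) simp
  show "integrable noise (\<lambda>\<omega>. \<Prod>k\<in>K. real_of_int (walk_factor p \<omega> k))"
    by (rule N.indep_vars_integrable[OF K ind integral_walk_factor(1)[OF p]])
  show "(\<integral>\<omega>. (\<Prod>k\<in>K. real_of_int (walk_factor p \<omega> k)) \<partial>noise) = (\<Prod>k\<in>K. if k = 0 then 0 else 1 - 2 * p)"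
    unfolding N.indep_vars_lebesgue_integral[OF K ind integral_walk_factor(1)[OF p]] integral_walk_factor(2)[OF p] ..
qed

lemma Y_path_eq:
  "Y_path p \<omega> n = real_of_int (walk_factor p \<omega> 0) * (1 - (\<Prod>k=1..n. real_of_int (walk_factor p \<omega> k))) / (2 * sqrt p)"
  by (simp add: Y_path_def walk_path_even)

text \<open>For \<open>0 < p \<le> 1\<close> this is the second moment of an increment of length
  \<open>n\<close> of the rescaled walk. The sum is kept, rather than the quotient, so that
  integration over \<open>p\<close> goes term by term.\<close>

definition persistence_sum :: "real \<Rightarrow> nat \<Rightarrow> real" where
  "persistence_sum p n = (\<Sum>k<n. (1 - 2 * p) ^ k)"

lemma persistence_sum_eq: "p \<noteq> 0 \<Longrightarrow> persistence_sum p n = (1 - (1 - 2 * p) ^ n) / (2 * p)"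
  unfolding persistence_sum_def by (simp add: sum_gp_strict)

text \<open>Up to the scaling the path is a difference of two products of independent signs, both
  containing the symmetric factor 0.\<close>

lemma integral_Y_path:
  assumes p: "0 < p" "p \<le> 1"
  shows "(\<integral>\<omega>. Y_path p \<omega> n \<partial>noise) = 0"
proof -
  let ?r = "\<lambda>\<omega> k. real_of_int (walk_factor p \<omega> k)"
  have p': "0 \<le> p" using p by simp
  note P = integral_prod_walk_factor[OF p' p(2)]
  have "(\<lambda>\<omega>. Y_path p \<omega> n) = (\<lambda>\<omega>. ((\<Prod>k\<in>{0}. ?r \<omega> k) - (\<Prod>k\<in>{0..n}. ?r \<omega> k)) / (2 * sqrt p))"
  proof
    fix \<omega>
    have "(\<Prod>k\<in>{0..n}. ?r \<omega> k) = ?r \<omega> 0 * (\<Prod>k=1..n. ?r \<omega> k)"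
      by (subst prod.atLeast_Suc_atMost) simp_all
    then show "Y_path p \<omega> n = ((\<Prod>k\<in>{0}. ?r \<omega> k) - (\<Prod>k\<in>{0..n}. ?r \<omega> k)) / (2 * sqrt p)"
      by (simp add: Y_path_eq algebra_simps)
  qed
  moreover have "(\<integral>\<omega>. (\<Prod>k\<in>{0}. ?r \<omega> k) - (\<Prod>k\<in>{0..n}. ?r \<omega> k) \<partial>noise) = 0"
  proof -
    have "(\<Prod>k\<in>{0..n}. if k = 0 then 0 else 1 - 2 * p) = 0" by (rule prod_zero) auto
    moreover have "(\<Prod>k\<in>{0::nat}. if k = 0 then 0 else 1 - 2 * p) = 0" by simp
    ultimately show ?thesis
      using P[of "{0}"] P[of "{0..n}"] by (subst Bochner_Integration.integral_diff) (simp_all only: finite.intros finite_atLeastAtMost diff_self)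
  qed
  ultimately show ?thesis by (simp only: integral_divide_zero div_0)
qed

text \<open>Squares of signs are 1: in the product of two positions the factor 0 disappears and the
  common factors up to \<open>m\<close> cancel, leaving the product over the indices from
  \<open>m + 1\<close> to \<open>n\<close>. Independence gives powers of \<open>1 - 2 * p\<close>,
  and regrouping them into geometric sums shows the covariance of a process with stationary
  increments.\<close>

lemma integral_Y_path_mult:
  assumes p: "0 < p" "p \<le> 1" and nm: "m \<le> n"
  shows "integrable noise (\<lambda>\<omega>. Y_path p \<omega> n * Y_path p \<omega> m)" 
    "(\<integral>\<omega>. Y_path p \<omega> n * Y_path p \<omega> m \<partial>noise) =
      (persistence_sum p n + persistence_sum p m - persistence_sum p (n - m)) / 2"
proof -
  let ?r = "\<lambda>\<omega> k. real_of_int (walk_factor p \<omega> k)"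
  let ?P = "\<lambda>K \<omega>. \<Prod>k\<in>K. ?r \<omega> k"
  have p': "0 \<le> p" using p by simp
  have P1: "integrable noise (?P {a..b})" 
    and P2: "(\<integral>\<omega>. ?P {a..b} \<omega> \<partial>noise) = (1 - 2 * p) ^ (Suc b - a)" if "1 \<le> a" for a b :: nat
  proof -
    show "integrable noise (?P {a..b})" by (rule integral_prod_walk_factor(1)[OF p' p(2)]) simp
    have "(\<Prod>k\<in>{a..b}. if k = 0 then 0 else 1 - 2 * p) = (\<Prod>k\<in>{a..b}. 1 - 2 * p)"
      using that by (intro prod.cong) auto
    then show "(\<integral>\<omega>. ?P {a..b} \<omega> \<partial>noise) = (1 - 2 * p) ^ (Suc b - a)"
      using integral_prod_walk_factor(2)[OF p' p(2), of "{a..b}"] by simp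
  qed
  have sq: "(?P K \<omega>)\<^sup>2 = 1" for K \<omega>
  proof -
    have "(real_of_int z)\<^sup>2 = 1" if "z = 1 \<or> z = - 1" for z using that by auto
    from this[OF prod_walk_factor_cases[of p \<omega> K]] show ?thesis by (simp only: of_int_prod)
  qed
  have Pnm: "?P {1..n} \<omega> * ?P {1..m} \<omega> = ?P {Suc m..n} \<omega>" for \<omega>
  proof -
    have "?P {1..n} \<omega> = ?P {1..m} \<omega> * ?P {Suc m..n} \<omega>"
    proof -
      have "{1..n} = {1..m} \<union> {Suc m..n}" using nm by auto
      then have "?P {1..n} \<omega> = ?P ({1..m} \<union> {Suc m..n}) \<omega>" by (simp only:)
      also have "\<dots> = ?P {1..m} \<omega> * ?P {Suc m..n} \<omega>" by (rule prod.union_disjoint) auto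
      finally show ?thesis .
    qed
    then have "?P {1..n} \<omega> * ?P {1..m} \<omega> = (?P {1..m} \<omega>)\<^sup>2 * ?P {Suc m..n} \<omega>" by (simp only: power2_eq_square ac_simps)
    then show ?thesis by (simp only: sq mult_1)
  qed
  have Y: "Y_path p \<omega> n * Y_path p \<omega> m = (1 - ?P {1..n} \<omega> - ?P {1..m} \<omega> + ?P {Suc m..n} \<omega>) / (4 * p)" for \<omega>
  proof -
    have r0: "?r \<omega> 0 * ?r \<omega> 0 = 1" using walk_factor_cases[of p \<omega> 0] by auto
    have "(a * (1 - b) / (2 * s)) * (a * (1 - c) / (2 * s)) = (a * a) * (1 - b - c + b * c) / (4 * (s * s))" for a b c s :: real
      by (simp add: algebra_simps)
    from this[of "?r \<omega> 0" "?P {1..n} \<omega>" "sqrt p" "?P {1..m} \<omega>"] show ?thesis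
      unfolding Y_path_eq r0 Pnm mult_1 using p by (simp only: real_sqrt_mult_self abs_of_pos)
  qed
  note one = P1[of 1 n] P1[of 1 m] P1[of "Suc m" n]
  show "integrable noise (\<lambda>\<omega>. Y_path p \<omega> n * Y_path p \<omega> m)"
    unfolding Y using one by simp
  have "(\<integral>\<omega>. Y_path p \<omega> n * Y_path p \<omega> m \<partial>noise) =
      (1 - (1 - 2 * p) ^ n - (1 - 2 * p) ^ m + (1 - 2 * p) ^ (n - m)) / (4 * p)"
    unfolding Y using one P2[of 1 n] P2[of 1 m] P2[of "Suc m" n] N.prob_space by simp
  also have "\<dots> = (persistence_sum p n + persistence_sum p m - persistence_sum p (n - m)) / 2"
  proof -
    have "(1 - a - b + c) / (4 * p) = ((1 - a) / (2 * p) + (1 - b) / (2 * p) - (1 - c) / (2 * p)) / 2" for a b c :: real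
      by (simp add: add_divide_distrib[symmetric] diff_divide_distrib[symmetric])
    moreover have "p \<noteq> 0" using p by simp
    ultimately show ?thesis unfolding persistence_sum_eq[OF \<open>p \<noteq> 0\<close>] by blast
  qed
  finally show "(\<integral>\<omega>. Y_path p \<omega> n * Y_path p \<omega> m \<partial>noise) =
      (persistence_sum p n + persistence_sum p m - persistence_sum p (n - m)) / 2" .
qed

section \<open>Mixing over the persistence\<close>

lemma measurable_fst_mu_H: "fst \<in> borel_measurable (mu_H H \<Otimes>\<^sub>M noise)"
proof -
  have "(\<lambda>p. p) \<in> borel_measurable (mu_H H)" by (rule borel_measurable_mu_H) simp
  moreover have "fst \<in> mu_H H \<Otimes>\<^sub>M noise \<rightarrow>\<^sub>M mu_H H" by (rule measurable_fst)
  ultimately show ?thesis by (rule measurable_compose[rotated])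
qed

lemma measurable_snd_noise: "(\<lambda>x. snd x k) \<in> borel_measurable (mu_H H \<Otimes>\<^sub>M noise)"
  by (rule measurable_compose[OF measurable_snd measurable_noise_coord])

lemma measurable_Y_path_pair:
  "(\<lambda>x. Y_path (fst x) (snd x) n) \<in> borel_measurable (mu_H H \<Otimes>\<^sub>M noise)"
proof -
  note [measurable] = measurable_fst_mu_H measurable_snd_noise
  have [measurable]: "(\<lambda>x. real_of_int (walk_factor (fst x) (snd x) k)) \<in> borel_measurable (mu_H H \<Otimes>\<^sub>M noise)" for k
  proof -
    have "(\<lambda>x. if k = 0 then (if snd x 0 \<le> 1 / 2 then 1 else - 1) else (if snd x k \<le> fst x then - 1 else 1 :: real))
        \<in> borel_measurable (mu_H H \<Otimes>\<^sub>M noise)"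
      by measurable
    moreover have "real_of_int (walk_factor (fst x) (snd x) k) =
        (if k = 0 then (if snd x 0 \<le> 1 / 2 then 1 else - 1) else (if snd x k \<le> fst x then - 1 else 1))" for x :: "real \<times> (nat \<Rightarrow> real)"
      by (simp add: walk_factor_def)
    ultimately show ?thesis by (simp only:)
  qed
  show ?thesis unfolding Y_path_eq
    by (intro borel_measurable_divide borel_measurable_times borel_measurable_diff borel_measurable_const
        borel_measurable_prod) measurable
qed

lemma measurable_Y_path_seq: "case_prod Y_path \<in> mu_H H \<Otimes>\<^sub>M noise \<rightarrow>\<^sub>M seq_space"
proof (rule measurable_PiM_single')
  show "(\<lambda>x. (case x of (p, \<omega>) \<Rightarrow> Y_path p \<omega>) n) \<in> borel_measurable (mu_H H \<Otimes>\<^sub>M noise)" for n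
    unfolding case_prod_beta' by (rule measurable_Y_path_pair)
qed (simp add: space_PiM)

lemma borel_measurable_noise_integral:
  assumes "g \<in> borel_measurable (mu_H H \<Otimes>\<^sub>M noise)"
  shows "(\<lambda>p. \<integral>\<omega>. (g (p, \<omega>) :: real) \<partial>noise) \<in> borel_measurable (mu_H H)"
proof (rule N.borel_measurable_lebesgue_integral)
  show "case_prod (\<lambda>p \<omega>. g (p, \<omega>)) \<in> borel_measurable (mu_H H \<Otimes>\<^sub>M noise)"
    unfolding case_prod_eta by (rule assms)
qed

context
  fixes H :: real
  assumes H: "0 < H" "H < 1 / 2"
begin

interpretation mu: prob_space "mu_H H" by (rule prob_space_mu_H[OF H])
interpretation J: pair_prob_space "mu_H H" noise ..

text \<open>All \<open>p\<close> share the same noise, so drawing \<open>p\<close> and then the walk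
  amounts to applying one measurable map to a pair of independent variables; moments of the mixture
  become iterated integrals.\<close>

lemma Q_mix_eq: "Q_mix (mu_H H) = distr (mu_H H \<Otimes>\<^sub>M noise) seq_space (case_prod Y_path)"
proof -
  have meas: "(\<lambda>p. distr noise seq_space (Y_path p)) \<in> mu_H H \<rightarrow>\<^sub>M subprob_algebra seq_space"
    by (rule measurable_distr2[OF measurable_Y_path_seq])
      (simp add: space_subprob_algebra N.subprob_space_axioms)
  have "Q_mix (mu_H H) = mu_H H \<bind> (\<lambda>p. distr noise seq_space (Y_path p))"
    unfolding Q_mix_def by (rule bind_cong[OF refl]) (simp add: Q_law_eq space_mu_H)
  also have "\<dots> = distr (mu_H H \<Otimes>\<^sub>M noise) seq_space (case_prod Y_path)"
  proof (rule measure_eqI)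
    have ne: "space (mu_H H) \<noteq> {}" by (rule mu.not_empty)
    show s: "sets (mu_H H \<bind> (\<lambda>p. distr noise seq_space (Y_path p))) = sets (distr (mu_H H \<Otimes>\<^sub>M noise) seq_space (case_prod Y_path))"
      using sets_bind[of "mu_H H" "\<lambda>p. distr noise seq_space (Y_path p)" seq_space] ne by simp
    fix A assume "A \<in> sets (mu_H H \<bind> (\<lambda>p. distr noise seq_space (Y_path p)))"
    then have A: "A \<in> sets seq_space" unfolding s by simp
    have Yp: "Y_path p \<in> noise \<rightarrow>\<^sub>M seq_space" if "p \<in> space (mu_H H)" for p
      using measurable_Pair2[OF measurable_Y_path_seq that] by simp
    have pre: "case_prod Y_path -` A \<inter> space (mu_H H \<Otimes>\<^sub>M noise) \<in> sets (mu_H H \<Otimes>\<^sub>M noise)"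
      by (rule measurable_sets[OF measurable_Y_path_seq A])
    have "emeasure (mu_H H \<bind> (\<lambda>p. distr noise seq_space (Y_path p))) A =
        (\<integral>\<^sup>+p. emeasure (distr noise seq_space (Y_path p)) A \<partial>mu_H H)"
      by (rule emeasure_bind[OF ne meas A])
    also have "\<dots> = (\<integral>\<^sup>+p. emeasure noise (Pair p -` (case_prod Y_path -` A \<inter> space (mu_H H \<Otimes>\<^sub>M noise))) \<partial>mu_H H)"
    proof (rule nn_integral_cong)
      fix p assume p: "p \<in> space (mu_H H)"
      have "Pair p -` (case_prod Y_path -` A \<inter> space (mu_H H \<Otimes>\<^sub>M noise)) = Y_path p -` A \<inter> space noise"
      proof (rule set_eqI)
        show "\<omega> \<in> Pair p -` (case_prod Y_path -` A \<inter> space (mu_H H \<Otimes>\<^sub>M noise)) \<longleftrightarrow> \<omega> \<in> Y_path p -` A \<inter> space noise" for \<omega>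
          by (simp add: space_pair_measure p)
      qed
      then show "emeasure (distr noise seq_space (Y_path p)) A =
          emeasure noise (Pair p -` (case_prod Y_path -` A \<inter> space (mu_H H \<Otimes>\<^sub>M noise)))"
        using emeasure_distr[OF Yp[OF p] A] by (simp only:)
    qed
    also have "\<dots> = emeasure (mu_H H \<Otimes>\<^sub>M noise) (case_prod Y_path -` A \<inter> space (mu_H H \<Otimes>\<^sub>M noise))"
      by (rule N.emeasure_pair_measure_alt[OF pre, symmetric])
    also have "\<dots> = emeasure (distr (mu_H H \<Otimes>\<^sub>M noise) seq_space (case_prod Y_path)) A"
      by (rule emeasure_distr[OF measurable_Y_path_seq A, symmetric])
    finally show "emeasure (mu_H H \<bind> (\<lambda>p. distr noise seq_space (Y_path p))) A =
        emeasure (distr (mu_H H \<Otimes>\<^sub>M noise) seq_space (case_prod Y_path)) A" .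
  qed
  finally show ?thesis .
qed

lemma persistence_sum_mu_H:
  shows "integrable (mu_H H) (\<lambda>p. persistence_sum p n)"
    and "(c_H H)\<^sup>2 * (\<integral>p. persistence_sum p n \<partial>mu_H H) = walk_variance H n"
proof -
  note i = integral_mu_H_power[OF H]
  show "integrable (mu_H H) (\<lambda>p. persistence_sum p n)"
    unfolding persistence_sum_def by (rule Bochner_Integration.integrable_sum) (rule i(1))
  have "(\<integral>p. persistence_sum p n \<partial>mu_H H) = (\<Sum>k<n. mean_persistence_power H k)"
    unfolding persistence_sum_def Bochner_Integration.integral_sum[OF i(1)] i(2) ..
  then show "(c_H H)\<^sup>2 * (\<integral>p. persistence_sum p n \<partial>mu_H H) = walk_variance H n"
    unfolding walk_variance_eq_sum[OF H] by (simp only:)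
qed

abbreviation (input) Yn :: "nat \<Rightarrow> real \<times> (nat \<Rightarrow> real) \<Rightarrow> real" where
  "Yn n x \<equiv> Y_path (fst x) (snd x) n"

lemma integrable_Y_square: "integrable (mu_H H \<Otimes>\<^sub>M noise) (\<lambda>x. Yn n x * Yn n x)"
proof (rule J.Fubini_integrable)
  \<comment> \<open>The formula fails at \<open>p = 0\<close>, where the path is 0 by division by
    zero while \<open>persistence_sum 0 n = n\<close>; that point is excluded by
    \<open>AE_mu_H\<close>.\<close>
  have eq: "(\<integral>\<omega>. norm (Yn n (p, \<omega>) * Yn n (p, \<omega>)) \<partial>noise) = persistence_sum p n" if "0 < p \<and> p \<le> 1" for p
    using integral_Y_path_mult(2)[of p n n] that by (simp add: persistence_sum_def)
  show "integrable (mu_H H) (\<lambda>p. \<integral>\<omega>. norm (Yn n (p, \<omega>) * Yn n (p, \<omega>)) \<partial>noise)"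
  proof (rule integrable_cong_AE_imp[OF persistence_sum_mu_H(1)])
    show "(\<lambda>p. \<integral>\<omega>. norm (Yn n (p, \<omega>) * Yn n (p, \<omega>)) \<partial>noise) \<in> borel_measurable (mu_H H)"
      unfolding real_norm_def by (rule borel_measurable_noise_integral)
        (intro borel_measurable_abs borel_measurable_times measurable_Y_path_pair)
    show "AE p in mu_H H. persistence_sum p n = (\<integral>\<omega>. norm (Yn n (p, \<omega>) * Yn n (p, \<omega>)) \<partial>noise)"
      using AE_mu_H by eventually_elim (simp only: eq)
  qed
  show "AE p in mu_H H. integrable noise (\<lambda>\<omega>. Yn n (p, \<omega>) * Yn n (p, \<omega>))"
    using AE_mu_H by eventually_elim (simp add: integral_Y_path_mult(1))
qed (rule borel_measurable_times[OF measurable_Y_path_pair measurable_Y_path_pair])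

lemma integrable_Y_mult: "integrable (mu_H H \<Otimes>\<^sub>M noise) (\<lambda>x. Yn n x * Yn m x)"
proof (rule Bochner_Integration.integrable_bound)
  show "integrable (mu_H H \<Otimes>\<^sub>M noise) (\<lambda>x. Yn n x * Yn n x + Yn m x * Yn m x)"
    by (intro Bochner_Integration.integrable_add integrable_Y_square)
  have "\<bar>a * b\<bar> \<le> \<bar>a * a + b * b\<bar>" for a b :: real
  proof -
    have "2 * \<bar>a * b\<bar> \<le> a * a + b * b"
      using sum_squares_bound[of "\<bar>a\<bar>" "\<bar>b\<bar>"] by (simp add: abs_mult power2_eq_square)
    then show ?thesis by linarith
  qed
  then show "AE x in mu_H H \<Otimes>\<^sub>M noise. norm (Yn n x * Yn m x) \<le> norm (Yn n x * Yn n x + Yn m x * Yn m x)"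
    by (intro AE_I2) (simp only: real_norm_def)
qed (rule borel_measurable_times[OF measurable_Y_path_pair measurable_Y_path_pair])

lemma integrable_Y: "integrable (mu_H H \<Otimes>\<^sub>M noise) (Yn n)"
proof (rule J.P.square_integrable_imp_integrable)
  show "integrable (mu_H H \<Otimes>\<^sub>M noise) (\<lambda>x. (Yn n x)\<^sup>2)"
    unfolding power2_eq_square by (rule integrable_Y_square)
qed (rule measurable_Y_path_pair)

lemma integral_Y: "(\<integral>x. Yn n x \<partial>(mu_H H \<Otimes>\<^sub>M noise)) = 0"
proof -
  have "(\<integral>x. Yn n x \<partial>(mu_H H \<Otimes>\<^sub>M noise)) = (\<integral>p. (\<integral>\<omega>. Yn n (p, \<omega>) \<partial>noise) \<partial>mu_H H)"
    by (rule J.integral_fst'[OF integrable_Y, symmetric])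
  also have "\<dots> = (\<integral>p. 0 \<partial>mu_H H)"
  proof (rule integral_cong_AE)
    show "(\<lambda>p. \<integral>\<omega>. Yn n (p, \<omega>) \<partial>noise) \<in> borel_measurable (mu_H H)"
      by (rule borel_measurable_noise_integral) (rule measurable_Y_path_pair)
    show "AE p in mu_H H. (\<integral>\<omega>. Yn n (p, \<omega>) \<partial>noise) = 0"
      using AE_mu_H by eventually_elim (simp add: integral_Y_path)
  qed simp
  finally show ?thesis by simp
qed

lemma integral_Y_mult:
  assumes nm: "m \<le> n"
  shows "(c_H H)\<^sup>2 * (\<integral>x. Yn n x * Yn m x \<partial>(mu_H H \<Otimes>\<^sub>M noise)) =
    (walk_variance H n + walk_variance H m - walk_variance H (n - m)) / 2"
proof -
  have "(\<integral>x. Yn n x * Yn m x \<partial>(mu_H H \<Otimes>\<^sub>M noise)) = (\<integral>p. (\<integral>\<omega>. Yn n (p, \<omega>) * Yn m (p, \<omega>) \<partial>noise) \<partial>mu_H H)"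
    by (rule J.integral_fst'[OF integrable_Y_mult, symmetric])
  also have "\<dots> = (\<integral>p. (persistence_sum p n + persistence_sum p m - persistence_sum p (n - m)) / 2 \<partial>mu_H H)"
  proof (rule integral_cong_AE)
    show "(\<lambda>p. \<integral>\<omega>. Yn n (p, \<omega>) * Yn m (p, \<omega>) \<partial>noise) \<in> borel_measurable (mu_H H)"
      by (rule borel_measurable_noise_integral) (intro borel_measurable_times measurable_Y_path_pair)
    show "(\<lambda>p. (persistence_sum p n + persistence_sum p m - persistence_sum p (n - m)) / 2) \<in> borel_measurable (mu_H H)"
      by (rule borel_measurable_mu_H) (unfold persistence_sum_def, measurable)
    show "AE p in mu_H H. (\<integral>\<omega>. Yn n (p, \<omega>) * Yn m (p, \<omega>) \<partial>noise) =
        (persistence_sum p n + persistence_sum p m - persistence_sum p (n - m)) / 2"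
      using AE_mu_H by eventually_elim (simp add: integral_Y_path_mult(2)[OF _ _ nm])
  qed
  also have "\<dots> = ((\<integral>p. persistence_sum p n \<partial>mu_H H) + (\<integral>p. persistence_sum p m \<partial>mu_H H) - (\<integral>p. persistence_sum p (n - m) \<partial>mu_H H)) / 2"
    using persistence_sum_mu_H(1) by simp
  finally have E: "(\<integral>x. Yn n x * Yn m x \<partial>(mu_H H \<Otimes>\<^sub>M noise)) = \<dots>" .
  have "k * ((a + b - c) / 2) = (k * a + k * b - k * c) / 2" for k a b c :: real
    by (simp add: distrib_left right_diff_distrib)
  then show ?thesis unfolding E persistence_sum_mu_H(2)[symmetric] by blast
qed

lemma Q_mix_transfer:
  assumes g: "g \<in> borel_measurable seq_space"
  shows "integrable (Q_mix (mu_H H)) g \<longleftrightarrow> integrable (mu_H H \<Otimes>\<^sub>M noise) (\<lambda>x. g (Y_path (fst x) (snd x)))"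
    and "(\<integral>y. g y \<partial>Q_mix (mu_H H)) = (\<integral>x. g (Y_path (fst x) (snd x)) \<partial>(mu_H H \<Otimes>\<^sub>M noise) :: real)"
  unfolding Q_mix_eq integrable_distr_eq[OF measurable_Y_path_seq g] integral_distr[OF measurable_Y_path_seq g]
  by (simp_all only: case_prod_beta')

lemma Q_mix_moments:
  shows "integrable (Q_mix (mu_H H)) (\<lambda>y. y n)" "(\<integral>y. y n \<partial>Q_mix (mu_H H)) = 0"
    "integrable (Q_mix (mu_H H)) (\<lambda>y. y n * y m)"
    "(c_H H)\<^sup>2 * (\<integral>y. y n * y m \<partial>Q_mix (mu_H H)) =
      (walk_variance H n + walk_variance H m - walk_variance H (nat \<bar>int n - int m\<bar>)) / 2"
proof -
  have [measurable]: "(\<lambda>y. y n) \<in> borel_measurable seq_space" for n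
    by (rule measurable_component_singleton) simp
  have 1: "(\<lambda>y. y n) \<in> borel_measurable seq_space" and 2: "(\<lambda>y. y n * y m) \<in> borel_measurable seq_space"
    by measurable
  show "integrable (Q_mix (mu_H H)) (\<lambda>y. y n)" "(\<integral>y. y n \<partial>Q_mix (mu_H H)) = 0"
    unfolding Q_mix_transfer[OF 1] by (rule integrable_Y, rule integral_Y)
  show "integrable (Q_mix (mu_H H)) (\<lambda>y. y n * y m)"
    unfolding Q_mix_transfer[OF 2] by (rule integrable_Y_mult)
  show "(c_H H)\<^sup>2 * (\<integral>y. y n * y m \<partial>Q_mix (mu_H H)) =
      (walk_variance H n + walk_variance H m - walk_variance H (nat \<bar>int n - int m\<bar>)) / 2"
    unfolding Q_mix_transfer[OF 2]
  proof (cases "m \<le> n")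
    case True
    then have "nat \<bar>int n - int m\<bar> = n - m" by simp
    then show "(c_H H)\<^sup>2 * (\<integral>x. Yn n x * Yn m x \<partial>(mu_H H \<Otimes>\<^sub>M noise)) =
      (walk_variance H n + walk_variance H m - walk_variance H (nat \<bar>int n - int m\<bar>)) / 2"
      using integral_Y_mult[OF True] by (simp only:)
  next
    case False
    then have nm: "n \<le> m" "nat \<bar>int n - int m\<bar> = m - n" by simp_all
    then show "(c_H H)\<^sup>2 * (\<integral>x. Yn n x * Yn m x \<partial>(mu_H H \<Otimes>\<^sub>M noise)) =
      (walk_variance H n + walk_variance H m - walk_variance H (nat \<bar>int n - int m\<bar>)) / 2"
      using integral_Y_mult[OF nm(1)] by (simp only: mult.commute add.commute)
  qed
qed

end

section \<open>The limit processes and tightness\<close>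

text \<open>The square of \<open>c_H\<close> times the covariance under the mixture, written as the
  polarization of the increment variance.\<close>

definition walk_cov :: "real \<Rightarrow> nat \<Rightarrow> nat \<Rightarrow> real" where
  "walk_cov H n m = (walk_variance H n + walk_variance H m - walk_variance H (nat \<bar>int n - int m\<bar>)) / 2"

lemma walk_cov_sym: "walk_cov H n m = walk_cov H m n"
proof -
  have "nat \<bar>int n - int m\<bar> = nat \<bar>int m - int n\<bar>" by linarith
  then show ?thesis unfolding walk_cov_def by (simp only: add.commute)
qed

lemma walk_cov_increment:
  "walk_cov H n n + walk_cov H m m - 2 * walk_cov H n m = walk_variance H (nat \<bar>int n - int m\<bar>)"
proof -
  have "walk_cov H k k = walk_variance H k" for k by (simp add: walk_cov_def)
  moreover have "a + b - 2 * x = z" if "x = (a + b - z) / 2" for a b x z :: real using that by simp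
  from this[OF walk_cov_def] have "walk_variance H n + walk_variance H m - 2 * walk_cov H n m = walk_variance H (nat \<bar>int n - int m\<bar>)" .
  ultimately show ?thesis by (simp only:)
qed

lemma measurable_seq_coord: "(\<lambda>y. y n) \<in> borel_measurable seq_space"
  by (rule measurable_component_singleton) simp

lemma floor_scaling_limit:
  assumes s: "0 \<le> s"
  shows "(\<lambda>N. real (nat \<lfloor>real N * s\<rfloor>) / real N) \<longlonglongrightarrow> s"
proof (rule tendsto_sandwich)
  have "(\<lambda>N. s - 1 / real N) \<longlonglongrightarrow> s - 0" by (intro tendsto_diff tendsto_const lim_const_over_n)
  then show "(\<lambda>N. s - 1 / real N) \<longlonglongrightarrow> s" by simp
  show "(\<lambda>N. s) \<longlonglongrightarrow> s" by (rule tendsto_const)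
  have b: "s - 1 / real N \<le> real (nat \<lfloor>real N * s\<rfloor>) / real N \<and> real (nat \<lfloor>real N * s\<rfloor>) / real N \<le> s" if N: "0 < N" for N
  proof -
    have N': "0 < real N" using N by simp
    have "0 \<le> \<lfloor>real N * s\<rfloor>" using s by simp
    then have e: "real (nat \<lfloor>real N * s\<rfloor>) = of_int \<lfloor>real N * s\<rfloor>" by simp
    have "of_int \<lfloor>real N * s\<rfloor> \<le> real N * s" "real N * s - 1 \<le> of_int \<lfloor>real N * s\<rfloor>" by linarith+
    then have "of_int \<lfloor>real N * s\<rfloor> / real N \<le> real N * s / real N" "(real N * s - 1) / real N \<le> of_int \<lfloor>real N * s\<rfloor> / real N"
      using N' by (simp_all only: divide_right_mono less_imp_le)
    then show ?thesis unfolding e using N' by (simp add: diff_divide_distrib)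
  qed
  show "eventually (\<lambda>N. s - 1 / real N \<le> real (nat \<lfloor>real N * s\<rfloor>) / real N) sequentially"
    using eventually_gt_at_top[of 0] by eventually_elim (use b in blast)
  show "eventually (\<lambda>N. real (nat \<lfloor>real N * s\<rfloor>) / real N \<le> s) sequentially"
    using eventually_gt_at_top[of 0] by eventually_elim (use b in blast)
qed

definition fbm_cov :: "real \<Rightarrow> real \<Rightarrow> real \<Rightarrow> real" where
  "fbm_cov H s t = (s powr (2 * H) + t powr (2 * H) - \<bar>s - t\<bar> powr (2 * H)) / 2"

lemma walk_cov_scaling:
  assumes H: "0 < H" "H < 1 / 2" and st: "0 \<le> s" "0 \<le> t"
  shows "(\<lambda>N. walk_cov H (nat \<lfloor>real N * s\<rfloor>) (nat \<lfloor>real N * t\<rfloor>) / (real N powr H)\<^sup>2) \<longlonglongrightarrow> fbm_cov H s t"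
proof -
  let ?a = "\<lambda>N. nat \<lfloor>real N * s\<rfloor>" and ?b = "\<lambda>N. nat \<lfloor>real N * t\<rfloor>"
  have "(\<lambda>N. \<bar>real (?a N) / real N - real (?b N) / real N\<bar>) \<longlonglongrightarrow> \<bar>s - t\<bar>"
    by (intro tendsto_rabs tendsto_diff floor_scaling_limit st)
  moreover have "\<bar>real (?a N) / real N - real (?b N) / real N\<bar> = real (nat \<bar>int (?a N) - int (?b N)\<bar>) / real N" for N
  proof -
    have "real (nat \<bar>int n - int m\<bar>) = \<bar>real n - real m\<bar>" for n m by simp
    then show ?thesis by (simp only: diff_divide_distrib[symmetric] abs_divide abs_of_nat)
  qed
  ultimately have d: "(\<lambda>N. real (nat \<bar>int (?a N) - int (?b N)\<bar>) / real N) \<longlonglongrightarrow> \<bar>s - t\<bar>" by (simp only:)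
  have sq: "(real N powr H)\<^sup>2 = real N powr (2 * H)" for N
    by (simp add: power2_eq_square powr_add[symmetric])
  have "(\<lambda>N. (walk_variance H (?a N) / real N powr (2 * H) + walk_variance H (?b N) / real N powr (2 * H)
      - walk_variance H (nat \<bar>int (?a N) - int (?b N)\<bar>) / real N powr (2 * H)) / 2) \<longlonglongrightarrow> fbm_cov H s t"
    unfolding fbm_cov_def
    by (intro tendsto_divide tendsto_diff tendsto_add tendsto_const walk_variance_scaling[OF H] d floor_scaling_limit st) simp
  moreover have "(x / k + y / k - z / k) / 2 = (x + y - z) / 2 / k" for x y z k :: real
    by (simp add: add_divide_distrib diff_divide_distrib)
  ultimately show ?thesis unfolding walk_cov_def sq by (simp only:)
qed

lemma noise_sum_linear:
  "(\<Sum>t\<in>J. a t * noise_sum (b t) n \<omega>) = noise_sum (\<lambda>l. \<Sum>t\<in>J. a t * b t l) n \<omega>"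
  unfolding noise_sum_def sum_distrib_left sum_distrib_right
  by (subst sum.swap) (simp add: mult.assoc)

lemma noise_sum_diff: "noise_sum b n \<omega> - noise_sum b' n \<omega> = noise_sum (\<lambda>l. b l - b' l) n \<omega>"
  unfolding noise_sum_def by (simp add: sum_subtractf left_diff_distrib)

lemma step_path_cong: "(\<And>n. n \<le> k \<Longrightarrow> g n = h n) \<Longrightarrow> step_path k g = step_path k h"
  unfolding step_path_def using step_index by (intro restrict_ext) blast

text \<open>Above the threshold \<open>e\<close>, dividing \<open>x ^ p\<close> by the smaller power
  \<open>e ^ (p - 1)\<close> only overestimates \<open>x\<close>. A bound on a high moment thus
  becomes a bound on a mean, pointwise and without tail probabilities.\<close>

lemma le_add_power_div:
  fixes x e :: real
  assumes "0 \<le> x" "0 < e" "0 < p" shows "x \<le> e + x ^ p / e ^ (p - 1)"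
proof (cases "x \<le> e")
  case True
  have "0 \<le> x ^ p / e ^ (p - 1)" using assms by simp
  then show ?thesis using True by linarith
next
  case False
  have "e ^ (p - 1) \<le> x ^ (p - 1)" using False assms by (intro power_mono) simp_all
  then have "x * e ^ (p - 1) \<le> x * x ^ (p - 1)" using assms(1) by (rule mult_left_mono)
  also have "x * x ^ (p - 1) = x ^ p" using assms(3) by (simp add: power_eq_if)
  finally have "x \<le> x ^ p / e ^ (p - 1)" using assms(2) by (simp add: pos_le_divide_eq)
  then show ?thesis using assms(2) by linarith
qed

text \<open>The maximal inequality is available for block lengths that are powers of two; rounding
  up costs at most a factor 2.\<close>

lemma power2_between:
  assumes "1 \<le> (x::real)" shows "\<exists>r. x \<le> 2 ^ r \<and> 2 ^ r \<le> 2 * x"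
proof -
  have ex: "\<exists>r. x \<le> 2 ^ r" using real_arch_pow[of 2 x] by (auto intro: less_imp_le)
  define r where "r = (LEAST r. x \<le> 2 ^ r)"
  have r: "x \<le> 2 ^ r" unfolding r_def using ex by (rule LeastI_ex)
  have "2 ^ r \<le> 2 * x"
  proof (cases r)
    case 0
    then show ?thesis using assms by simp
  next
    case (Suc m)
    have "\<not> x \<le> 2 ^ m" using not_less_Least[of m "\<lambda>r. x \<le> 2 ^ r"] Suc unfolding r_def[symmetric] by simp
    then show ?thesis unfolding Suc power_Suc by linarith
  qed
  then show ?thesis using r by blast
qed

text \<open>The coarse path holds the value of the last coarse grid time, at most
  \<open>N / k + 1\<close> fine steps back, where the 1 is due to rounding. By
  \<open>k \<le> N\<close> this is at most \<open>2 * N / k\<close>, hence within one block. The sum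
  over all blocks dominates the error of whichever block contains the given time.\<close>

lemma step_path_discretisation:
  fixes S :: "nat \<Rightarrow> 'a \<Rightarrow> real"
  assumes k: "0 < k" "k \<le> N" and r: "2 * real N / real k \<le> 2 ^ r" and e: "0 < e" and p: "0 < p"
  shows "skorohod_dist (step_path N (\<lambda>n. S n \<omega>)) (step_path k (\<lambda>j. S (nat \<lfloor>real N * (real j / real k)\<rfloor>) \<omega>))
    \<le> e + (\<Sum>j\<le>k. max_incr S (nat \<lfloor>real N * (real j / real k)\<rfloor>) (2 ^ r) \<omega> ^ p / e ^ (p - 1))"
proof (rule skorohod_dist_le_sup[OF step_path_cadlag step_path_cadlag])
  fix t :: real assume t: "t \<in> {0..1}"
  define j where "j = nat \<lfloor>real k * t\<rfloor>"
  define a where "a = nat \<lfloor>real N * (real j / real k)\<rfloor>"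
  define n where "n = nat \<lfloor>real N * t\<rfloor>"
  have k': "0 < real k" and N': "0 < real N" using k by simp_all
  have jk: "j \<le> k" unfolding j_def by (rule step_index[OF t])
  have "0 \<le> real k * t" using t k' by simp
  then have rj: "real j = of_int \<lfloor>real k * t\<rfloor>" unfolding j_def by simp
  then have j1: "real j \<le> real k * t" and j2: "real k * t < real j + 1" by linarith+
  have jt1: "real j / real k \<le> t" using j1 k' by (simp add: pos_divide_le_eq mult.commute)
  have jt2: "t < real j / real k + 1 / real k" using j2 k' by (simp add: add_divide_distrib[symmetric] pos_less_divide_eq mult.commute)
  have x1: "real N * (real j / real k) \<le> real N * t" using jt1 N' by (intro mult_left_mono) simp_all
  have x2: "real N * t < real N * (real j / real k) + real N / real k"
  proof -
    have "real N * t < real N * (real j / real k + 1 / real k)" using jt2 N' by (intro mult_strict_left_mono)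
    then show ?thesis by (simp only: distrib_left times_divide_eq_right mult_1_right)
  qed
  have an: "a \<le> n" unfolding a_def n_def using x1 by (intro nat_mono floor_mono)
  have "0 \<le> real N * (real j / real k)" by simp
  then have ra: "real a = of_int \<lfloor>real N * (real j / real k)\<rfloor>" unfolding a_def by simp
  have "0 \<le> real N * t" using t N' by simp
  then have rn: "real n = of_int \<lfloor>real N * t\<rfloor>" unfolding n_def by simp
  have Nk: "1 \<le> real N / real k" using k k' by (simp add: pos_le_divide_eq)
  have "real n - real a < real N / real k + 1"
    unfolding ra rn using x2 by linarith
  also have "\<dots> \<le> 2 * real N / real k" using Nk by simp
  finally have "real n - real a \<le> 2 ^ r" using r by linarith
  then have "real (n - a) \<le> real (2 ^ r)" using an by (simp add: of_nat_diff)
  then have na: "n - a \<le> 2 ^ r" by (simp only: of_nat_le_iff)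
  have "\<bar>S (a + (n - a)) \<omega> - S a \<omega>\<bar> \<le> max_incr S a (2 ^ r) \<omega>" by (rule max_incr_ge[OF na])
  then have "\<bar>S n \<omega> - S a \<omega>\<bar> \<le> max_incr S a (2 ^ r) \<omega>" using an by simp
  also have "\<dots> \<le> e + max_incr S a (2 ^ r) \<omega> ^ p / e ^ (p - 1)"
    by (rule le_add_power_div[OF max_incr_nonneg e p])
  also have "\<dots> \<le> e + (\<Sum>j\<le>k. max_incr S (nat \<lfloor>real N * (real j / real k)\<rfloor>) (2 ^ r) \<omega> ^ p / e ^ (p - 1))"
    unfolding a_def using jk e
    by (intro add_left_mono member_le_sum[where f = "\<lambda>j. max_incr S (nat \<lfloor>real N * (real j / real k)\<rfloor>) (2 ^ r) \<omega> ^ p / e ^ (p - 1)"])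
      (simp_all add: max_incr_nonneg)
  finally have "\<bar>S n \<omega> - S a \<omega>\<bar> \<le> e + (\<Sum>j\<le>k. max_incr S (nat \<lfloor>real N * (real j / real k)\<rfloor>) (2 ^ r) \<omega> ^ p / e ^ (p - 1))" .
  then show "\<bar>step_path N (\<lambda>n. S n \<omega>) t - step_path k (\<lambda>j. S (nat \<lfloor>real N * (real j / real k)\<rfloor>) \<omega>) t\<bar>
    \<le> e + (\<Sum>j\<le>k. max_incr S (nat \<lfloor>real N * (real j / real k)\<rfloor>) (2 ^ r) \<omega> ^ p / e ^ (p - 1))"
    unfolding step_path_apply[OF t] n_def a_def j_def .
qed

lemma (in prob_space) indep_vars_Suc:
  assumes "indep_vars (\<lambda>_. N) X {1..}"
  shows "indep_vars (\<lambda>_. N) (\<lambda>i. X (Suc i)) UNIV"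
proof -
  let ?F = "\<lambda>i. {X i -` A \<inter> space M |A. A \<in> sets N}"
  have rv: "\<And>i. i \<ge> 1 \<Longrightarrow> random_variable N (X i)" and ind: "indep_sets ?F {1..}"
    using assms unfolding indep_vars_def2 by simp_all
  have "indep_sets (\<lambda>i. ?F (Suc i)) UNIV"
  proof (rule indep_setsI)
    show "?F (Suc i) \<subseteq> events" for i using measurable_sets[OF rv[of "Suc i"]] by auto
    fix A :: "nat \<Rightarrow> 'a set" and J :: "nat set"
    assume J: "J \<noteq> {}" "finite J" and A: "\<forall>j\<in>J. A j \<in> ?F (Suc j)"
    have "prob (\<Inter>j\<in>Suc ` J. A (j - 1)) = (\<Prod>j\<in>Suc ` J. prob (A (j - 1)))"
      by (rule indep_setsD[OF ind]) (use J A in auto)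
    then show "prob (\<Inter>j\<in>J. A j) = (\<Prod>j\<in>J. prob (A j))"
      by (simp add: prod.reindex)
  qed
  then show ?thesis using rv unfolding indep_vars_def2 by simp
qed

text \<open>It has two uses: the variance in the central limit theorem, and the positivity of
  \<open>walk_cov\<close>, whose quadratic form is thereby a variance.\<close>

lemma Q_mix_combination:
  assumes H: "0 < H" "H < 1 / 2" and J: "finite J"
  shows "integrable (Q_mix (mu_H H)) (\<lambda>y. (\<Sum>t\<in>J. a t * y (k t))\<^sup>2)"
    "(\<integral>y. (\<Sum>t\<in>J. a t * y (k t)) \<partial>Q_mix (mu_H H)) = 0"
    "(c_H H)\<^sup>2 * (\<integral>y. (\<Sum>t\<in>J. a t * y (k t))\<^sup>2 \<partial>Q_mix (mu_H H)) = (\<Sum>s\<in>J. \<Sum>t\<in>J. a s * a t * walk_cov H (k s) (k t))"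
proof -
  note Q = Q_mix_moments[OF H]
  show "integrable (Q_mix (mu_H H)) (\<lambda>y. (\<Sum>t\<in>J. a t * y (k t))\<^sup>2)"
    unfolding square_sum_expand by (intro Bochner_Integration.integrable_sum integrable_mult_right Q(3))
  have "(\<integral>y. (\<Sum>t\<in>J. a t * y (k t)) \<partial>Q_mix (mu_H H)) = (\<Sum>t\<in>J. (\<integral>y. a t * y (k t) \<partial>Q_mix (mu_H H)))"
    by (rule Bochner_Integration.integral_sum) (intro integrable_mult_right Q(1))
  then show "(\<integral>y. (\<Sum>t\<in>J. a t * y (k t)) \<partial>Q_mix (mu_H H)) = 0" by (simp add: Q(2))
  have "(\<integral>y. (\<Sum>t\<in>J. a t * y (k t))\<^sup>2 \<partial>Q_mix (mu_H H)) = (\<Sum>s\<in>J. (\<integral>y. (\<Sum>t\<in>J. a s * a t * (y (k s) * y (k t))) \<partial>Q_mix (mu_H H)))"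
    unfolding square_sum_expand
    by (rule Bochner_Integration.integral_sum) (intro Bochner_Integration.integrable_sum integrable_mult_right Q(3))
  also have "\<dots> = (\<Sum>s\<in>J. \<Sum>t\<in>J. (\<integral>y. a s * a t * (y (k s) * y (k t)) \<partial>Q_mix (mu_H H)))"
    by (intro sum.cong refl Bochner_Integration.integral_sum integrable_mult_right Q(3))
  also have "\<dots> = (\<Sum>s\<in>J. \<Sum>t\<in>J. a s * a t * (\<integral>y. y (k s) * y (k t) \<partial>Q_mix (mu_H H)))"
    by (simp only: integral_mult_right_zero)
  finally have e: "(\<integral>y. (\<Sum>t\<in>J. a t * y (k t))\<^sup>2 \<partial>Q_mix (mu_H H)) = \<dots>" .
  show "(c_H H)\<^sup>2 * (\<integral>y. (\<Sum>t\<in>J. a t * y (k t))\<^sup>2 \<partial>Q_mix (mu_H H)) = (\<Sum>s\<in>J. \<Sum>t\<in>J. a s * a t * walk_cov H (k s) (k t))"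
    unfolding e walk_cov_def Q(4)[symmetric] sum_distrib_left by (simp only: ac_simps)
qed

text \<open>Positivity is inherited from the walk itself: the form is the square of
  \<open>c_H\<close> times the second moment of a linear combination of positions.\<close>

lemma walk_cov_cholesky:
  assumes H: "0 < H" "H < 1 / 2"
  shows "\<exists>A. \<forall>i<n. \<forall>j<n. walk_cov H i j = (\<Sum>l<n. A i l * A j l)"
proof (rule cholesky)
  show "walk_cov H i j = walk_cov H j i" for i j by (rule walk_cov_sym)
  show "0 \<le> (\<Sum>i<n. \<Sum>j<n. x i * x j * walk_cov H i j)" for x
    unfolding Q_mix_combination(3)[OF H finite_lessThan, symmetric] by (intro mult_nonneg_nonneg Bochner_Integration.integral_nonneg) simp_all
qed

text \<open>Fixes one factorisation per \<open>N\<close>. Those of different \<open>N\<close> need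
  not be compatible, since weak convergence sees each law separately.\<close>

locale walk_limit =
  fixes H :: real and A :: "nat \<Rightarrow> nat \<Rightarrow> nat \<Rightarrow> real"
  assumes H: "0 < H" "H < 1 / 2"
    and chol: "\<And>N i j. i \<le> N \<Longrightarrow> j \<le> N \<Longrightarrow> walk_cov H i j = (\<Sum>l<Suc N. A N i l * A N j l)"
begin

text \<open>The clipping extends the Gaussian vector by its last value beyond \<open>N\<close>. The
  blocks of the maximal inequality can run past \<open>N\<close>, and with this extension the
  increment bounds hold for all indices.\<close>

definition coef :: "nat \<Rightarrow> nat \<Rightarrow> nat \<Rightarrow> real" where
  "coef N n l = A N (min n N) l / real N powr H"

definition grid_gauss :: "nat \<Rightarrow> nat \<Rightarrow> (real \<Rightarrow> real) \<Rightarrow> real" where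
  "grid_gauss N n = noise_sum (coef N n) (Suc N)"

definition limit_process :: "nat \<Rightarrow> real \<Rightarrow> (real \<Rightarrow> real) \<Rightarrow> real" where
  "limit_process N t = grid_gauss N (nat \<lfloor>real N * t\<rfloor>)"

lemma measurable_grid_gauss[measurable]: "grid_gauss N n \<in> borel_measurable white_noise"
  unfolding grid_gauss_def by measurable

lemma coef_cov:
  "(\<Sum>l<Suc N. coef N n l * coef N m l) = walk_cov H (min n N) (min m N) / (real N powr H)\<^sup>2"
proof -
  have "walk_cov H (min n N) (min m N) = (\<Sum>l<Suc N. A N (min n N) l * A N (min m N) l)"
    by (rule chol) simp_all
  moreover have "coef N n l * coef N m l = A N (min n N) l * A N (min m N) l / (real N powr H)\<^sup>2" for l
    unfolding coef_def by (simp add: power2_eq_square)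
  ultimately show ?thesis by (simp only: sum_divide_distrib)
qed

lemma grid_gauss_iexp:
  assumes J: "finite J" and k: "\<And>t. t \<in> J \<Longrightarrow> k t \<le> N"
  shows "(\<integral>\<omega>. iexp (\<Sum>t\<in>J. a t * grid_gauss N (k t) \<omega>) \<partial>white_noise) =
    complex_of_real (exp (- (\<Sum>s\<in>J. \<Sum>t\<in>J. a s * a t * (walk_cov H (k s) (k t) / (real N powr H)\<^sup>2)) / 2))"
proof -
  have "(\<Sum>l<Suc N. (\<Sum>t\<in>J. a t * coef N (k t) l)\<^sup>2) = (\<Sum>l<Suc N. \<Sum>s\<in>J. \<Sum>t\<in>J. a s * a t * (coef N (k s) l * coef N (k t) l))"
    by (simp only: square_sum_expand)
  also have "\<dots> = (\<Sum>s\<in>J. \<Sum>l<Suc N. \<Sum>t\<in>J. a s * a t * (coef N (k s) l * coef N (k t) l))"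
    by (rule sum.swap)
  also have "\<dots> = (\<Sum>s\<in>J. \<Sum>t\<in>J. \<Sum>l<Suc N. a s * a t * (coef N (k s) l * coef N (k t) l))"
    by (intro sum.cong refl sum.swap)
  also have "\<dots> = (\<Sum>s\<in>J. \<Sum>t\<in>J. a s * a t * (\<Sum>l<Suc N. coef N (k s) l * coef N (k t) l))"
    by (simp only: sum_distrib_left)
  also have "\<dots> = (\<Sum>s\<in>J. \<Sum>t\<in>J. a s * a t * (walk_cov H (k s) (k t) / (real N powr H)\<^sup>2))"
    unfolding coef_cov by (intro sum.cong refl) (simp add: min_absorb1 k)
  finally have e: "(\<Sum>l<Suc N. (\<Sum>t\<in>J. a t * coef N (k t) l)\<^sup>2) = \<dots>" .
  show ?thesis
    unfolding grid_gauss_def noise_sum_linear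
    using noise_sum_iexp[of 1 "\<lambda>l. \<Sum>t\<in>J. a t * coef N (k t) l" "Suc N"] unfolding e by (simp only: mult_1 power_one)
qed

lemma grid_gauss_moment:
  "\<exists>q G. 0 < q \<and> 0 \<le> G \<and>
    (\<forall>N n m. integrable white_noise (\<lambda>\<omega>. \<bar>grid_gauss N n \<omega> - grid_gauss N m \<omega>\<bar> ^ (2 * q))) \<and>
    (\<forall>N n m. 0 < N \<longrightarrow> (\<integral>\<omega>. \<bar>grid_gauss N n \<omega> - grid_gauss N m \<omega>\<bar> ^ (2 * q) \<partial>white_noise) \<le> G / (real N)\<^sup>2 * (real n - real m)\<^sup>2)"
proof -
  obtain C where C: "C \<ge> 0" "\<And>n. \<bar>walk_variance H n\<bar> \<le> C * real n powr (2 * H)" using walk_variance_bound[OF H] by blast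
  \<comment> \<open>With x = d / N at most 1, the variance is of order
    \<open>x powr (2 * H)\<close>; its \<open>q\<close>-th power is below the square of x as soon as
    \<open>H * q > 1\<close>. This square is the growth that \<open>max_incr_moment\<close>
    assumes.\<close>
  obtain q where q: "1 / H < real q" using reals_Archimedean2 by blast
  have Hq: "1 < H * real q" using q H(1) by (simp add: pos_divide_less_eq mult.commute)
  have q0: "0 < q" using Hq H(1) by (cases q) simp_all
  define \<kappa> :: real where "\<kappa> = fact (2 * q) / (2 ^ q * fact q)"
  have \<kappa>: "0 \<le> \<kappa>" unfolding \<kappa>_def by simp
  have diff: "\<bar>grid_gauss N n \<omega> - grid_gauss N m \<omega>\<bar> ^ (2 * q) = noise_sum (\<lambda>l. coef N n l - coef N m l) (Suc N) \<omega> ^ (2 * q)" for N n m \<omega>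
    unfolding grid_gauss_def noise_sum_diff by (simp add: power_mult)
  show ?thesis
  proof (intro exI[of _ q] exI[of _ "\<kappa> * C ^ q"] conjI allI impI)
    show "0 < q" by (rule q0)
    show "0 \<le> \<kappa> * C ^ q" using \<kappa> C(1) by simp
    show "integrable white_noise (\<lambda>\<omega>. \<bar>grid_gauss N n \<omega> - grid_gauss N m \<omega>\<bar> ^ (2 * q))" for N n m
      unfolding diff by (rule noise_sum_moment(1))
    fix N n m :: nat assume N: "0 < N"
    let ?n = "min n N" and ?m = "min m N"
    define d where "d = nat \<bar>int ?n - int ?m\<bar>"
    have "(\<Sum>l<Suc N. (coef N n l - coef N m l)\<^sup>2) =
        (\<Sum>l<Suc N. coef N n l * coef N n l) + (\<Sum>l<Suc N. coef N m l * coef N m l) - 2 * (\<Sum>l<Suc N. coef N n l * coef N m l)"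
      unfolding sum_distrib_left sum.distrib[symmetric] sum_subtractf[symmetric]
      by (rule sum.cong) (simp_all add: power2_eq_square algebra_simps)
    also have "\<dots> = (walk_cov H ?n ?n + walk_cov H ?m ?m - 2 * walk_cov H ?n ?m) / (real N powr H)\<^sup>2"
      unfolding coef_cov by (simp add: add_divide_distrib diff_divide_distrib)
    also have "\<dots> = walk_variance H d / (real N powr H)\<^sup>2" unfolding walk_cov_increment d_def ..
    finally have v: "(\<Sum>l<Suc N. (coef N n l - coef N m l)\<^sup>2) = walk_variance H d / (real N powr H)\<^sup>2" .
    have "(\<Sum>l<Suc N. (coef N n l - coef N m l)\<^sup>2) \<ge> 0" by (rule sum_nonneg) simp
    then have v0: "0 \<le> walk_variance H d / (real N powr H)\<^sup>2" unfolding v .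
    have N': "0 < real N" using N by simp
    have sq: "(real N powr H)\<^sup>2 = real N powr (2 * H)" by (simp add: power2_eq_square powr_add[symmetric])
    let ?x = "real d / real N"
    have x: "0 \<le> ?x" "?x \<le> 1"
    proof -
      have "d \<le> N" unfolding d_def by linarith
      then show "0 \<le> ?x" "?x \<le> 1" using N' by simp_all
    qed
    have "walk_variance H d / (real N powr H)\<^sup>2 \<le> C * real d powr (2 * H) / real N powr (2 * H)"
      unfolding sq using C(2)[of d] by (intro divide_right_mono) simp_all
    also have "\<dots> = C * ?x powr (2 * H)" using N' by (simp add: powr_divide)
    finally have "(walk_variance H d / (real N powr H)\<^sup>2) ^ q \<le> (C * ?x powr (2 * H)) ^ q"
      using v0 by (rule power_mono)
    also have "\<dots> = C ^ q * ?x powr (2 * H * real q)"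
    proof -
      have "(?x powr (2 * H)) ^ q = ?x powr (real q * (2 * H))" 
      proof (cases "?x = 0")
        case True
        show ?thesis unfolding True using q0 by simp
      next
        case False
        then show ?thesis by (rule powr_power)
      qed
      then show ?thesis by (simp only: power_mult_distrib mult.commute[of "real q"])
    qed
    also have "\<dots> \<le> C ^ q * ?x\<^sup>2"
    proof (rule mult_left_mono)
      show "?x powr (2 * H * real q) \<le> ?x\<^sup>2"
      proof (cases "?x = 0")
        case False
        then have x0: "0 < ?x" using x by linarith
        have "?x powr (2 * H * real q) \<le> ?x powr 2"
          using x Hq by (intro powr_mono') simp_all
        then show ?thesis using x0 by (simp add: powr_numeral)
      next
        case True
        show ?thesis unfolding True by simp
      qed
    qed (use C(1) in simp)
    also have "\<dots> \<le> C ^ q * ((real n - real m)\<^sup>2 / (real N)\<^sup>2)"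
    proof (rule mult_left_mono)
      have "real d \<le> \<bar>real n - real m\<bar>" unfolding d_def by linarith
      then have "(real d)\<^sup>2 \<le> (real n - real m)\<^sup>2" by (simp only: abs_le_square_iff[symmetric] abs_of_nat)
      then show "?x\<^sup>2 \<le> (real n - real m)\<^sup>2 / (real N)\<^sup>2" unfolding power_divide by (intro divide_right_mono) simp_all
    qed (use C(1) in simp)
    finally have main: "(walk_variance H d / (real N powr H)\<^sup>2) ^ q \<le> C ^ q * ((real n - real m)\<^sup>2 / (real N)\<^sup>2)" .
    have "(\<integral>\<omega>. \<bar>grid_gauss N n \<omega> - grid_gauss N m \<omega>\<bar> ^ (2 * q) \<partial>white_noise) = \<kappa> * (walk_variance H d / (real N powr H)\<^sup>2) ^ q"
      unfolding diff noise_sum_moment(2) v \<kappa>_def ..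
    also have "\<dots> \<le> \<kappa> * (C ^ q * ((real n - real m)\<^sup>2 / (real N)\<^sup>2))" by (rule mult_left_mono[OF main \<kappa>])
    finally show "(\<integral>\<omega>. \<bar>grid_gauss N n \<omega> - grid_gauss N m \<omega>\<bar> ^ (2 * q) \<partial>white_noise) \<le> \<kappa> * C ^ q / (real N)\<^sup>2 * (real n - real m)\<^sup>2"
      by (simp add: mult.assoc)
  qed
qed

text \<open>The Cramer-Wold device: a fixed linear combination of the coordinates is a normalised
  sum of i.i.d. centred variables with finite variance, and the variance in its limit is the
  quadratic form realised by the Gaussian vector.\<close>

lemma fidi_converges_limit_process:
  assumes P: "prob_space P" and ind: "prob_space.indep_vars P (\<lambda>_. seq_space) Y {1..}"
    and dist: "\<And>i. i \<ge> 1 \<Longrightarrow> distr P seq_space (Y i) = Q_mix (mu_H H)"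
  shows "fidi_converges {0..1} P (normalised_sum H Y N) white_noise (limit_process N)"
  unfolding fidi_converges_def
proof (intro allI impI)
  fix J :: "real set" assume J': "finite J \<and> J \<subseteq> {0..1}"
  then have J: "finite J" by simp
  interpret prob_space P by (rule P)
  let ?k = "\<lambda>t. nat \<lfloor>real N * t\<rfloor>"
  have kN: "?k t \<le> N" if "t \<in> J" for t using step_index[of t N] J' that by blast
  have Ym: "Y i \<in> P \<rightarrow>\<^sub>M seq_space" if "i \<ge> 1" for i using ind that unfolding indep_vars_def by simp
  have Yk: "(\<lambda>\<omega>. Y i \<omega> n) \<in> borel_measurable P" if "i \<ge> 1" for i n
    by (rule measurable_compose[OF Ym[OF that] measurable_seq_coord])
  show "converges_in_law (product_topology (\<lambda>_. euclideanreal) J) (\<lambda>_. P) (\<lambda>m \<omega>. \<lambda>t\<in>J. normalised_sum H Y N m t \<omega>)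
      white_noise (\<lambda>\<omega>. \<lambda>t\<in>J. limit_process N t \<omega>)"
  proof (rule converges_in_law_of_char[OF J])
    show "prob_space P" "prob_space white_noise" by (rule P, rule prob_space_white_noise)
    show "normalised_sum H Y N m t \<in> borel_measurable P" for m t
      unfolding normalised_sum_def[abs_def]
      by (intro borel_measurable_divide borel_measurable_times borel_measurable_const borel_measurable_sum Yk) simp
    show "limit_process N t \<in> borel_measurable white_noise" for t
      unfolding limit_process_def by (rule measurable_grid_gauss)
    fix a :: "real \<Rightarrow> real"
    \<comment> \<open>The factor \<open>c_H H / real N powr H\<close> moves into the coefficients,
      so that only \<open>sqrt (real m)\<close>, the scaling of the central limit theorem, remains
      outside.\<close>
    define b where "b t = a t * (c_H H / real N powr H)" for t
    define g where "g y = (\<Sum>t\<in>J. b t * y (?k t))" for y :: "nat \<Rightarrow> real"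
    define V where "V = (\<Sum>s\<in>J. \<Sum>t\<in>J. a s * a t * (walk_cov H (?k s) (?k t) / (real N powr H)\<^sup>2))"
    have gm: "g \<in> borel_measurable seq_space"
      unfolding g_def[abs_def] by (intro borel_measurable_sum borel_measurable_times borel_measurable_const measurable_seq_coord)
    have lin: "(\<Sum>t\<in>J. a t * normalised_sum H Y N m t \<omega>) = (\<Sum>i<m. g (Y (Suc i) \<omega>)) / sqrt (real m)" for m \<omega>
    proof -
      have "a t * normalised_sum H Y N m t \<omega> = (\<Sum>i<m. b t * Y (Suc i) \<omega> (?k t)) / sqrt (real m)" for t
        unfolding normalised_sum_def b_def sum_distrib_left[symmetric] One_nat_def sum.atLeast1_atMost_eq by simp
      then have "(\<Sum>t\<in>J. a t * normalised_sum H Y N m t \<omega>) = (\<Sum>t\<in>J. (\<Sum>i<m. b t * Y (Suc i) \<omega> (?k t))) / sqrt (real m)"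
        by (simp only: sum_divide_distrib)
      also have "(\<Sum>t\<in>J. (\<Sum>i<m. b t * Y (Suc i) \<omega> (?k t))) = (\<Sum>i<m. g (Y (Suc i) \<omega>))"
        unfolding g_def by (rule sum.swap)
      finally show ?thesis .
    qed
    have tr: "integrable P (\<lambda>\<omega>. f (Y (Suc i) \<omega>)) \<longleftrightarrow> integrable (Q_mix (mu_H H)) f"
      "(\<integral>\<omega>. f (Y (Suc i) \<omega>) \<partial>P) = (\<integral>y. f y \<partial>Q_mix (mu_H H))"
      if f: "f \<in> borel_measurable seq_space" for f :: "(nat \<Rightarrow> real) \<Rightarrow> real" and i
    proof -
      have Yi: "Y (Suc i) \<in> P \<rightarrow>\<^sub>M seq_space" and d: "distr P seq_space (Y (Suc i)) = Q_mix (mu_H H)"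
        by (rule Ym, simp, rule dist, simp)
      show "integrable P (\<lambda>\<omega>. f (Y (Suc i) \<omega>)) \<longleftrightarrow> integrable (Q_mix (mu_H H)) f"
        unfolding d[symmetric] by (rule integrable_distr_eq[OF Yi f, symmetric])
      show "(\<integral>\<omega>. f (Y (Suc i) \<omega>) \<partial>P) = (\<integral>y. f y \<partial>Q_mix (mu_H H))"
        unfolding d[symmetric] by (rule integral_distr[OF Yi f, symmetric])
    qed
    have g2m: "(\<lambda>y. (g y)\<^sup>2) \<in> borel_measurable seq_space" using gm by (rule borel_measurable_power)
    note Q = Q_mix_combination[OF H J, of b ?k, folded g_def]
    have QV: "(\<integral>y. (g y)\<^sup>2 \<partial>Q_mix (mu_H H)) = V"
    proof -
      define b' where "b' t = a t / real N powr H" for t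
      have gb: "g y = c_H H * (\<Sum>t\<in>J. b' t * y (?k t))" for y
        unfolding g_def b_def b'_def sum_distrib_left by (intro sum.cong refl) simp
      have "(\<integral>y. (g y)\<^sup>2 \<partial>Q_mix (mu_H H)) = (c_H H)\<^sup>2 * (\<integral>y. (\<Sum>t\<in>J. b' t * y (?k t))\<^sup>2 \<partial>Q_mix (mu_H H))"
        unfolding gb power_mult_distrib by (rule integral_mult_right_zero)
      also have "\<dots> = (\<Sum>s\<in>J. \<Sum>t\<in>J. b' s * b' t * walk_cov H (?k s) (?k t))" by (rule Q_mix_combination(3)[OF H J])
      also have "\<dots> = V" unfolding V_def b'_def by (intro sum.cong refl) (simp add: power2_eq_square)
      finally show ?thesis .
    qed
    have "(\<lambda>m. \<integral>\<omega>. iexp ((\<Sum>i<m. g (Y (Suc i) \<omega>)) / sqrt (real m)) \<partial>P) \<longlonglongrightarrow> complex_of_real (exp (- V / 2))"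
    proof (rule clt_char)
      have "indep_vars (\<lambda>_. borel) (\<lambda>i \<omega>. g (Y i \<omega>)) {1..}"
        by (rule indep_vars_compose2[OF ind]) (rule gm)
      then show "indep_vars (\<lambda>_. borel) (\<lambda>i \<omega>. g (Y (Suc i) \<omega>)) UNIV"
        by (rule indep_vars_Suc)
      show "distr P borel (\<lambda>\<omega>. g (Y (Suc i) \<omega>)) = distr (Q_mix (mu_H H)) borel g" for i
      proof -
        have Yi: "Y (Suc i) \<in> P \<rightarrow>\<^sub>M seq_space" and d: "distr P seq_space (Y (Suc i)) = Q_mix (mu_H H)"
          by (rule Ym, simp, rule dist, simp)
        show ?thesis unfolding d[symmetric] distr_distr[OF gm Yi] comp_def ..
      qed
      show "integrable P (\<lambda>\<omega>. (g (Y (Suc i) \<omega>))\<^sup>2)" for i unfolding tr(1)[OF g2m] by (rule Q(1))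
      show "expectation (\<lambda>\<omega>. g (Y (Suc i) \<omega>)) = 0" for i unfolding tr(2)[OF gm] by (rule Q(2))
      show "expectation (\<lambda>\<omega>. (g (Y (Suc i) \<omega>))\<^sup>2) = V" for i unfolding tr(2)[OF g2m] by (rule QV)
    qed
    moreover have lim: "(\<integral>\<omega>. iexp (\<Sum>t\<in>J. a t * limit_process N t \<omega>) \<partial>white_noise) = complex_of_real (exp (- V / 2))"
      unfolding limit_process_def V_def by (rule grid_gauss_iexp[OF J]) (rule kN)
    ultimately show "(\<lambda>m. \<integral>\<omega>. iexp (\<Sum>t\<in>J. a t * normalised_sum H Y N m t \<omega>) \<partial>P)
        \<longlonglongrightarrow> (\<integral>\<omega>. iexp (\<Sum>t\<in>J. a t * limit_process N t \<omega>) \<partial>white_noise)"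
      by (simp only: lin lim)
  qed
qed

definition limit_path :: "nat \<Rightarrow> (real \<Rightarrow> real) \<Rightarrow> real \<Rightarrow> real" where
  "limit_path N \<omega> = step_path N (\<lambda>n. grid_gauss N n \<omega>)"

text \<open>The Gaussian vector of level \<open>N\<close> observed at \<open>k + 1\<close> times
  only. For fixed \<open>k\<close> its limit in \<open>N\<close> is a finite-dimensional
  statement.\<close>

definition coarse_path :: "nat \<Rightarrow> nat \<Rightarrow> (real \<Rightarrow> real) \<Rightarrow> real \<Rightarrow> real" where
  "coarse_path k N \<omega> = step_path k (\<lambda>j. grid_gauss N (nat \<lfloor>real N * (real j / real k)\<rfloor>) \<omega>)"

lemma limit_path_eq: "limit_path N \<omega> = (\<lambda>t\<in>{0..1}. limit_process N t \<omega>)"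
  unfolding limit_path_def step_path_def limit_process_def ..

lemma measurable_limit_path: "limit_path N \<in> white_noise \<rightarrow>\<^sub>M borel_sets_of skorohod_topology"
  unfolding limit_path_def[abs_def] by (rule measurable_step_path) (rule measurable_grid_gauss)

lemma measurable_coarse_path: "coarse_path k N \<in> white_noise \<rightarrow>\<^sub>M borel_sets_of skorohod_topology"
  unfolding coarse_path_def[abs_def] by (rule measurable_step_path) (rule measurable_grid_gauss)

text \<open>The blocks have length of order \<open>N / k\<close> and the increment constant is
  \<open>G\<close> over the square of \<open>N\<close>, so each of the \<open>k + 1\<close> block
  maxima has a moment of order \<open>1 / k\<close> squared, and the sum is of order
  \<open>1 / k\<close> for every \<open>N\<close>. An integrable majorant \<open>D\<close> stands in
  for the distance, whose measurability would be a separate question.\<close>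

lemma coarse_path_error:
  "\<exists>G p. 0 < (p::nat) \<and> 0 \<le> G \<and>
    (\<forall>k N e. 0 < k \<longrightarrow> k \<le> N \<longrightarrow> 0 < e \<longrightarrow>
      (\<exists>D. integrable white_noise D \<and> (\<forall>\<omega>. skorohod_dist (limit_path N \<omega>) (coarse_path k N \<omega>) \<le> D \<omega>) \<and>
        (\<integral>\<omega>. D \<omega> \<partial>white_noise) \<le> e + G / (real k * e ^ (p - 1))))"
proof -
  obtain q G where q: "0 < q" and G: "0 \<le> G"
    and int0: "\<forall>N n m. integrable white_noise (\<lambda>\<omega>. \<bar>grid_gauss N n \<omega> - grid_gauss N m \<omega>\<bar> ^ (2 * q))"
    and bd0: "\<forall>N n m. 0 < N \<longrightarrow> (\<integral>\<omega>. \<bar>grid_gauss N n \<omega> - grid_gauss N m \<omega>\<bar> ^ (2 * q) \<partial>white_noise) \<le> G / (real N)\<^sup>2 * (real n - real m)\<^sup>2"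
    using grid_gauss_moment by (elim exE conjE)
  note int = int0[rule_format] and bd = bd0[rule_format]
  let ?p = "2 * q"
  have p: "0 < ?p" using q by simp
  obtain K where K: "0 \<le> K" and mi: "\<forall>(M :: (real \<Rightarrow> real) measure) S c. prob_space M \<longrightarrow> (\<forall>n. S n \<in> borel_measurable M) \<longrightarrow> c \<ge> 0 \<longrightarrow>
    (\<forall>n m. integrable M (\<lambda>\<omega>. \<bar>S n \<omega> - S m \<omega>\<bar> ^ ?p) \<and>
            (\<integral>\<omega>. \<bar>S n \<omega> - S m \<omega>\<bar> ^ ?p \<partial>M) \<le> c * (real n - real m)\<^sup>2) \<longrightarrow>
    (\<forall>a r. integrable M (\<lambda>\<omega>. max_incr S a (2 ^ r) \<omega> ^ ?p) \<and>
            (\<integral>\<omega>. max_incr S a (2 ^ r) \<omega> ^ ?p \<partial>M) \<le> K * c * 4 ^ r)"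
    using max_incr_moment[OF p] by (elim exE conjE)
  show ?thesis
  \<comment> \<open>The constant is 16 times 2: 16 bounds \<open>4 ^ r\<close> in terms of the
    square of \<open>N / k\<close>, and 2 comes from \<open>k + 1 \<le> 2 * k\<close>.\<close>
  proof (intro exI[of _ "32 * (K * G)"] exI[of _ ?p] conjI allI impI)
    show "0 < ?p" by (rule p)
    show "0 \<le> 32 * (K * G)" using K G by simp
    fix k N :: nat and e :: real assume k: "0 < k" "k \<le> N" and e: "0 < e"
    have k': "0 < real k" and N': "0 < real N" and N: "0 < N" using k by simp_all
    have "1 \<le> 2 * real N / real k" using k k' by (simp add: pos_le_divide_eq)
    then obtain r where r: "2 * real N / real k \<le> 2 ^ r" "2 ^ r \<le> 2 * (2 * real N / real k)"
      using power2_between by blast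
    let ?S = "\<lambda>n. grid_gauss N n"
    have c: "0 \<le> G / (real N)\<^sup>2" using G by simp
    have M: "integrable white_noise (\<lambda>\<omega>. max_incr ?S a (2 ^ r) \<omega> ^ ?p) \<and>
        (\<integral>\<omega>. max_incr ?S a (2 ^ r) \<omega> ^ ?p \<partial>white_noise) \<le> K * (G / (real N)\<^sup>2) * 4 ^ r" for a
      by (rule mi[rule_format, OF prob_space_white_noise measurable_grid_gauss c]) (intro conjI int bd[OF N])
    have four: "(4::real) ^ r \<le> (4 * real N / real k)\<^sup>2"
    proof -
      have "(4::real) ^ r = (2 ^ r)\<^sup>2" by (simp add: power_mult[symmetric] mult.commute[of r 2]) (simp add: power_mult)
      also have "\<dots> \<le> (4 * real N / real k)\<^sup>2" using r(2) by (intro power_mono) simp_all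
      finally show ?thesis .
    qed
    have KG: "K * (G / (real N)\<^sup>2) * 4 ^ r \<le> 16 * (K * G) / (real k)\<^sup>2"
    proof -
      have "K * (G / (real N)\<^sup>2) * 4 ^ r \<le> K * (G / (real N)\<^sup>2) * (4 * real N / real k)\<^sup>2"
        by (intro mult_left_mono four mult_nonneg_nonneg K c)
      also have "\<dots> = 16 * (K * G) / (real k)\<^sup>2" using N' by (simp add: power_divide power_mult_distrib)
      finally show ?thesis .
    qed
    let ?a = "\<lambda>j. nat \<lfloor>real N * (real j / real k)\<rfloor>"
    define D where "D \<omega> = e + (\<Sum>j\<le>k. max_incr ?S (?a j) (2 ^ r) \<omega> ^ ?p / e ^ (?p - 1))" for \<omega>
    have ep: "0 < e ^ (?p - 1)" using e by simp
    have iD: "integrable white_noise (\<lambda>\<omega>. \<Sum>j\<le>k. max_incr ?S (?a j) (2 ^ r) \<omega> ^ ?p / e ^ (?p - 1))"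
      using M by (intro Bochner_Integration.integrable_sum integrable_divide_zero) blast
    have ic: "integrable white_noise (\<lambda>\<omega>. e)" by simp
    show "\<exists>D. integrable white_noise D \<and> (\<forall>\<omega>. skorohod_dist (limit_path N \<omega>) (coarse_path k N \<omega>) \<le> D \<omega>) \<and>
        (\<integral>\<omega>. D \<omega> \<partial>white_noise) \<le> e + 32 * (K * G) / (real k * e ^ (?p - 1))"
    proof (intro exI[of _ D] conjI allI)
      show "integrable white_noise D" unfolding D_def[abs_def] by (rule Bochner_Integration.integrable_add[OF ic iD])
      show "skorohod_dist (limit_path N \<omega>) (coarse_path k N \<omega>) \<le> D \<omega>" for \<omega>
        unfolding limit_path_def coarse_path_def D_def by (rule step_path_discretisation[OF k r(1) e p])
      have "(\<integral>\<omega>. D \<omega> \<partial>white_noise) = e + (\<integral>\<omega>. (\<Sum>j\<le>k. max_incr ?S (?a j) (2 ^ r) \<omega> ^ ?p / e ^ (?p - 1)) \<partial>white_noise)"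
        unfolding D_def Bochner_Integration.integral_add[OF ic iD] using WN.prob_space by simp
      moreover have "(\<integral>\<omega>. (\<Sum>j\<le>k. max_incr ?S (?a j) (2 ^ r) \<omega> ^ ?p / e ^ (?p - 1)) \<partial>white_noise)
          = (\<Sum>j\<le>k. (\<integral>\<omega>. max_incr ?S (?a j) (2 ^ r) \<omega> ^ ?p / e ^ (?p - 1) \<partial>white_noise))"
        by (rule Bochner_Integration.integral_sum) (use M in \<open>intro integrable_divide_zero, blast\<close>)
      moreover have "(\<Sum>j\<le>k. (\<integral>\<omega>. max_incr ?S (?a j) (2 ^ r) \<omega> ^ ?p / e ^ (?p - 1) \<partial>white_noise)) \<le> 32 * (K * G) / (real k * e ^ (?p - 1))"
      proof -
      have "(\<Sum>j\<le>k. (\<integral>\<omega>. max_incr ?S (?a j) (2 ^ r) \<omega> ^ ?p / e ^ (?p - 1) \<partial>white_noise))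
          \<le> (\<Sum>j\<le>k. 16 * (K * G) / (real k)\<^sup>2 / e ^ (?p - 1))"
      proof (rule sum_mono)
        fix j
        have "(\<integral>\<omega>. max_incr ?S (?a j) (2 ^ r) \<omega> ^ ?p \<partial>white_noise) \<le> 16 * (K * G) / (real k)\<^sup>2"
          using conjunct2[OF M[of "?a j"]] KG by (rule order_trans)
        then show "(\<integral>\<omega>. max_incr ?S (?a j) (2 ^ r) \<omega> ^ ?p / e ^ (?p - 1) \<partial>white_noise) \<le> 16 * (K * G) / (real k)\<^sup>2 / e ^ (?p - 1)"
          unfolding integral_divide_zero using ep by (intro divide_right_mono) simp_all
      qed
      also have "\<dots> = (real k + 1) * (16 * (K * G) / (real k)\<^sup>2 / e ^ (?p - 1))" by simp
      also have "\<dots> \<le> (2 * real k) * (16 * (K * G) / (real k)\<^sup>2 / e ^ (?p - 1))"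
        using k K G ep by (intro mult_right_mono divide_nonneg_nonneg) simp_all
      also have "\<dots> = 32 * (K * G) / (real k * e ^ (?p - 1))"
        using k' by (simp add: power2_eq_square)
      finally show "(\<Sum>j\<le>k. (\<integral>\<omega>. max_incr ?S (?a j) (2 ^ r) \<omega> ^ ?p / e ^ (?p - 1) \<partial>white_noise)) \<le> 32 * (K * G) / (real k * e ^ (?p - 1))" .
      qed
      ultimately show "(\<integral>\<omega>. D \<omega> \<partial>white_noise) \<le> e + 32 * (K * G) / (real k * e ^ (?p - 1))" by linarith
    qed
  qed
qed

text \<open>Composed with \<open>step_path\<close>, a Lipschitz functional of paths is a Lipschitz
  function of \<open>k + 1\<close> coordinates, and the characteristic functions of these converge
  because the covariances do.\<close>

lemma coarse_path_limit:
  assumes B: "fractional_brownian_motion H {0..1} M B" and f: "sk.bounded_lipschitz f"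
  shows "(\<lambda>N. \<integral>\<omega>. f (coarse_path (Suc k) (Suc N) \<omega>) \<partial>white_noise)
    \<longlonglongrightarrow> (\<integral>\<omega>. f (step_path (Suc k) (\<lambda>j. B (min 1 (real j / real (Suc k))) \<omega>)) \<partial>M)"
proof -
  have M: "prob_space M" and g: "gaussian_process M {0..1} B"
    and mean: "\<And>t. t \<in> {0..1} \<Longrightarrow> (\<integral>\<omega>. B t \<omega> \<partial>M) = 0"
    and cov: "\<And>s t. s \<in> {0..1} \<Longrightarrow> t \<in> {0..1} \<Longrightarrow> (\<integral>\<omega>. B s \<omega> * B t \<omega> \<partial>M) = fbm_cov H s t"
    using B unfolding fractional_brownian_motion_def fbm_cov_def by blast+
  have Bm: "B t \<in> borel_measurable M" if "t \<in> {0..1}" for t using g that unfolding gaussian_process_def by blast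
  obtain K L where K: "\<And>x. x \<in> cadlag_paths \<Longrightarrow> \<bar>f x\<bar> \<le> K" and L: "0 \<le> L"
    and lip: "\<And>x y. x \<in> cadlag_paths \<Longrightarrow> y \<in> cadlag_paths \<Longrightarrow> \<bar>f x - f y\<bar> \<le> L * skorohod_dist x y"
    using f unfolding sk.bounded_lipschitz_def by blast
  let ?J = "{..Suc k}"
  have J: "finite ?J" by simp
  define u where "u j = real j / real (Suc k)" for j
  have u: "u j \<in> {0..1}" if "j \<in> ?J" for j
  proof -
    have "real j \<le> real (Suc k)" using that by (simp only: atMost_iff of_nat_le_iff)
    moreover have "0 < real (Suc k)" by simp
    ultimately show ?thesis unfolding u_def by (simp only: atLeastAtMost_iff divide_le_eq_1_pos) simp
  qed
  define h where "h g = f (step_path (Suc k) g)" for g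
  define Z where "Z N j = grid_gauss (Suc N) (nat \<lfloor>real (Suc N) * u j\<rfloor>)" for N j
  have hlip: "\<bar>h x - h y\<bar> \<le> L * l1_dist ?J x y" for x y
  proof -
    have "\<bar>x n - y n\<bar> \<le> l1_dist ?J x y" if "n \<le> Suc k" for n
      unfolding l1_dist_def using that by (intro member_le_sum[where f = "\<lambda>n. \<bar>x n - y n\<bar>"]) simp_all
    then have "skorohod_dist (step_path (Suc k) x) (step_path (Suc k) y) \<le> l1_dist ?J x y" by (rule step_path_dist)
    then have "L * skorohod_dist (step_path (Suc k) x) (step_path (Suc k) y) \<le> L * l1_dist ?J x y" using L by (rule mult_left_mono)
    moreover have "\<bar>h x - h y\<bar> \<le> L * skorohod_dist (step_path (Suc k) x) (step_path (Suc k) y)"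
      unfolding h_def by (rule lip[OF step_path_cadlag step_path_cadlag])
    ultimately show ?thesis by linarith
  qed
  have "(\<lambda>N. \<integral>\<omega>. h (\<lambda>j\<in>?J. Z N j \<omega>) \<partial>white_noise) \<longlonglongrightarrow> (\<integral>\<omega>. h (\<lambda>j\<in>?J. B (u j) \<omega>) \<partial>M)"
  proof (rule levy_continuity_lipschitz[where J = ?J and f = h and K = K and L = L and M = "\<lambda>_. white_noise" and M' = M
        and X = "\<lambda>N \<omega>. \<lambda>j\<in>?J. Z N j \<omega>" and X' = "\<lambda>\<omega>. \<lambda>j\<in>?J. B (u j) \<omega>"])
    show "finite ?J" by (rule J)
    show "prob_space white_noise" by (rule prob_space_white_noise)
    show "prob_space M" by (rule M)
    show "(\<lambda>\<omega>. \<lambda>j\<in>?J. Z N j \<omega>) \<in> white_noise \<rightarrow>\<^sub>M (\<Pi>\<^sub>M t\<in>?J. borel)" for N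
      by (rule measurable_product_topology(2)[OF J]) (unfold Z_def, rule measurable_grid_gauss)
    show "(\<lambda>\<omega>. \<lambda>j\<in>?J. B (u j) \<omega>) \<in> M \<rightarrow>\<^sub>M (\<Pi>\<^sub>M t\<in>?J. borel)"
      by (rule measurable_product_topology(2)[OF J]) (rule Bm, rule u)
    show "h \<in> borel_measurable (\<Pi>\<^sub>M t\<in>?J. borel)" by (rule l1_lipschitz_measurable[OF J hlip L])
    show "\<bar>h y\<bar> \<le> K" for y unfolding h_def by (rule K[OF step_path_cadlag])
    show "\<bar>h x - h y\<bar> \<le> L * l1_dist ?J x y" for x y by (rule hlip)
    fix a :: "nat \<Rightarrow> real"
    have sel: "(\<Sum>t\<in>?J. a t * (\<lambda>j\<in>?J. x j) t) = (\<Sum>t\<in>?J. a t * x t)" for x :: "nat \<Rightarrow> real" by (rule sum.cong) simp_all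
    have inj: "inj_on u ?J" by (rule inj_onI) (simp add: u_def)
    have lim: "(\<integral>\<omega>. iexp (\<Sum>t\<in>?J. a t * B (u t) \<omega>) \<partial>M) =
        complex_of_real (exp (- (\<Sum>s\<in>?J. \<Sum>t\<in>?J. a s * a t * fbm_cov H (u s) (u t)) / 2))"
    proof -
      \<comment> \<open>The formula for Gaussian processes sums over a set of times, here over grid
        indices; the coefficients are carried over by the inverse of the injection
        \<open>u\<close>.\<close>
      let ?a = "\<lambda>t. a (inv_into ?J u t)"
      have inv: "inv_into ?J u (u j) = j" if "j \<in> ?J" for j using inv_into_f_f[OF inj that] .
      have "(\<integral>\<omega>. iexp (\<Sum>t\<in>u ` ?J. ?a t * B t \<omega>) \<partial>M) =
          complex_of_real (exp (- (\<Sum>s\<in>u ` ?J. \<Sum>t\<in>u ` ?J. ?a s * ?a t * fbm_cov H s t) / 2))"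
        by (rule gaussian_process_iexp[OF M g mean cov]) (use u in auto)
      moreover have "(\<Sum>t\<in>u ` ?J. ?a t * x t) = (\<Sum>t\<in>?J. a t * x (u t))" for x
        unfolding sum.reindex[OF inj] comp_def by (rule sum.cong) (simp_all only: inv)
      moreover have "(\<Sum>s\<in>u ` ?J. \<Sum>t\<in>u ` ?J. ?a s * ?a t * fbm_cov H s t) = (\<Sum>s\<in>?J. \<Sum>t\<in>?J. a s * a t * fbm_cov H (u s) (u t))"
        unfolding sum.reindex[OF inj] comp_def by (intro sum.cong refl) (simp_all only: inv)
      ultimately show ?thesis by (simp only:)
    qed
    have kn: "nat \<lfloor>real (Suc N) * u j\<rfloor> \<le> Suc N" if "j \<in> ?J" for j N by (rule step_index[OF u[OF that]])
    have pre: "(\<integral>\<omega>. iexp (\<Sum>t\<in>?J. a t * Z N t \<omega>) \<partial>white_noise) =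
        complex_of_real (exp (- (\<Sum>s\<in>?J. \<Sum>t\<in>?J. a s * a t * (walk_cov H (nat \<lfloor>real (Suc N) * u s\<rfloor>) (nat \<lfloor>real (Suc N) * u t\<rfloor>) / (real (Suc N) powr H)\<^sup>2)) / 2))" for N
      unfolding Z_def by (rule grid_gauss_iexp[OF J kn])
    have "(\<lambda>N. complex_of_real (exp (- (\<Sum>s\<in>?J. \<Sum>t\<in>?J. a s * a t * (walk_cov H (nat \<lfloor>real (Suc N) * u s\<rfloor>) (nat \<lfloor>real (Suc N) * u t\<rfloor>) / (real (Suc N) powr H)\<^sup>2)) / 2)))
        \<longlonglongrightarrow> complex_of_real (exp (- (\<Sum>s\<in>?J. \<Sum>t\<in>?J. a s * a t * fbm_cov H (u s) (u t)) / 2))"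
    proof (intro tendsto_of_real tendsto_exp tendsto_divide tendsto_minus tendsto_sum tendsto_mult tendsto_const)
      fix s t assume "s \<in> ?J" "t \<in> ?J"
      then have "0 \<le> u s" "0 \<le> u t" using u by simp_all
      from LIMSEQ_Suc[OF walk_cov_scaling[OF H this]]
      show "(\<lambda>N. walk_cov H (nat \<lfloor>real (Suc N) * u s\<rfloor>) (nat \<lfloor>real (Suc N) * u t\<rfloor>) / (real (Suc N) powr H)\<^sup>2) \<longlonglongrightarrow> fbm_cov H (u s) (u t)" .
    qed simp
    then show "(\<lambda>N. \<integral>\<omega>. iexp (\<Sum>t\<in>?J. a t * (\<lambda>j\<in>?J. Z N j \<omega>) t) \<partial>white_noise) \<longlonglongrightarrow> (\<integral>\<omega>. iexp (\<Sum>t\<in>?J. a t * (\<lambda>j\<in>?J. B (u j) \<omega>) t) \<partial>M)"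
      unfolding sel pre lim .
  qed
  moreover have "h (\<lambda>j\<in>?J. Z N j \<omega>) = f (coarse_path (Suc k) (Suc N) \<omega>)" for N \<omega>
    unfolding h_def coarse_path_def by (rule arg_cong[where f = f], rule step_path_cong) (simp add: Z_def u_def)
  moreover have "h (\<lambda>j\<in>?J. B (u j) \<omega>) = f (step_path (Suc k) (\<lambda>j. B (min 1 (real j / real (Suc k))) \<omega>))" for \<omega>
  proof -
    have "(\<lambda>j\<in>?J. B (u j) \<omega>) j = B (min 1 (real j / real (Suc k))) \<omega>" if "j \<le> Suc k" for j
    proof -
      have jJ: "j \<in> ?J" using that by simp
      have "u j \<le> 1" using u[OF jJ] by simp
      then have "min 1 (real j / real (Suc k)) = u j" unfolding u_def by (rule min_absorb2)
      then show ?thesis using jJ by (simp only: restrict_apply if_True)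
    qed
    then show ?thesis unfolding h_def by (intro arg_cong[where f = f] step_path_cong)
  qed
  ultimately show ?thesis by (simp only:)
qed

text \<open>Three comparisons: the limit path with its coarse version, uniformly in
  \<open>N\<close>; the coarse version with discretised Brownian motion, for fixed \<open>k\<close>;
  and the latter with \<open>B\<close> itself, by uniform continuity of its paths. Accordingly
  \<open>e\<close> is chosen first, then \<open>k\<close>, then \<open>N\<close>.\<close>

theorem limit_path_converges_lipschitz:
  assumes B: "fractional_brownian_motion H {0..1} M B" and f: "sk.bounded_lipschitz f"
  shows "(\<lambda>N. \<integral>\<omega>. f (limit_path (Suc N) \<omega>) \<partial>white_noise) \<longlonglongrightarrow> (\<integral>\<omega>. f (\<lambda>t\<in>{0..1}. B t \<omega>) \<partial>M)"
proof -
  have M: "prob_space M" and g: "gaussian_process M {0..1} B"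
    and cont: "\<And>\<omega>. \<omega> \<in> space M \<Longrightarrow> continuous_on {0..1} (\<lambda>t. B t \<omega>)"
    using B unfolding fractional_brownian_motion_def by blast+
  interpret M: prob_space M by (rule M)
  have Bm: "B t \<in> borel_measurable M" if "t \<in> {0..1}" for t using g that unfolding gaussian_process_def by blast
  obtain K L where K: "\<And>x. x \<in> cadlag_paths \<Longrightarrow> \<bar>f x\<bar> \<le> K" and L: "0 \<le> L"
    and lip: "\<And>x y. x \<in> cadlag_paths \<Longrightarrow> y \<in> cadlag_paths \<Longrightarrow> \<bar>f x - f y\<bar> \<le> L * skorohod_dist x y"
    using f unfolding sk.bounded_lipschitz_def by blast
  have fm: "f \<in> borel_measurable (borel_sets_of skorohod_topology)"
    by (rule continuous_map_borel_measurable[OF skorohod.lipschitz_continuous_map[OF L lip]])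
  define b where "b k \<omega> = step_path (Suc k) (\<lambda>j. B (min 1 (real j / real (Suc k))) \<omega>)" for k \<omega>
  have bm: "b k \<in> M \<rightarrow>\<^sub>M borel_sets_of skorohod_topology" for k
    unfolding b_def[abs_def] by (rule measurable_step_path) (intro Bm, simp)
  have Bp: "(\<lambda>\<omega>. \<lambda>t\<in>{0..1}. B t \<omega>) \<in> M \<rightarrow>\<^sub>M borel_sets_of skorohod_topology"
    by (rule measurable_continuous_process[OF Bm cont])
  have third: "(\<lambda>k. \<integral>\<omega>. f (b k \<omega>) \<partial>M) \<longlonglongrightarrow> (\<integral>\<omega>. f (\<lambda>t\<in>{0..1}. B t \<omega>) \<partial>M)"
  proof (rule integral_dominated_convergence[where w = "\<lambda>_. K"])
    show "(\<lambda>\<omega>. f (\<lambda>t\<in>{0..1}. B t \<omega>)) \<in> borel_measurable M" by (rule measurable_compose[OF Bp fm])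
    show "(\<lambda>\<omega>. f (b k \<omega>)) \<in> borel_measurable M" for k by (rule measurable_compose[OF bm fm])
    show "AE \<omega> in M. norm (f (b k \<omega>)) \<le> K" for k
      unfolding b_def real_norm_def by (intro AE_I2 K step_path_cadlag)
    show "AE \<omega> in M. (\<lambda>k. f (b k \<omega>)) \<longlonglongrightarrow> f (\<lambda>t\<in>{0..1}. B t \<omega>)"
    proof (rule AE_I2)
      fix \<omega> assume w: "\<omega> \<in> space M"
      let ?B = "\<lambda>t\<in>{0..1}. B t \<omega>"
      have Bc: "?B \<in> cadlag_paths" by (rule continuous_cadlag[OF cont[OF w]])
      show "(\<lambda>k. f (b k \<omega>)) \<longlonglongrightarrow> f ?B"
      proof (rule LIMSEQ_I)
        fix e :: real assume e: "0 < e"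
        have L1: "0 < L + 1" using L by linarith
        have e1: "0 < e / (L + 1)" using e L1 by (rule divide_pos_pos)
        obtain k0 where k0: "\<And>k. k \<ge> k0 \<Longrightarrow> skorohod_dist (step_path (Suc k) (\<lambda>j. B (real j / real (Suc k)) \<omega>)) ?B \<le> e / (L + 1)"
          using step_path_continuous_limit[OF cont[OF w] e1] by blast
        have "norm (f (b k \<omega>) - f ?B) < e" if "k \<ge> k0" for k
        proof -
          have bk: "b k \<omega> = step_path (Suc k) (\<lambda>j. B (real j / real (Suc k)) \<omega>)"
            unfolding b_def
          proof (rule step_path_cong)
            fix n assume "n \<le> Suc k"
            then have "real n \<le> real (Suc k)" by (simp only: of_nat_le_iff)
            then have "real n / real (Suc k) \<le> 1" by simp
            then show "B (min 1 (real n / real (Suc k))) \<omega> = B (real n / real (Suc k)) \<omega>" by (simp only: min_absorb2)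
          qed
          have "\<bar>f (b k \<omega>) - f ?B\<bar> \<le> L * skorohod_dist (b k \<omega>) ?B"
            unfolding bk by (rule lip[OF step_path_cadlag Bc])
          also have "\<dots> \<le> L * (e / (L + 1))" unfolding bk by (rule mult_left_mono[OF k0[OF that] L])
          also have "\<dots> < (L + 1) * (e / (L + 1))" using e1 by (intro mult_strict_right_mono) simp_all
          also have "\<dots> = e" using L1 by simp
          finally show ?thesis by (simp only: real_norm_def)
        qed
        then show "\<exists>no. \<forall>n\<ge>no. norm (f (b n \<omega>) - f ?B) < e" by blast
      qed
    qed
  qed simp
  obtain G p where p: "0 < (p::nat)" and G: "0 \<le> G"
    and err0: "\<forall>k N e. 0 < k \<longrightarrow> k \<le> N \<longrightarrow> 0 < e \<longrightarrow>
      (\<exists>D. integrable white_noise D \<and> (\<forall>\<omega>. skorohod_dist (limit_path N \<omega>) (coarse_path k N \<omega>) \<le> D \<omega>) \<and>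
        (\<integral>\<omega>. D \<omega> \<partial>white_noise) \<le> e + G / (real k * e ^ (p - 1)))"
    using coarse_path_error by (elim exE conjE)
  note err = err0[rule_format]
  have first: "\<bar>(\<integral>\<omega>. f (limit_path N \<omega>) \<partial>white_noise) - (\<integral>\<omega>. f (coarse_path k N \<omega>) \<partial>white_noise)\<bar> \<le> L * (e + G / (real k * e ^ (p - 1)))"
    if kN: "0 < k" "k \<le> N" and e: "0 < e" for k N e
  proof -
    obtain D where iD: "integrable white_noise D" and D: "\<And>\<omega>. skorohod_dist (limit_path N \<omega>) (coarse_path k N \<omega>) \<le> D \<omega>"
      and bD: "(\<integral>\<omega>. D \<omega> \<partial>white_noise) \<le> e + G / (real k * e ^ (p - 1))"
      using err[OF kN e] by blast
    have c1: "limit_path N \<omega> \<in> cadlag_paths" "coarse_path k N \<omega> \<in> cadlag_paths" for \<omega>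
      unfolding limit_path_def coarse_path_def by (rule step_path_cadlag)+
    have i1: "integrable white_noise (\<lambda>\<omega>. f (limit_path N \<omega>))"
      using K[OF c1(1)] by (intro WN.integrable_const_bound[where B = K] AE_I2 measurable_compose[OF measurable_limit_path fm]) simp
    have i2: "integrable white_noise (\<lambda>\<omega>. f (coarse_path k N \<omega>))"
      using K[OF c1(2)] by (intro WN.integrable_const_bound[where B = K] AE_I2 measurable_compose[OF measurable_coarse_path fm]) simp
    have "\<bar>\<integral>\<omega>. f (limit_path N \<omega>) - f (coarse_path k N \<omega>) \<partial>white_noise\<bar> \<le> (\<integral>\<omega>. L * D \<omega> \<partial>white_noise)"
    proof (rule abs_integral_le)
      show "integrable white_noise (\<lambda>\<omega>. f (limit_path N \<omega>) - f (coarse_path k N \<omega>))" by (rule Bochner_Integration.integrable_diff[OF i1 i2])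
      show "integrable white_noise (\<lambda>\<omega>. L * D \<omega>)" by (rule integrable_mult_right[OF iD])
      show "\<bar>f (limit_path N \<omega>) - f (coarse_path k N \<omega>)\<bar> \<le> L * D \<omega>" for \<omega>
        using lip[OF c1] mult_left_mono[OF D L] by (rule order_trans)
    qed
    also have "\<dots> = L * (\<integral>\<omega>. D \<omega> \<partial>white_noise)" by (rule integral_mult_right_zero)
    also have "\<dots> \<le> L * (e + G / (real k * e ^ (p - 1)))" by (rule mult_left_mono[OF bD L])
    finally show ?thesis unfolding Bochner_Integration.integral_diff[OF i1 i2] .
  qed
  let ?lim = "\<integral>\<omega>. f (\<lambda>t\<in>{0..1}. B t \<omega>) \<partial>M"
  show ?thesis
  proof (rule LIMSEQ_I)
    fix r :: real assume r: "0 < r"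
    \<comment> \<open>Each comparison is allowed \<open>r / 4\<close>. The first one has two parts
      of size \<open>r / 8\<close>: this choice controls \<open>L * e\<close>, and a large
      \<open>k\<close> controls the rest. The denominator stays positive for
      \<open>L = 0\<close>.\<close>
    define e where "e = r / (8 * (L + 1))"
    have L1: "0 < L + 1" using L by linarith
    have e: "0 < e" unfolding e_def using r L1 by simp
    have Le: "L * e \<le> r / 8"
    proof -
      have "L * e \<le> (L + 1) * e" using e by (intro mult_right_mono) simp_all
      also have "\<dots> = r / 8"
      proof -
        have "c * (x / (8 * c)) = x / 8" if "c \<noteq> 0" for x c :: real
          using that by simp
        moreover have "L + 1 \<noteq> 0"
          using L1 by linarith
        ultimately show ?thesis
          unfolding e_def by blast
      qed
      finally show ?thesis .
    qed
    have "(\<lambda>k. L * G / e ^ (p - 1) / real k) \<longlonglongrightarrow> 0" by (rule lim_const_over_n)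
    then have "(\<lambda>k. L * G / e ^ (p - 1) / real (Suc k)) \<longlonglongrightarrow> 0" by (rule LIMSEQ_Suc)
    then have "eventually (\<lambda>k. L * G / e ^ (p - 1) / real (Suc k) < r / 8) sequentially"
      by (rule order_tendstoD(2)) (use r in simp)
    moreover have "eventually (\<lambda>k. dist (\<integral>\<omega>. f (b k \<omega>) \<partial>M) ?lim < r / 4) sequentially"
      by (rule tendstoD[OF third]) (use r in simp)
    ultimately have "eventually (\<lambda>k. L * G / e ^ (p - 1) / real (Suc k) < r / 8 \<and> dist (\<integral>\<omega>. f (b k \<omega>) \<partial>M) ?lim < r / 4) sequentially"
      by (rule eventually_conj)
    then obtain k where k1: "L * G / e ^ (p - 1) / real (Suc k) < r / 8" and k2: "dist (\<integral>\<omega>. f (b k \<omega>) \<partial>M) ?lim < r / 4"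
      unfolding eventually_sequentially by blast
    have k1': "L * (G / (real (Suc k) * e ^ (p - 1))) < r / 8"
    proof -
      have "L * (G / (real (Suc k) * e ^ (p - 1))) = L * G / e ^ (p - 1) / real (Suc k)"
        by (simp only: times_divide_eq_right divide_divide_eq_left mult.commute)
      then show ?thesis using k1 by (simp only:)
    qed
    obtain N0 where N0: "\<And>N. N \<ge> N0 \<Longrightarrow> norm ((\<integral>\<omega>. f (coarse_path (Suc k) (Suc N) \<omega>) \<partial>white_noise) - (\<integral>\<omega>. f (b k \<omega>) \<partial>M)) < r / 4"
      using LIMSEQ_D[OF coarse_path_limit[OF B f, of k], of "r / 4"] r unfolding b_def by auto
    have "norm ((\<integral>\<omega>. f (limit_path (Suc N) \<omega>) \<partial>white_noise) - ?lim) < r" if N: "N \<ge> max N0 k" for N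
    proof -
      have "Suc k \<le> Suc N" "0 < Suc k" using N by simp_all
      note F = first[OF this(2,1) e]
      have "L * (e + G / (real (Suc k) * e ^ (p - 1))) < r / 4"
        unfolding distrib_left using Le k1' by linarith
      moreover have "N \<ge> N0" using N by simp
      note N0[OF this]
      ultimately show ?thesis using F k2 unfolding real_norm_def dist_real_def by linarith
    qed
    then show "\<exists>no. \<forall>n\<ge>no. norm ((\<integral>\<omega>. f (limit_path (Suc n) \<omega>) \<partial>white_noise) - ?lim) < r" by blast
  qed
qed

theorem limit_path_converges_in_law:
  assumes B: "fractional_brownian_motion H {0..1} M B"
  shows "converges_in_law skorohod_topology (\<lambda>_. white_noise) (\<lambda>N. limit_path (Suc N)) M (\<lambda>\<omega>. \<lambda>t\<in>{0..1}. B t \<omega>)"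
  unfolding converges_in_law_def
proof (intro conjI allI impI)
  have g: "gaussian_process M {0..1} B"
    and cont: "\<And>\<omega>. \<omega> \<in> space M \<Longrightarrow> continuous_on {0..1} (\<lambda>t. B t \<omega>)"
    using B unfolding fractional_brownian_motion_def by blast+
  show M: "prob_space M" using B unfolding fractional_brownian_motion_def by blast
  have Bm: "B t \<in> borel_measurable M" if "t \<in> {0..1}" for t using g that unfolding gaussian_process_def by blast
  show "prob_space white_noise" by (rule prob_space_white_noise)
  show mZ: "limit_path (Suc N) \<in> white_noise \<rightarrow>\<^sub>M borel_sets_of skorohod_topology" for N by (rule measurable_limit_path)
  show mB: "(\<lambda>\<omega>. \<lambda>t\<in>{0..1}. B t \<omega>) \<in> M \<rightarrow>\<^sub>M borel_sets_of skorohod_topology"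
    by (rule measurable_continuous_process[OF Bm cont])
  fix f assume f: "continuous_map skorohod_topology euclideanreal f \<and> bounded (f ` topspace skorohod_topology)"
  obtain K where K: "\<And>x. x \<in> cadlag_paths \<Longrightarrow> \<bar>f x\<bar> \<le> K"
    using f unfolding skorohod.topspace_mtopology bounded_iff by auto
  note fm = continuous_map_borel_measurable[OF conjunct1[OF f]]
  have hm: "h \<in> borel_measurable (borel_sets_of skorohod_topology)" if h: "sk.bounded_lipschitz h" for h
  proof -
    obtain L where L: "0 \<le> L" "\<And>x y. x \<in> cadlag_paths \<Longrightarrow> y \<in> cadlag_paths \<Longrightarrow> \<bar>h x - h y\<bar> \<le> L * skorohod_dist x y"
      using h unfolding sk.bounded_lipschitz_def by blast
    show ?thesis by (rule continuous_map_borel_measurable[OF skorohod.lipschitz_continuous_map[OF L]])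
  qed
  show "(\<lambda>N. \<integral>\<omega>. f (limit_path (Suc N) \<omega>) \<partial>white_noise) \<longlonglongrightarrow> (\<integral>\<omega>. f (\<lambda>t\<in>{0..1}. B t \<omega>) \<partial>M)"
  proof (rule sk.convergence_of_lipschitz[where M = "\<lambda>_. white_noise" and M' = M and K = K and f = f
        and X = "\<lambda>N. limit_path (Suc N)" and X' = "\<lambda>\<omega>. \<lambda>t\<in>{0..1}. B t \<omega>"])
    show "prob_space white_noise" by (rule prob_space_white_noise)
    show "prob_space M" by (rule M)
    show "limit_path (Suc N) \<omega> \<in> cadlag_paths" for N \<omega> unfolding limit_path_def by (rule step_path_cadlag)
    show "(\<lambda>t\<in>{0..1}. B t \<omega>) \<in> cadlag_paths" if "\<omega> \<in> space M" for \<omega> by (rule continuous_cadlag[OF cont[OF that]])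
    show "(\<lambda>\<omega>. f (limit_path (Suc N) \<omega>)) \<in> borel_measurable white_noise" for N by (rule measurable_compose[OF mZ fm])
    show "(\<lambda>\<omega>. f (\<lambda>t\<in>{0..1}. B t \<omega>)) \<in> borel_measurable M" by (rule measurable_compose[OF mB fm])
    show "\<bar>f x\<bar> \<le> K" if "x \<in> cadlag_paths" for x by (rule K[OF that])
    show "\<exists>r>0. \<forall>y\<in>cadlag_paths. skorohod_dist x y < r \<longrightarrow> \<bar>f y - f x\<bar> < e" if "x \<in> cadlag_paths" "e > 0" for x e
      using conjunct1[OF f] that unfolding skorohod.continuous_map_real_iff by blast
    fix h assume h: "sk.bounded_lipschitz h"
    show "(\<lambda>\<omega>. h (limit_path (Suc N) \<omega>)) \<in> borel_measurable white_noise" for N by (rule measurable_compose[OF mZ hm[OF h]])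
    show "(\<lambda>\<omega>. h (\<lambda>t\<in>{0..1}. B t \<omega>)) \<in> borel_measurable M" by (rule measurable_compose[OF mB hm[OF h]])
    show "(\<lambda>N. \<integral>\<omega>. h (limit_path (Suc N) \<omega>) \<partial>white_noise) \<longlonglongrightarrow> (\<integral>\<omega>. h (\<lambda>t\<in>{0..1}. B t \<omega>) \<partial>M)"
      by (rule limit_path_converges_lipschitz[OF B h])
  qed
qed

end

theorem theorem3:
  fixes H :: real
    and P :: "'a measure" and Y :: "nat \<Rightarrow> 'a \<Rightarrow> nat \<Rightarrow> real"
    and M :: "'b measure" and B :: "real \<Rightarrow> 'b \<Rightarrow> real"
  assumes "0 < H" and "H < 1 / 2"
    and "prob_space P"
    and "prob_space.indep_vars P (\<lambda>_. seq_space) Y {1..}"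
    and "\<And>i. i \<ge> 1 \<Longrightarrow> distr P seq_space (Y i) = Q_mix (mu_H H)"
    and "fractional_brownian_motion H {0..1} M B"
  shows "\<exists>(W :: nat \<Rightarrow> (real \<Rightarrow> real) measure) (Z :: nat \<Rightarrow> real \<Rightarrow> (real \<Rightarrow> real) \<Rightarrow> real).
           (\<forall>N\<ge>1. fidi_converges {0..1} P (normalised_sum H Y N) (W N) (Z N)) \<and>
           converges_in_law skorohod_topology
             (\<lambda>N. W (Suc N)) (\<lambda>N \<omega>. \<lambda>t\<in>{0..1}. Z (Suc N) t \<omega>)
             M (\<lambda>\<omega>. \<lambda>t\<in>{0..1}. B t \<omega>)"
proof -
  have "\<forall>N. \<exists>A. \<forall>i<Suc N. \<forall>j<Suc N. walk_cov H i j = (\<Sum>l<Suc N. A i l * A j l)"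
    using walk_cov_cholesky[OF assms(1,2)] by blast
  from choice[OF this] obtain A where A: "\<forall>N. \<forall>i<Suc N. \<forall>j<Suc N. walk_cov H i j = (\<Sum>l<Suc N. A N i l * A N j l)" ..
  interpret walk_limit H A
  proof
    show "0 < H" "H < 1 / 2" by (rule assms(1), rule assms(2))
    show "walk_cov H i j = (\<Sum>l<Suc N. A N i l * A N j l)" if "i \<le> N" "j \<le> N" for N i j
      using A that by (simp only: less_Suc_eq_le)
  qed
  show ?thesis
  \<comment> \<open>Only the laws of the limit processes matter, so a single Gaussian space serves
    every \<open>N\<close>.\<close>
  proof (intro exI[of _ "\<lambda>_. white_noise"] exI[of _ limit_process] conjI allI impI)
    show "fidi_converges {0..1} P (normalised_sum H Y N) white_noise (limit_process N)" for N
      by (rule fidi_converges_limit_process[OF assms(3-5)])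
    show "converges_in_law skorohod_topology (\<lambda>N. white_noise) (\<lambda>N \<omega>. \<lambda>t\<in>{0..1}. limit_process (Suc N) t \<omega>)
        M (\<lambda>\<omega>. \<lambda>t\<in>{0..1}. B t \<omega>)"
      using limit_path_converges_in_law[OF assms(6)] unfolding limit_path_eq[abs_def] .
  qed
qed

end
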